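(* Let $n$ be a positive integer, let $\mathsf D$ be the vector field on $\mathsf T=\mathsf T_n$ given either by Option 1 or by Option 2, let $\widetilde{\mathcal M}$ and $\mathcal M\subset\widetilde{\mathcal M}$ be the associated graded algebras of Calabi-Yau quasi-modular forms and of Calabi-Yau modular forms for the Dwork family, let $\mathcal D$ be the derivation of $\widetilde{\mathcal M}$ induced by $\mathsf D$, and let $\partial$ be the Ramanujan-Serre type derivation (all as defined in the context). Then: (1) $\mathcal D$ is a degree $2$ differential operator on $\widetilde{\mathcal M}$, i.e. $\mathcal D(\widetilde{\mathcal M}_r)\subseteq\widetilde{\mathcal M}_{r+2}$ for all integers $r$; (2) $\partial$ is a degree $2$ differential operator on $\mathcal M$, i.e. $\partial(\mathcal M_r)\subseteq\mathcal M_{r+2}$ for all integers $r$ (in particular $\mathcal M$ is closed under $\partial$).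
   Context: **The moduli space $\mathsf T$.** Fix $n\ge 1$. Put $m=\frac{n+1}2$ if $n$ is odd, $m=\frac n2$ if $n$ is even; $d=\frac{(n+1)(n+3)}4+1$ if $n$ is odd, $d=\frac{n(n+2)}4+1$ if $n$ is even. $\mathsf T=\mathsf T_n$ is the moduli space of pairs $(X,[\alpha_1,\dots,\alpha_{n+1}])$, where $X$ is a mirror $n$-fold of the Dwork family (desingularized quotient of $t_{n+2}x_0^{n+2}+x_1^{n+2}+\dots+x_{n+1}^{n+2}-(n+2)t_1x_0\cdots x_{n+1}=0$ by the group of $(\zeta_0,\dots,\zeta_{n+1})$ with $\zeta_i^{n+2}=1$, $\prod\zeta_i=1$) and $\alpha_1,\dots,\alpha_{n+1}$ is a basis of $H^n_{\rm dR}(X)$ with $\alpha_i\in F^{n+1-i}\setminus F^{n+2-i}$ (Hodge filtration) and intersection matrix $(\langle\alpha_i,\alpha_j\rangle)=\Phi$, where $\Phi=\begin{pmatrix}0&J_m\\-J_m&0\end{pmatrix}$ for $n$ odd, $\Phi=J_{n+1}$ for $n$ even, $J_k$ being the $k\times k$ matrix with $1$'s on the antidiagonal and $0$ elsewhere. It has the following explicit description. Let $B$ be the $(n+1)\times(n+1)$ matrix of $1$-forms in $t_1,t_{n+2}$ (Gauss-Manin matrix in a basis $\omega=(\omega_1,\dots,\omega_{n+1})^{\rm tr}$) with entries: $B[i,i]=-\frac{i}{(n+2)t_{n+2}}dt_{n+2}$ and $B[i,i+1]=dt_1-\frac{t_1}{(n+2)t_{n+2}}dt_{n+2}$ for $1\le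 i\le n$; $B[n+1,j]=\frac{-S_2(n+2,j)t_1^j}{t_1^{n+2}-t_{n+2}}dt_1+\frac{S_2(n+2,j)t_1^{j+1}}{(n+2)t_{n+2}(t_1^{n+2}-t_{n+2})}dt_{n+2}$ for $1\le j\le n$; $B[n+1,n+1]=\frac{-S_2(n+2,n+1)t_1^{n+1}}{t_1^{n+2}-t_{n+2}}dt_1+\frac{\frac{n(n+1)}2t_1^{n+2}+(n+1)t_{n+2}}{(n+2)t_{n+2}(t_1^{n+2}-t_{n+2})}dt_{n+2}$; all other entries $0$. Here $S_2$ denotes Stirling numbers of the second kind. Let $\Omega=(\langle\omega_i,\omega_j\rangle)$ be the $(-1)^n$-symmetric matrix determined by $\Omega_{ij}=0$ for $i+j\le n+1$, $\Omega_{1,n+1}=(-(n+2))^n\frac{c_n}{t_1^{n+2}-t_{n+2}}$ ($c_n$ a fixed nonzero constant), $\Omega_{j,n+2-j}=(-1)^{j-1}\Omega_{1,n+1}$, and $d\Omega=B\Omega+\Omega B^{\rm tr}$. Points of $\mathsf T$ are given by $(t_1,t_{n+2})$ with $t_{n+2}(t_1^{n+2}-t_{n+2})\ne0$ and an invertible lower triangular matrix $S=(s_{ij})$ with $s_{11}=1$ and $S\Omega S^{\rm tr}=\Phi$; then $\alpha=S\omega$. Independent coordinates: the entries $s_{ij}$, $i\ge j$, $(i,j)\neq(1,1)$, with $i+j\le n+2$ ($n$ odd) or $i+j<n+2$ ($n$ even), read from left to right and top to bottom, are named $t_2,t_3,\dots$ in order, skipping the index $n+2$ (already used). So $t_2=s_{21}$.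 Let $I=\{1,\dots,d\}$ if $n\ne2$, $I=\{1,2,4\}$ if $n=2$; $(t_j)_{j\in I}$ is the chart. For $n$ even let in addition $u=s_{\frac{n+2}2\frac{n+2}2}$, so $u^2=\frac{(-1)^{n/2}}{c_n(n+2)^n}(t_1^{n+2}-t_{n+2})$ ($u$ is called $t_{d+1}$, and $t_3$ when $n=2$). All other entries of $S$ are regular functions of these, and $\mathcal O_{\mathsf T}=\mathbb C\big[t_j\,(j\in I),\,u,\,\frac1{t_{n+2}(t_{n+2}-t_1^{n+2})\check t}\big]$ ($u$ present only for $n$ even, subject to its quadratic relation), where $\check t$ is the product of the $m-1$ coordinates $t_j$ lying on the main diagonal of $S$. Vector fields on $\mathsf T$ are $\mathbb C$-derivations of $\mathcal O_{\mathsf T}$, written $\sum_{j\in I}E^j\frac{\partial}{\partial t_j}$ ($\frac{\partial}{\partial t_j}$ extends uniquely to $u$). **Vector fields.** For a vector field $E$ its Gauss-Manin matrix $A_E$ (i.e. $\nabla_E\alpha=A_E\alpha$) is determined by $E(S)=A_ES-S\,B(E)$, with $E(S)$ taken entrywise; $E$ is determined by $A_E$. - The modular vector field $\mathsf R$ is the unique vector field for which there are regular functions $\mathsf Y_1,\dots,\mathsf Y_{n-2}$ such that $A_{\mathsf R}=\mathsf Y$, where $\mathsf Y$ has superdiagonal $(1,\mathsf Y_1,\dots,\mathsf Y_{n-2},-1)$ (for $n=2$: $(1,-1)$; for $n=1$: $(1)$) and zeros elsewhere, and $\mathsf Y\Phi+\Phi\mathsf Y^{\rm tr}=0$. - For $\mathfrak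 g$ upper triangular with $\mathfrak g^{\rm tr}\Phi+\Phi\mathfrak g=0$, $\mathsf R_{\mathfrak g}$ is the unique vector field with $A_{\mathsf R_{\mathfrak g}}=\mathfrak g^{\rm tr}$. With $E_{ij}$ the matrix units put $\mathfrak g_{11}=E_{11}-E_{n+1,n+1}$ and, for $n\ge3$, $\mathfrak g_{22}=E_{22}-E_{nn}$. - $\mathsf H:=-\mathsf R_{\mathfrak g_{11}}$ if $n=1$, $\mathsf H:=-2\mathsf R_{\mathfrak g_{11}}$ if $n=2$, $\mathsf H:=\mathsf R_{\mathfrak g_{22}}-\mathsf R_{\mathfrak g_{11}}$ if $n\ge3$. One has $\mathsf H=\sum_{j\in I}w_jt_j\frac{\partial}{\partial t_j}$ with non-negative integers $w_j$: for $n=1$, $(w_1,w_2,w_3)=(1,2,3)$; for $n=2$, $(w_1,w_2,w_4)=(2,2,8)$; for $n\ge3$, $w_1=1$, $w_{n+2}=n+2$, and if $t_j=s_{ik}$ then $w_j=k+1$ for $i\in\{2,n+1\}$, $w_j=k$ for $3\le i\le n-1$, $w_j=k-1$ for $i=n$. **Weights.** $\deg t_j=w_j$, and for $n$ even $\deg u=\frac{n+2}2$ if $n\ge4$, $\deg u=4$ if $n=2$. This makes $\mathcal O_{\mathsf T}$ $\mathbb Z$-graded. **The vector field $\mathsf D$.** Let $\delta_2^n$ be the Kronecker delta. Option 1: $\mathsf D:=\mathsf R$, but for odd $n\ge3$ the coordinate $t_d$ of the chart is replaced by $\tilde t_d:=t_7+t_2t_4$ if $n=3$ (here $d=7$), $\tilde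 t_d:=t_d+t_2t_{d-2}$ if $n\ge5$; $\tilde t_d$ has weight $w_d=2$ and is again denoted $t_d$, and all partial derivatives $\frac{\partial}{\partial t_j}$ are with respect to the new chart. Option 2: the original chart is kept and $\mathsf D:=\mathsf R+t_2\big([\mathsf R,(1+\delta_2^n)\frac{\partial}{\partial t_2}]-\mathsf H\big)$. **Calabi-Yau (quasi-)modular forms.** Let $\mathsf t_j$ ($j\in I$; and $\mathsf u$ for $n$ even) be the components of a solution of $\mathsf D$, $\mathsf t_j$ corresponding to the coordinate $t_j$ of the chart used in the chosen option, with $\deg\mathsf t_j=w_j$ (and $\deg \mathsf u=\deg u$). $\widetilde{\mathcal M}$ is the $\mathbb C$-algebra $\mathbb C\big[\mathsf t_j\,(j\in I),\,\mathsf u,\,\frac1{\mathsf t_{n+2}(\mathsf t_{n+2}-\mathsf t_1^{n+2})\check{\mathsf t}}\big]$ and $\mathcal M$ is its subalgebra generated by the same elements with $\mathsf t_2$ omitted, so $\widetilde{\mathcal M}=\mathcal M[\mathsf t_2]$; $\check{\mathsf t}$ corresponds to $\check t$. The $\mathsf t_j$ are treated as independent variables, i.e. $\widetilde{\mathcal M}$ is identified with $\mathcal O_{\mathsf T}$ as a graded algebra via $\mathsf t_j\leftrightarrow t_j$, $\mathsf u\leftrightarrow u$. $\widetilde{\mathcal M}_r$, $\mathcal M_r$ ($r\in\mathbb Z$) denote the weight $r$ parts. $\mathcal D$ is the derivation of $\widetilde{\mathcal M}$ obtained from $\mathsf D$ by replacing $t_j$ by $\mathsf t_j$ and $\frac{\partial}{\partial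 t_j}$ by $\frac{\partial}{\partial\mathsf t_j}$. The Ramanujan-Serre type derivation $\partial$ is defined by $\partial f:=\mathcal Df+(1-\frac12\delta_2^n)\,r\,\mathsf t_2f$ for $f\in\widetilde{\mathcal M}_r$, $r\in\mathbb Z$. *)

theory Defs
  imports
    "HOL-Analysis.Product_Vector"
    "HOL-Combinatorics.Stirling"
    "Jordan_Normal_Form.Matrix"
begin

subsection \<open>Matrices with rows and columns numbered from 1\<close>

text \<open>The library numbers matrix entries from 0; all index formulas below use the
  1-based numbering of the mathematical text, through these two functions.\<close>

definition entry :: "'a mat \<Rightarrow> nat \<Rightarrow> nat \<Rightarrow> 'a" where
  "entry A i j = A $$ (i - 1, j - 1)"

definition mat1 :: "nat \<Rightarrow> (nat \<Rightarrow> nat \<Rightarrow> 'a) \<Rightarrow> 'a mat" where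
  "mat1 k f = mat k k (\<lambda>(i, j). f (Suc i) (Suc j))"


subsection \<open>The moduli space\<close>

definition dwork_m :: "nat \<Rightarrow> nat" where
  "dwork_m n = (if odd n then (n + 1) div 2 else n div 2)"

definition dwork_d :: "nat \<Rightarrow> nat" where
  "dwork_d n = (if odd n then (n + 1) * (n + 3) div 4 + 1 else n * (n + 2) div 4 + 1)"

definition Phi :: "nat \<Rightarrow> complex mat" where
  "Phi n = mat1 (n + 1) (\<lambda>i j.
     if i + j = n + 2 then (if odd n \<and> i > dwork_m n then -1 else 1) else 0)"

text \<open>\<open>GM_B n a b x y\<close> is the matrix \<open>B\<close> of 1-forms at the point \<open>(t\<^sub>1, t\<^sub>n\<^sub>+\<^sub>2) = (a, b)\<close>,
  evaluated on the tangent vector with \<open>dt\<^sub>1 = x\<close> and \<open>dt\<^sub>n\<^sub>+\<^sub>2 = y\<close>.\<close>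

definition GM_B :: "nat \<Rightarrow> complex \<Rightarrow> complex \<Rightarrow> complex \<Rightarrow> complex \<Rightarrow> complex mat" where
  "GM_B n a b x y = mat1 (n + 1) (\<lambda>i j.
     if i \<le> n then
       (if j = i then - (of_nat i / (of_nat (n + 2) * b)) * y
        else if j = i + 1 then x - a / (of_nat (n + 2) * b) * y
        else 0)
     else if j \<le> n then
       - (of_nat (Stirling (n + 2) j) * a ^ j) / (a ^ (n + 2) - b) * x
       + (of_nat (Stirling (n + 2) j) * a ^ (j + 1))
           / (of_nat (n + 2) * b * (a ^ (n + 2) - b)) * y
     else
       - (of_nat (Stirling (n + 2) (n + 1)) * a ^ (n + 1)) / (a ^ (n + 2) - b) * x
       + (of_nat n * of_nat (n + 1) / 2 * a ^ (n + 2) + of_nat (n + 1) * b)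
           / (of_nat (n + 2) * b * (a ^ (n + 2) - b)) * y)"

text \<open>The defining properties of \<open>\<Omega> = (\<langle>\<omega>\<^sub>i, \<omega>\<^sub>j\<rangle>)\<close>, with constant \<open>c = c\<^sub>n\<close>, on the domain
  \<open>t\<^sub>n\<^sub>+\<^sub>2 (t\<^sub>1\<^sup>n\<^sup>+\<^sup>2 - t\<^sub>n\<^sub>+\<^sub>2) \<noteq> 0\<close>. The last clause is \<open>d\<Omega> = B \<Omega> + \<Omega> B\<^sup>t\<^sup>r\<close>: the
  (complex linear) total differential of each entry is the corresponding entry of the right-hand
  side. These properties determine \<open>\<Omega>\<close> on that domain.\<close>

definition intersection_matrix ::
    "nat \<Rightarrow> complex \<Rightarrow> (complex \<Rightarrow> complex \<Rightarrow> complex mat) \<Rightarrow> bool" where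
  "intersection_matrix n c \<Omega> \<longleftrightarrow>
     (\<forall>a b. b * (a ^ (n + 2) - b) \<noteq> 0 \<longrightarrow>
        \<Omega> a b \<in> carrier_mat (n + 1) (n + 1) \<and>
        transpose_mat (\<Omega> a b) = ((-1) ^ n) \<cdot>\<^sub>m \<Omega> a b \<and>
        (\<forall>i\<in>{1..n+1}. \<forall>j\<in>{1..n+1}. i + j \<le> n + 1 \<longrightarrow> entry (\<Omega> a b) i j = 0) \<and>
        entry (\<Omega> a b) 1 (n + 1) = (- of_nat (n + 2)) ^ n * (c / (a ^ (n + 2) - b)) \<and>
        (\<forall>j\<in>{1..n+1}. entry (\<Omega> a b) j (n + 2 - j) = (-1) ^ (j - 1) * entry (\<Omega> a b) 1 (n + 1)) \<and>
        (\<forall>i\<in>{1..n+1}. \<forall>j\<in>{1..n+1}.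
           ((\<lambda>(a', b'). entry (\<Omega> a' b') i j) has_derivative
            (\<lambda>(x, y). entry (GM_B n a b x y * \<Omega> a b + \<Omega> a b * transpose_mat (GM_B n a b x y)) i j))
           (at (a, b))))"

text \<open>A point \<open>(t\<^sub>1, t\<^sub>n\<^sub>+\<^sub>2, S)\<close> of the moduli space stands for the basis \<open>\<alpha> = S \<omega>\<close>.\<close>

type_synonym point = "complex \<times> complex \<times> complex mat"

definition moduli_T :: "nat \<Rightarrow> (complex \<Rightarrow> complex \<Rightarrow> complex mat) \<Rightarrow> point set" where
  "moduli_T n \<Omega> = {(a, b, S).
     b * (a ^ (n + 2) - b) \<noteq> 0 \<and>
     S \<in> carrier_mat (n + 1) (n + 1) \<and> invertible_mat S \<and>
     (\<forall>i\<in>{1..n+1}. \<forall>j\<in>{1..n+1}. i < j \<longrightarrow> entry S i j = 0) \<and>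
     entry S 1 1 = 1 \<and>
     S * \<Omega> a b * transpose_mat S = Phi n}"


subsection \<open>Algebras of functions and their gradings\<close>

text \<open>A complex function on \<open>T\<close> is represented by a function on the whole type that vanishes
  outside \<open>T\<close>, so that two functions on \<open>T\<close> are equal iff their representatives are.\<close>

definition on_set :: "'p set \<Rightarrow> ('p \<Rightarrow> complex) \<Rightarrow> 'p \<Rightarrow> complex" where
  "on_set T f = (\<lambda>p. if p \<in> T then f p else 0)"

inductive_set generated_algebra :: "'p set \<Rightarrow> ('p \<Rightarrow> complex) set \<Rightarrow> ('p \<Rightarrow> complex) set"
  for T :: "'p set" and G :: "('p \<Rightarrow> complex) set" where
  const: "on_set T (\<lambda>_. a) \<in> generated_algebra T G"
| gen: "g \<in> G \<Longrightarrow> g \<in> generated_algebra T G"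
| add: "f \<in> generated_algebra T G \<Longrightarrow> g \<in> generated_algebra T G \<Longrightarrow>
    (\<lambda>p. f p + g p) \<in> generated_algebra T G"
| mult: "f \<in> generated_algebra T G \<Longrightarrow> g \<in> generated_algebra T G \<Longrightarrow>
    (\<lambda>p. f p * g p) \<in> generated_algebra T G"

text \<open>The grading of the generated algebra by weights of the generators: \<open>(r, f)\<close> is in the
  following set iff \<open>f\<close> is a linear combination of monomials of weight \<open>r\<close> in the generators,
  where \<open>(s, g) \<in> G\<close> means that the generator \<open>g\<close> has weight \<open>s\<close>.\<close>

inductive_set homogeneous ::
    "'p set \<Rightarrow> (int \<times> ('p \<Rightarrow> complex)) set \<Rightarrow> (int \<times> ('p \<Rightarrow> complex)) set"
  for T :: "'p set" and G :: "(int \<times> ('p \<Rightarrow> complex)) set" where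
  zero: "(r, \<lambda>_. 0) \<in> homogeneous T G"
| const: "(0, on_set T (\<lambda>_. a)) \<in> homogeneous T G"
| gen: "(s, g) \<in> G \<Longrightarrow> (s, g) \<in> homogeneous T G"
| add: "(r, f) \<in> homogeneous T G \<Longrightarrow> (r, g) \<in> homogeneous T G \<Longrightarrow>
    (r, \<lambda>p. f p + g p) \<in> homogeneous T G"
| mult: "(r, f) \<in> homogeneous T G \<Longrightarrow> (s, g) \<in> homogeneous T G \<Longrightarrow>
    (r + s, \<lambda>p. f p * g p) \<in> homogeneous T G"


subsection \<open>Charts\<close>

text \<open>Positions in \<open>S\<close> of the independent coordinates, left to right and top to bottom. They are
  named \<open>t\<^sub>2, t\<^sub>3, \<dots>\<close>, skipping the index \<open>n + 2\<close>; \<open>position n j\<close> is the position of \<open>t\<^sub>j\<close>.\<close>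

definition positions :: "nat \<Rightarrow> (nat \<times> nat) list" where
  "positions n = [(i, k). i \<leftarrow> [1..<n+2], k \<leftarrow> [1..<i+1],
     (i, k) \<noteq> (1, 1) \<and> (if odd n then i + k \<le> n + 2 else i + k < n + 2)]"

definition position :: "nat \<Rightarrow> nat \<Rightarrow> nat \<times> nat" where
  "position n j = positions n ! (if j < n + 2 then j - 2 else j - 3)"

definition index_I :: "nat \<Rightarrow> nat set" where
  "index_I n = (if n = 2 then {1, 2, 4} else {1..dwork_d n})"

definition diagonal_I :: "nat \<Rightarrow> nat set" where
  "diagonal_I n = {j \<in> index_I n - {1, n + 2}. fst (position n j) = snd (position n j)}"

definition s_fun :: "nat \<Rightarrow> (complex \<Rightarrow> complex \<Rightarrow> complex mat) \<Rightarrow> nat \<Rightarrow> nat \<Rightarrow> point \<Rightarrow> complex" where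
  "s_fun n \<Omega> i k = on_set (moduli_T n \<Omega>) (\<lambda>(a, b, S). entry S i k)"

definition t_fun :: "nat \<Rightarrow> (complex \<Rightarrow> complex \<Rightarrow> complex mat) \<Rightarrow> nat \<Rightarrow> point \<Rightarrow> complex" where
  "t_fun n \<Omega> j =
     (if j = 1 then on_set (moduli_T n \<Omega>) (\<lambda>(a, b, S). a)
      else if j = n + 2 then on_set (moduli_T n \<Omega>) (\<lambda>(a, b, S). b)
      else s_fun n \<Omega> (fst (position n j)) (snd (position n j)))"

definition u_fun :: "nat \<Rightarrow> (complex \<Rightarrow> complex \<Rightarrow> complex mat) \<Rightarrow> point \<Rightarrow> complex" where
  "u_fun n \<Omega> = s_fun n \<Omega> ((n + 2) div 2) ((n + 2) div 2)"

datatype variant = Option1 | Option2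

definition chart :: "variant \<Rightarrow> nat \<Rightarrow> (complex \<Rightarrow> complex \<Rightarrow> complex mat) \<Rightarrow> nat \<Rightarrow> point \<Rightarrow> complex" where
  "chart v n \<Omega> j =
     (if v = Option1 \<and> odd n \<and> n \<ge> 3 \<and> j = dwork_d n then
        (if n = 3 then (\<lambda>p. t_fun n \<Omega> 7 p + t_fun n \<Omega> 2 p * t_fun n \<Omega> 4 p)
         else (\<lambda>p. t_fun n \<Omega> (dwork_d n) p + t_fun n \<Omega> 2 p * t_fun n \<Omega> (dwork_d n - 2) p))
      else t_fun n \<Omega> j)"

definition weight :: "nat \<Rightarrow> nat \<Rightarrow> int" where
  "weight n j =
     (if n = 1 then int j
      else if n = 2 then (if j = 4 then 8 else 2)
      else if j = 1 then 1
      else if j = n + 2 then int (n + 2)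
      else (case position n j of (i, k) \<Rightarrow>
        if i = 2 \<or> i = n + 1 then int k + 1
        else if i = n then int k - 1
        else int k))"

definition weight_u :: "nat \<Rightarrow> int" where
  "weight_u n = (if n = 2 then 4 else int ((n + 2) div 2))"

text \<open>The generators \<open>t\<^sub>j\<close> (\<open>j \<in> J\<close>), \<open>u\<close> (for even \<open>n\<close>) and the inverse of
  \<open>t\<^sub>n\<^sub>+\<^sub>2 (t\<^sub>n\<^sub>+\<^sub>2 - t\<^sub>1\<^sup>n\<^sup>+\<^sup>2) t\<close>, where the last factor is the product of the diagonal coordinates,
  with their weights. In every case \<open>(n + 2) w\<^sub>1 = w\<^sub>n\<^sub>+\<^sub>2\<close>.\<close>

definition generators ::
    "variant \<Rightarrow> nat \<Rightarrow> (complex \<Rightarrow> complex \<Rightarrow> complex mat) \<Rightarrow> nat set \<Rightarrow> (int \<times> (point \<Rightarrow> complex)) set" where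
  "generators v n \<Omega> J =
     (\<lambda>j. (weight n j, chart v n \<Omega> j)) ` J \<union>
     (if even n then {(weight_u n, u_fun n \<Omega>)} else {}) \<union>
     {(- (2 * weight n (n + 2) + (\<Sum>j\<in>diagonal_I n. weight n j)),
       on_set (moduli_T n \<Omega>) (\<lambda>p. 1 /
         (chart v n \<Omega> (n + 2) p * (chart v n \<Omega> (n + 2) p - chart v n \<Omega> 1 p ^ (n + 2))
          * (\<Prod>j\<in>diagonal_I n. chart v n \<Omega> j p))))}"

text \<open>The algebra of regular functions uses the original chart, which is the one of Option 2.\<close>

definition O_T :: "nat \<Rightarrow> (complex \<Rightarrow> complex \<Rightarrow> complex mat) \<Rightarrow> (point \<Rightarrow> complex) set" where
  "O_T n \<Omega> = generated_algebra (moduli_T n \<Omega>) (snd ` generators Option2 n \<Omega> (index_I n))"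


subsection \<open>Vector fields\<close>

text \<open>Vector fields are derivations of \<^const>\<open>O_T\<close>; their values outside \<^const>\<open>O_T\<close> are
  irrelevant.\<close>

type_synonym vfield = "(point \<Rightarrow> complex) \<Rightarrow> (point \<Rightarrow> complex)"

definition vector_field :: "nat \<Rightarrow> (complex \<Rightarrow> complex \<Rightarrow> complex mat) \<Rightarrow> vfield \<Rightarrow> bool" where
  "vector_field n \<Omega> E \<longleftrightarrow>
     (\<forall>f\<in>O_T n \<Omega>. E f \<in> O_T n \<Omega>) \<and>
     (\<forall>f\<in>O_T n \<Omega>. \<forall>g\<in>O_T n \<Omega>. E (\<lambda>p. f p + g p) = (\<lambda>p. E f p + E g p)) \<and>
     (\<forall>a. \<forall>f\<in>O_T n \<Omega>. E (\<lambda>p. a * f p) = (\<lambda>p. a * E f p)) \<and>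
     (\<forall>f\<in>O_T n \<Omega>. \<forall>g\<in>O_T n \<Omega>. E (\<lambda>p. f p * g p) = (\<lambda>p. E f p * g p + f p * E g p))"

text \<open>\<open>A\<close> is the Gauss-Manin matrix of \<open>E\<close>: \<open>E(S) = A S - S B(E)\<close>.\<close>

definition gauss_manin_matrix ::
    "nat \<Rightarrow> (complex \<Rightarrow> complex \<Rightarrow> complex mat) \<Rightarrow> vfield \<Rightarrow> (point \<Rightarrow> complex mat) \<Rightarrow> bool" where
  "gauss_manin_matrix n \<Omega> E A \<longleftrightarrow>
     (\<forall>p\<in>moduli_T n \<Omega>. case p of (a, b, S) \<Rightarrow>
        A p \<in> carrier_mat (n + 1) (n + 1) \<and>
        mat1 (n + 1) (\<lambda>i j. E (s_fun n \<Omega> i j) p) =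
          A p * S - S * GM_B n a b (E (t_fun n \<Omega> 1) p) (E (t_fun n \<Omega> (n + 2)) p))"

text \<open>Superdiagonal \<open>(1, Y\<^sub>1, \<dots>, Y\<^sub>n\<^sub>-\<^sub>2, -1)\<close>; this is \<open>(1, -1)\<close> for \<open>n = 2\<close> and \<open>(1)\<close> for
  \<open>n = 1\<close>.\<close>

definition Y_matrix :: "nat \<Rightarrow> (nat \<Rightarrow> point \<Rightarrow> complex) \<Rightarrow> point \<Rightarrow> complex mat" where
  "Y_matrix n Y p = mat1 (n + 1) (\<lambda>i j.
     if j = i + 1 then (if i = 1 then 1 else if i = n then -1 else Y (i - 1) p) else 0)"

definition modular_vector_field :: "nat \<Rightarrow> (complex \<Rightarrow> complex \<Rightarrow> complex mat) \<Rightarrow> vfield \<Rightarrow> bool" where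
  "modular_vector_field n \<Omega> R \<longleftrightarrow>
     vector_field n \<Omega> R \<and>
     (\<exists>Y. (\<forall>i\<in>{1..n-2}. Y i \<in> O_T n \<Omega>) \<and>
          gauss_manin_matrix n \<Omega> R (Y_matrix n Y) \<and>
          (\<forall>p\<in>moduli_T n \<Omega>.
             Y_matrix n Y p * Phi n + Phi n * transpose_mat (Y_matrix n Y p) = 0\<^sub>m (n + 1) (n + 1)))"

text \<open>The vector field \<open>R\<^sub>\<gg>\<close> attached to an element \<open>\<gg>\<close> of the Lie algebra.\<close>

definition lie_vector_field ::
    "nat \<Rightarrow> (complex \<Rightarrow> complex \<Rightarrow> complex mat) \<Rightarrow> complex mat \<Rightarrow> vfield \<Rightarrow> bool" where
  "lie_vector_field n \<Omega> \<gg> E \<longleftrightarrow>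
     vector_field n \<Omega> E \<and> gauss_manin_matrix n \<Omega> E (\<lambda>_. transpose_mat \<gg>)"

definition matrix_unit :: "nat \<Rightarrow> nat \<Rightarrow> nat \<Rightarrow> complex mat" where
  "matrix_unit n i j = mat1 (n + 1) (\<lambda>k l. if k = i \<and> l = j then 1 else 0)"

definition g11 :: "nat \<Rightarrow> complex mat" where
  "g11 n = matrix_unit n 1 1 - matrix_unit n (n + 1) (n + 1)"

definition g22 :: "nat \<Rightarrow> complex mat" where
  "g22 n = matrix_unit n 2 2 - matrix_unit n n n"

definition H_vector_field :: "nat \<Rightarrow> (complex \<Rightarrow> complex \<Rightarrow> complex mat) \<Rightarrow> vfield \<Rightarrow> bool" where
  "H_vector_field n \<Omega> H \<longleftrightarrow>
     (\<exists>R11. lie_vector_field n \<Omega> (g11 n) R11 \<and>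
        (if n = 1 then (\<forall>f\<in>O_T n \<Omega>. H f = (\<lambda>p. - R11 f p))
         else if n = 2 then (\<forall>f\<in>O_T n \<Omega>. H f = (\<lambda>p. - 2 * R11 f p))
         else (\<exists>R22. lie_vector_field n \<Omega> (g22 n) R22 \<and>
                (\<forall>f\<in>O_T n \<Omega>. H f = (\<lambda>p. R22 f p - R11 f p)))))"

text \<open>The coordinate vector field of the original chart; its value on \<open>u\<close> is forced by the quadratic
  relation for \<open>u\<close>.\<close>

definition partial_vector_field ::
    "nat \<Rightarrow> (complex \<Rightarrow> complex \<Rightarrow> complex mat) \<Rightarrow> nat \<Rightarrow> vfield \<Rightarrow> bool" where
  "partial_vector_field n \<Omega> j E \<longleftrightarrow>
     vector_field n \<Omega> E \<and>
     (\<forall>k\<in>index_I n. E (t_fun n \<Omega> k) = on_set (moduli_T n \<Omega>) (\<lambda>_. if k = j then 1 else 0))"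

definition commutator :: "vfield \<Rightarrow> vfield \<Rightarrow> vfield" where
  "commutator E F f = (\<lambda>p. E (F f) p - F (E f) p)"

text \<open>\<open>D\<close> is \<open>R\<close> in Option 1 (only the chart changes, see \<^const>\<open>chart\<close>) and
  \<open>R + t\<^sub>2 ([R, (1 + \<delta>) \<partial>/\<partial>t\<^sub>2] - H)\<close> in Option 2.\<close>

definition D_vector_field ::
    "variant \<Rightarrow> nat \<Rightarrow> (complex \<Rightarrow> complex \<Rightarrow> complex mat) \<Rightarrow> vfield \<Rightarrow> bool" where
  "D_vector_field v n \<Omega> D \<longleftrightarrow>
     (case v of
        Option1 \<Rightarrow> modular_vector_field n \<Omega> D
      | Option2 \<Rightarrow> (\<exists>R P H.
          modular_vector_field n \<Omega> R \<and> partial_vector_field n \<Omega> 2 P \<and> H_vector_field n \<Omega> H \<and>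
          (\<forall>f\<in>O_T n \<Omega>. D f = (\<lambda>p. R f p + t_fun n \<Omega> 2 p *
             (commutator R (\<lambda>g q. (1 + of_bool (n = 2)) * P g q) f p - H f p)))))"


subsection \<open>Calabi-Yau quasi-modular and modular forms\<close>

text \<open>Quasi-modular forms are identified with regular functions through \<open>\<t>\<^sub>j \<leftrightarrow> t\<^sub>j\<close>, where
  \<open>t\<^sub>j\<close> belongs to the chart of the chosen option.\<close>

definition QM :: "variant \<Rightarrow> nat \<Rightarrow> (complex \<Rightarrow> complex \<Rightarrow> complex mat) \<Rightarrow> (point \<Rightarrow> complex) set" where
  "QM v n \<Omega> = generated_algebra (moduli_T n \<Omega>) (snd ` generators v n \<Omega> (index_I n))"

definition QM_wt ::
    "variant \<Rightarrow> nat \<Rightarrow> (complex \<Rightarrow> complex \<Rightarrow> complex mat) \<Rightarrow> int \<Rightarrow> (point \<Rightarrow> complex) set" where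
  "QM_wt v n \<Omega> r = {f. (r, f) \<in> homogeneous (moduli_T n \<Omega>) (generators v n \<Omega> (index_I n))}"

definition MF :: "variant \<Rightarrow> nat \<Rightarrow> (complex \<Rightarrow> complex \<Rightarrow> complex mat) \<Rightarrow> (point \<Rightarrow> complex) set" where
  "MF v n \<Omega> = generated_algebra (moduli_T n \<Omega>) (snd ` generators v n \<Omega> (index_I n - {2}))"

definition MF_wt ::
    "variant \<Rightarrow> nat \<Rightarrow> (complex \<Rightarrow> complex \<Rightarrow> complex mat) \<Rightarrow> int \<Rightarrow> (point \<Rightarrow> complex) set" where
  "MF_wt v n \<Omega> r = MF v n \<Omega> \<inter> QM_wt v n \<Omega> r"

text \<open>The operator is given by its values on homogeneous elements and extended additively.\<close>

definition ramanujan_serre ::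
    "variant \<Rightarrow> nat \<Rightarrow> (complex \<Rightarrow> complex \<Rightarrow> complex mat) \<Rightarrow> vfield \<Rightarrow> vfield \<Rightarrow> bool" where
  "ramanujan_serre v n \<Omega> D Q \<longleftrightarrow>
     (\<forall>f\<in>QM v n \<Omega>. \<forall>g\<in>QM v n \<Omega>. Q (\<lambda>p. f p + g p) = (\<lambda>p. Q f p + Q g p)) \<and>
     (\<forall>r. \<forall>f\<in>QM_wt v n \<Omega> r.
        Q f = (\<lambda>p. D f p + (1 - of_bool (n = 2) / 2) * of_int r * chart v n \<Omega> 2 p * f p))"

end

theory Submission
  imports Defs
begin

text \<open>The entry \<open>s\<^sub>i\<^sub>j\<close> of \<open>S\<close> has weight \<open>\<omega> j + e\<^sub>i\<close>, where \<open>\<omega> = deg t\<^sub>1\<close> and \<open>e\<^sub>i\<close> are the diagonal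
  entries of the Gauss-Manin matrix of \<open>H\<close>. The equation \<open>S \<Omega> S\<^sup>t\<^sup>r = \<Phi>\<close> is homogeneous for these weights,
  which gives the weights of the dependent entries. Comparing entries in \<open>R(S) = Y S - S B(R)\<close> yields
  \<open>R t\<^sub>1 = s\<^sub>2\<^sub>2 - t\<^sub>1 t\<^sub>2\<close>, \<open>R t\<^sub>n\<^sub>+\<^sub>2 = - (n + 2) t\<^sub>n\<^sub>+\<^sub>2 t\<^sub>2\<close> and, outside the last row,
  \<open>R s\<^sub>i\<^sub>j = Y\<^sub>i s\<^sub>i\<^sub>+\<^sub>1\<^sub>,\<^sub>j - s\<^sub>2\<^sub>2 s\<^sub>i\<^sub>,\<^sub>j\<^sub>-\<^sub>1 - j t\<^sub>2 s\<^sub>i\<^sub>j\<close> with \<open>Y\<^sub>i = s\<^sub>i\<^sub>i s\<^sub>2\<^sub>2 / s\<^sub>i\<^sub>+\<^sub>1\<^sub>,\<^sub>i\<^sub>+\<^sub>1\<close>, so \<open>R\<close> has degree 2. In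
  Option 2 the correction term is \<open>t\<^sub>2\<close> times an operator of degree 0.

  For modular forms, \<open>S\<close> is multiplied by an element of the group preserving \<open>\<Phi>\<close> that makes \<open>s\<^sub>2\<^sub>1\<close> vanish.
  This shows which combinations of dependent entries are free of \<open>t\<^sub>2\<close>, and that \<open>R f\<close> is at most linear
  in \<open>t\<^sub>2\<close> for every generator \<open>f\<close> of the algebra of modular forms. The linear term is compensated by the
  Ramanujan-Serre correction in Option 1 and by \<open>t\<^sub>2 [R, \<partial>/\<partial>t\<^sub>2]\<close> in Option 2.\<close>

subsection \<open>Matrix entries\<close>

text \<open>The grading is handled as a span of monomials: a function has weight r as soon as some
  expression for it does. Every claim thus amounts to exhibiting an expression in the chosen
  generators, and a derivation twisted by a multiple of the weight is tested on the t_j and u alone,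
  the inverse generator following from the product rule. The obstacle is that a dependent entry of S
  is a priori an expression in all coordinates, t_2 included, while closure of the modular forms
  under the Ramanujan-Serre derivation asks for expressions without t_2. The equation for S is
  therefore solved for an arbitrary triangular matrix over an arbitrary set of generators, and the
  result is applied both to S and to its shifted version. For odd n \<ge> 3 the corner s_{n+1,1} is
  an independent coordinate, and R s_{n,1} contains it only through s_{n+1,1} + t_2 s_{n,1}. Either
  this sum is made a coordinate (Option 1), or a term with t_2 survives and the vector field has to
  be changed (Option 2). For n \<le> 2 the only entries of S among the generators are t_2 and
  u.\<close>

lemma entry_mat1 [simp]:
  "i \<in> {1..k} \<Longrightarrow> j \<in> {1..k} \<Longrightarrow> entry (mat1 k f) i j = f i j"
  by (auto simp: entry_def mat1_def)

lemma mat1_carrier [simp]: "mat1 k f \<in> carrier_mat k k"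
  by (simp add: mat1_def)

lemma entry_mult:
  fixes A B :: "'a::semiring_0 mat"
  assumes "A \<in> carrier_mat N N" "B \<in> carrier_mat N N" "i \<in> {1..N}" "j \<in> {1..N}"
  shows "entry (A * B) i j = (\<Sum>k = 1..N. entry A i k * entry B k j)"
proof -
  have "entry (A * B) i j = (\<Sum>k = 0..<N. A $$ (i - 1, k) * B $$ (k, j - 1))"
    using assms by (auto simp: entry_def scalar_prod_def)
  also have "\<dots> = (\<Sum>k = 1..N. entry A i k * entry B k j)"
    by (rule sum.reindex_bij_witness[of _ "\<lambda>k. k - 1" Suc]) (auto simp: entry_def)
  finally show ?thesis .
qed

lemma entry_transpose:
  assumes "A \<in> carrier_mat N N" "i \<in> {1..N}" "j \<in> {1..N}"
  shows "entry (transpose_mat A) i j = entry A j i"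
  using assms by (auto simp: entry_def)

lemma entry_smult:
  assumes "A \<in> carrier_mat N N" "i \<in> {1..N}" "j \<in> {1..N}"
  shows "entry (k \<cdot>\<^sub>m A) i j = k * entry A i j"
  using assms by (auto simp: entry_def)

lemma entry_add:
  assumes "A \<in> carrier_mat N N" "B \<in> carrier_mat N N" "i \<in> {1..N}" "j \<in> {1..N}"
  shows "entry (A + B) i j = entry A i j + entry B i j"
  using assms by (auto simp: entry_def)

lemma entry_minus:
  fixes A B :: "'a::group_add mat"
  assumes "A \<in> carrier_mat N N" "B \<in> carrier_mat N N" "i \<in> {1..N}" "j \<in> {1..N}"
  shows "entry (A - B) i j = entry A i j - entry B i j"
  using assms by (auto simp: entry_def)

lemma sum_single:
  fixes g :: "'b \<Rightarrow> 'a::comm_monoid_add"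
  assumes "finite A" "k \<in> A" "\<And>i. i \<in> A \<Longrightarrow> i \<noteq> k \<Longrightarrow> g i = 0"
  shows "sum g A = g k"
  using assms by (metis (no_types, lifting) DiffD1 DiffD2 add_0_right singletonI sum.neutral sum.remove)

subsection \<open>Weighted functions\<close>

lemma on_set_eq_iff: "on_set T f = on_set T g \<longleftrightarrow> (\<forall>p\<in>T. f p = g p)"
  by (auto simp: on_set_def fun_eq_iff)

lemma on_set_in [simp]: "p \<in> T \<Longrightarrow> on_set T f p = f p"
  by (simp add: on_set_def)

lemma on_set_out [simp]: "p \<notin> T \<Longrightarrow> on_set T f p = 0"
  by (simp add: on_set_def)

lemma on_set_idem [simp]: "on_set T (on_set T f) = on_set T f"
  by (auto simp: on_set_def)

text \<open>Stated for the restriction of \<open>f\<close> to \<open>T\<close>: the formulas below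
  hold only on \<open>T\<close>, where \<open>S\<close> is triangular and the denominators are
  nonzero, and \<open>weighted_cong\<close> then replaces \<open>f\<close> by any function with the
  same values there.\<close>

definition weighted ::
    "'p set \<Rightarrow> (int \<times> ('p \<Rightarrow> complex)) set \<Rightarrow> int \<Rightarrow> ('p \<Rightarrow> complex) \<Rightarrow> bool" where
  "weighted T G r f \<longleftrightarrow> (r, on_set T f) \<in> homogeneous T G"

definition vanishing_outside :: "'p set \<Rightarrow> ('p \<Rightarrow> complex) \<Rightarrow> bool" where
  "vanishing_outside T f \<longleftrightarrow> on_set T f = f"

lemma vanishing_outsideD: "vanishing_outside T f \<Longrightarrow> p \<notin> T \<Longrightarrow> f p = 0"
  unfolding vanishing_outside_def by (metis on_set_out)

lemma vanishing_outsideI: "(\<And>p. p \<notin> T \<Longrightarrow> f p = 0) \<Longrightarrow> vanishing_outside T f"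
  by (auto simp: vanishing_outside_def on_set_def)

lemma vanishing_outside_on_set [simp]: "vanishing_outside T (on_set T f)"
  by (simp add: vanishing_outside_def)

section \<open>Homogeneous elements and generated algebras\<close>

lemma homogeneous_vanishing:
  assumes "(r, f) \<in> homogeneous T G" "\<And>s g. (s, g) \<in> G \<Longrightarrow> vanishing_outside T g"
  shows "vanishing_outside T f"
proof (rule vanishing_outsideI)
  fix p assume "p \<notin> T"
  with assms show "f p = 0"
    by (induction rule: homogeneous.induct) (auto dest: vanishing_outsideD)
qed

lemma generated_vanishing:
  assumes "f \<in> generated_algebra T G" "\<And>g. g \<in> G \<Longrightarrow> vanishing_outside T g"
  shows "vanishing_outside T f"
proof (rule vanishing_outsideI)
  fix p assume "p \<notin> T"
  with assms show "f p = 0"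
    by (induction rule: generated_algebra.induct) (auto dest: vanishing_outsideD)
qed

lemma homogeneous_subst:
  assumes "(r, f) \<in> homogeneous T G" "G \<subseteq> homogeneous T G'"
  shows "(r, f) \<in> homogeneous T G'"
  using assms by (induction rule: homogeneous.induct) (auto intro: homogeneous.intros)

lemma homogeneous_generated:
  assumes "(r, f) \<in> homogeneous T G"
  shows "f \<in> generated_algebra T (snd ` G)"
  using assms
proof (induction rule: homogeneous.induct)
  case (zero r)
  have "(\<lambda>_. 0) = on_set T (\<lambda>_. 0)" by (auto simp: on_set_def)
  then show ?case by (metis generated_algebra.const)
qed (force intro: generated_algebra.intros)+

lemma generated_algebra_subst:
  assumes "f \<in> generated_algebra T G" "G \<subseteq> generated_algebra T G'"
  shows "f \<in> generated_algebra T G'"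
  using assms by (induction rule: generated_algebra.induct) (auto intro: generated_algebra.intros)

text \<open>The Ramanujan-Serre operator is prescribed on homogeneous functions and extended by
  additivity, so elements of a generated algebra have to be written as finite sums of homogeneous
  ones.\<close>

inductive_set homogeneous_sums ::
    "'p set \<Rightarrow> (int \<times> ('p \<Rightarrow> complex)) set \<Rightarrow> ('p \<Rightarrow> complex) set"
  for T :: "'p set" and G :: "(int \<times> ('p \<Rightarrow> complex)) set" where
  zero: "(\<lambda>_. 0) \<in> homogeneous_sums T G"
| step: "(r, h) \<in> homogeneous T G \<Longrightarrow> f \<in> homogeneous_sums T G \<Longrightarrow>
    (\<lambda>p. h p + f p) \<in> homogeneous_sums T G"

lemma homogeneous_sums_hom: "(r, h) \<in> homogeneous T G \<Longrightarrow> h \<in> homogeneous_sums T G"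
  using homogeneous_sums.step[OF _ homogeneous_sums.zero] by fastforce

lemma homogeneous_sums_add:
  assumes "f \<in> homogeneous_sums T G" "g \<in> homogeneous_sums T G"
  shows "(\<lambda>p. f p + g p) \<in> homogeneous_sums T G"
  using assms(1)
proof (induction rule: homogeneous_sums.induct)
  case (step r h f)
  then show ?case using homogeneous_sums.step[OF step(1) step(3)] by (simp add: add.assoc)
qed (use assms(2) in simp)

lemma homogeneous_sums_mult:
  assumes "f \<in> homogeneous_sums T G" "g \<in> homogeneous_sums T G"
  shows "(\<lambda>p. f p * g p) \<in> homogeneous_sums T G"
  using assms(1)
proof (induction rule: homogeneous_sums.induct)
  case zero
  then show ?case using homogeneous_sums.zero by simp
next
  case (step r h f)
  have "(\<lambda>p. h p * g p) \<in> homogeneous_sums T G"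
    using assms(2)
  proof (induction rule: homogeneous_sums.induct)
    case zero
    then show ?case using homogeneous_sums.zero by simp
  next
    case (step s k f)
    then show ?case
      using homogeneous_sums.step[OF homogeneous.mult[OF \<open>(r, h) \<in> _\<close> step(1)] step(3)]
      by (simp add: distrib_left)
  qed
  then show ?case using homogeneous_sums_add[OF _ step(3)] by (simp add: distrib_right)
qed

lemma generated_algebra_homogeneous_sums:
  assumes "f \<in> generated_algebra T (snd ` G)"
  shows "f \<in> homogeneous_sums T G"
  using assms
  by (induction rule: generated_algebra.induct)
    (auto intro: homogeneous_sums_hom[OF homogeneous.const] homogeneous_sums_hom[OF homogeneous.gen]
      homogeneous_sums_add homogeneous_sums_mult)

section \<open>Closure properties of weighted functions\<close>

lemma weighted_cong:
  assumes "weighted T G r f" "r = r'" "\<And>p. p \<in> T \<Longrightarrow> f p = f' p"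
  shows "weighted T G r' f'"
proof -
  have "on_set T f = on_set T f'" using assms by (simp add: on_set_eq_iff)
  with assms show ?thesis by (simp add: weighted_def)
qed

lemma weighted_const: "weighted T G 0 (\<lambda>_. k)"
  by (simp add: weighted_def homogeneous.const)

lemma weighted_zero: "weighted T G r (\<lambda>_. 0)"
proof -
  have "on_set T (\<lambda>_. 0) = (\<lambda>_. 0)" by (auto simp: on_set_def)
  then show ?thesis by (simp add: weighted_def homogeneous.zero)
qed

lemma weighted_add: "weighted T G r f \<Longrightarrow> weighted T G r g \<Longrightarrow> weighted T G r (\<lambda>p. f p + g p)"
proof -
  assume *: "weighted T G r f" "weighted T G r g"
  have "on_set T (\<lambda>p. f p + g p) = (\<lambda>p. on_set T f p + on_set T g p)" by (auto simp: on_set_def)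
  with * show ?thesis by (simp add: weighted_def homogeneous.add)
qed

lemma weighted_mult: "weighted T G r f \<Longrightarrow> weighted T G s g \<Longrightarrow> weighted T G (r + s) (\<lambda>p. f p * g p)"
proof -
  assume *: "weighted T G r f" "weighted T G s g"
  have "on_set T (\<lambda>p. f p * g p) = (\<lambda>p. on_set T f p * on_set T g p)" by (auto simp: on_set_def)
  with * show ?thesis by (simp add: weighted_def homogeneous.mult)
qed

lemma weighted_cmult: "weighted T G r f \<Longrightarrow> weighted T G r (\<lambda>p. k * f p)"
  using weighted_mult[OF weighted_const] by fastforce

lemma weighted_minus: "weighted T G r f \<Longrightarrow> weighted T G r (\<lambda>p. - f p)"
  using weighted_cmult[where k = "-1"] by fastforce

lemma weighted_diff: "weighted T G r f \<Longrightarrow> weighted T G r g \<Longrightarrow> weighted T G r (\<lambda>p. f p - g p)"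
  using weighted_add[OF _ weighted_minus] by fastforce

lemma weighted_sum:
  "(\<And>i. i \<in> A \<Longrightarrow> weighted T G r (f i)) \<Longrightarrow> weighted T G r (\<lambda>p. \<Sum>i\<in>A. f i p)"
  by (induction A rule: infinite_finite_induct) (auto intro: weighted_add weighted_zero)

lemma weighted_prod:
  "(\<And>i. i \<in> A \<Longrightarrow> weighted T G (r i) (f i)) \<Longrightarrow> weighted T G (\<Sum>i\<in>A. r i) (\<lambda>p. \<Prod>i\<in>A. f i p)"
  by (induction A rule: infinite_finite_induct) (auto intro: weighted_mult weighted_const)

lemma weighted_power:
  "weighted T G r f \<Longrightarrow> weighted T G (int k * r) (\<lambda>p. f p ^ k)"
proof (induction k)
  case 0
  then show ?case by (simp add: weighted_const)
next
  case (Suc k)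
  show ?case
    by (rule weighted_cong[OF weighted_mult[OF Suc(2) Suc(1)[OF Suc(2)]]]) (auto simp: algebra_simps)
qed

lemma weighted_subst:
  assumes "weighted T G r f" "\<And>s g. (s, g) \<in> G \<Longrightarrow> (s, g) \<in> homogeneous T G'"
  shows "weighted T G' r f"
  using assms homogeneous_subst unfolding weighted_def by fastforce

lemma weighted_gen: "(r, on_set T f) \<in> G \<Longrightarrow> weighted T G r f"
  by (simp add: weighted_def homogeneous.gen)

subsection \<open>The independent coordinates\<close>

text \<open>The weight of t_1, and the weight gained by moving one column to the right in
  \<open>S\<close>. The value 2 for n = 2 reflects H = -2 R_{g_11}; for all other n the coefficient
  of R_{g_11} in H is -1.\<close>

definition col_weight :: "nat \<Rightarrow> int" where
  "col_weight n = (if n = 2 then 2 else 1)"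

text \<open>The entry \<open>s\<^sub>i\<^sub>j\<close> has weight \<open>col_weight n * j + row_weight n i\<close>; the row weights are the
  diagonal entries of the Gauss-Manin matrix of \<open>H\<close>.\<close>

definition row_weight :: "nat \<Rightarrow> nat \<Rightarrow> int" where
  "row_weight n i =
     (if n = 1 then (if i = 1 then -1 else 1)
      else if n = 2 then (if i = 1 then -2 else if i = 3 then 2 else 0)
      else if i = 2 \<or> i = n + 1 then 1 else if i = 1 \<or> i = n then -1 else 0)"

lemma concat_map_Pair:
  "concat (map (\<lambda>k. if P k then [(i, k)] else []) xs) = map (Pair i) (filter P xs)"
  by (induction xs) auto

lemma positions_eq:
  "positions n = concat (map (\<lambda>i. map (Pair i) (filter (\<lambda>k. (i, k) \<noteq> (1, 1) \<and>
     (if odd n then i + k \<le> n + 2 else i + k < n + 2)) [1..<i + 1])) [1..<n + 2])"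
  unfolding positions_def concat_map_Pair by (rule refl)

lemma set_concat_map_Pair:
  "set (concat (map (\<lambda>i. map (Pair i) (filter (Q i) (f i))) xs)) =
     {x. fst x \<in> set xs \<and> snd x \<in> set (f (fst x)) \<and> Q (fst x) (snd x)}"
  by auto

lemma set_positions:
  "set (positions n) = {(i, k). 1 \<le> k \<and> k \<le> i \<and> i \<le> n + 1 \<and> (i, k) \<noteq> (1, 1) \<and>
     (if odd n then i + k \<le> n + 2 else i + k < n + 2)}"
  unfolding positions_eq set_concat_map_Pair set_upt
proof (rule Set.set_eqI)
  fix x :: "nat \<times> nat"
  show "x \<in> {x. fst x \<in> {1..<n + 2} \<and> snd x \<in> {1..<fst x + 1} \<and> (fst x, snd x) \<noteq> (1, 1) \<and>
        (if odd n then fst x + snd x \<le> n + 2 else fst x + snd x < n + 2)} \<longleftrightarrow>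
      x \<in> {(i, k). 1 \<le> k \<and> k \<le> i \<and> i \<le> n + 1 \<and> (i, k) \<noteq> (1, 1) \<and>
        (if odd n then i + k \<le> n + 2 else i + k < n + 2)}"
    by (cases x, simp only: mem_Collect_eq fst_conv snd_conv prod.case atLeastLessThan_iff) linarith
qed

lemma distinct_concat_map_Pair:
  "distinct xs \<Longrightarrow> (\<And>i. distinct (f i)) \<Longrightarrow> distinct (concat (map (\<lambda>i. map (Pair i) (f i)) xs))"
  by (induction xs) (auto simp: distinct_map inj_on_def)

lemma distinct_positions: "distinct (positions n)"
  unfolding positions_eq by (intro distinct_concat_map_Pair) auto

text \<open>With m = \<open>dwork_m n\<close>, both parities give column k the rows k to 2m + 1 - k.
  The column lengths 2(m + 1 - k) add up to m(m + 1); one position is lost to (1, 1), and the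
  coordinates t_1 and t_{n+2}, which are not entries of S, account for the 2.\<close>

lemma length_positions:
  assumes "n \<ge> 1"
  shows "length (positions n) + 2 = dwork_d n"
proof -
  define m where "m = dwork_m n"
  have n: "n = 2 * m - 1 \<and> odd n \<or> n = 2 * m \<and> even n" and m: "m \<ge> 1"
    using assms by (auto simp: m_def dwork_m_def elim!: oddE evenE)
  have "set (positions n) = prod.swap ` (SIGMA k:{1..m}. {k..2 * m + 1 - k}) - {(1, 1)}"
    using n m unfolding set_positions by (auto simp: image_iff split: if_splits)
  moreover have "(1, 1) \<in> prod.swap ` (SIGMA k:{1..m}. {k..2 * m + 1 - k})"
    using m by (auto simp: image_iff)
  ultimately have "card (set (positions n)) = card (SIGMA k:{1..m}. {k..2 * m + 1 - k}) - 1"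
    by (simp add: card_image)
  moreover have "card (SIGMA k:{1..m}. {k..2 * m + 1 - k}) = (\<Sum>k = 1..m. 2 * (m + 1 - k))"
    by (subst card_SigmaI) (auto intro!: sum.cong)
  moreover have "(\<Sum>k = 1..m. 2 * (m + 1 - k)) = (\<Sum>k = 1..m. 2 * k)"
    by (rule sum.reindex_bij_witness[of _ "\<lambda>k. m + 1 - k" "\<lambda>k. m + 1 - k"]) auto
  moreover have "(\<Sum>k = 1..m. 2 * k) = m * (m + 1)"
    by (induction m) auto
  ultimately have "length (positions n) = m * (m + 1) - 1"
    using distinct_card[OF distinct_positions] by metis
  moreover have "dwork_d n = m * (m + 1) + 1"
  proof (cases "odd n")
    case True
    then have "(n + 1) * (n + 3) = 4 * (m * (m + 1))" using n m
      by (auto simp: algebra_simps elim!: oddE)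
    then show ?thesis using True by (simp add: dwork_d_def)
  next
    case False
    then have "n * (n + 2) = 4 * (m * (m + 1))" using n by (auto simp: algebra_simps)
    then show ?thesis using False by (simp add: dwork_d_def)
  qed
  ultimately show ?thesis using m by (cases m) auto
qed

text \<open>n = 2 is the one case with \<open>dwork_d n < n + 2\<close>: the skipped index 4 exceeds
  d = 3, so \<open>index_I\<close> is not an interval. Otherwise n + 2 \<le> d, and skipping n + 2
  leaves exactly as many indices from 2 on as there are positions.\<close>

lemma index_I_iff:
  assumes "n \<ge> 1"
  shows "j \<in> index_I n - {1, n + 2} \<longleftrightarrow>
    j \<noteq> n + 2 \<and> 2 \<le> j \<and> (if j < n + 2 then j - 2 else j - 3) < length (positions n)"
proof (cases "n = 2")
  case True
  then have "length (positions n) = 1" using length_positions[of n] by (simp add: dwork_d_def)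
  with True show ?thesis by (auto simp: index_I_def)
next
  case False
  have "n + 2 \<le> dwork_d n"
  proof -
    consider "n = 1" | "n \<ge> 3" using assms False by linarith
    then show ?thesis
    proof cases
      case 2
      then have "3 * (n + 2) \<le> n * (n + 2)" "4 * (n + 3) \<le> (n + 1) * (n + 3)"
        using mult_le_mono1[of 3 n "n + 2"] mult_le_mono1[of 4 "n + 1" "n + 3"] by linarith+
      moreover have "n \<ge> 4" if "even n" using 2 that by (cases "n = 3") auto
      then have "4 * (n + 2) \<le> n * (n + 2)" if "even n"
        using that mult_le_mono1[of 4 n "n + 2"] by blast
      ultimately have "n + 2 \<le> n * (n + 2) div 4 + 1" if "even n"
        using that div_le_mono[of "4 * (n + 2)" "n * (n + 2)" 4] by simp
      moreover have "n + 2 \<le> (n + 1) * (n + 3) div 4 + 1"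
        using \<open>4 * (n + 3) \<le> _\<close> div_le_mono[of "4 * (n + 3)" "(n + 1) * (n + 3)" 4] by simp
      ultimately show ?thesis by (simp add: dwork_d_def)
    qed (simp add: dwork_d_def)
  qed
  with False length_positions[OF assms] show ?thesis by (auto simp: index_I_def)
qed

lemma finite_index_I [simp]: "finite (index_I n)"
  by (simp add: index_I_def)

lemma finite_diagonal_I [simp]: "finite (diagonal_I n)"
  by (simp add: diagonal_I_def)

lemma position_in:
  assumes "n \<ge> 1" "j \<in> index_I n - {1, n + 2}"
  shows "position n j \<in> set (positions n)"
  using assms(2) unfolding index_I_iff[OF assms(1)] position_def by (auto intro!: nth_mem split: if_splits)

lemma position_inj:
  assumes "n \<ge> 1" "j \<in> index_I n - {1, n + 2}" "j' \<in> index_I n - {1, n + 2}"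
    "position n j = position n j'"
  shows "j = j'"
  using assms(2-4) unfolding index_I_iff[OF assms(1)] position_def
  by (auto simp: nth_eq_iff_index_eq[OF distinct_positions] split: if_splits)

lemma position_ex:
  assumes "n \<ge> 1" "x \<in> set (positions n)"
  obtains j where "j \<in> index_I n - {1, n + 2}" "position n j = x"
proof -
  obtain l where l: "l < length (positions n)" "positions n ! l = x"
    using assms(2) by (auto simp: in_set_conv_nth)
  define j where "j = (if l < n then l + 2 else l + 3)"
  have "j \<in> index_I n - {1, n + 2}" "position n j = x"
    unfolding index_I_iff[OF assms(1)] using l by (auto simp: j_def position_def)
  then show ?thesis using that by blast
qed

lemma basic_indices:
  assumes "n \<ge> 1"
  shows "1 \<in> index_I n" "n + 2 \<in> index_I n" "2 \<in> index_I n - {1, n + 2}" "position n 2 = (2, 1)"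
proof -
  have *: "(2, 1) \<in> set (positions n)"
    using assms by (auto simp: set_positions)
  have split: "[1..<n + 2] = 1 # 2 # [3..<n + 2]"
    using assms by (simp add: upt_conv_Cons numeral_eq_Suc)
  have "\<exists>xs. positions n = (2, 1) # xs"
    unfolding positions_eq split using assms by (auto simp: upt_conv_Cons numeral_eq_Suc)
  then have 0: "positions n ! 0 = (2, 1)" by auto
  show "position n 2 = (2, 1)" using assms 0 by (simp add: position_def)
  show 2: "2 \<in> index_I n - {1, n + 2}"
    unfolding index_I_iff[OF assms] using length_pos_if_in_set[OF *] assms by simp
  show "1 \<in> index_I n" using length_positions[OF assms] by (auto simp: index_I_def)
  show "n + 2 \<in> index_I n"
  proof (cases "n = 1 \<or> n = 2")
    case True
    then show ?thesis by (auto simp: index_I_def dwork_d_def)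
  next
    case False
    then have n: "n \<ge> 3" using assms by linarith
    \<comment> \<open>The positions (2, 2) and (i, 1) for 2 \<le> i \<le> n are n in number, which
      gives n + 2 \<le> d by \<open>length_positions\<close>.\<close>
    define A :: "(nat \<times> nat) set" where "A = (\<lambda>i. (i, 1)) ` {2..n}"
    have "insert (2, 2) A \<subseteq> set (positions n)"
      unfolding set_positions A_def using n by auto
    then have "card (insert (2, 2) A) \<le> card (set (positions n))"
      by (intro card_mono) auto
    moreover have "card A = n - 1" by (simp add: A_def card_image inj_on_def)
    moreover have "(2, 2) \<notin> A" "finite A" by (auto simp: A_def)
    ultimately have "n \<le> length (positions n)"
      using distinct_card[OF distinct_positions[of n]] n by simp
    then show ?thesis using length_positions[OF assms] n by (auto simp: index_I_def)
  qed
qed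

text \<open>Locates the coordinates in the modified chart of Option 1: the last one is s_{n+1,1},
  and s_{n,1} stands two places before it.\<close>

lemma last_positions:
  assumes "odd n" "n \<ge> 3"
  shows "\<exists>xs. positions n = xs @ [(n, 1), (n, 2), (n + 1, 1)]"
proof -
  have split: "[1..<n + 2] = [1..<n] @ [n, n + 1]"
    using assms by (simp add: upt_Suc_append)
  have f1: "filter (\<lambda>k. (n, k) \<noteq> (1, 1) \<and> (if odd n then n + k \<le> n + 2 else n + k < n + 2)) [1..<n + 1] = [1, 2]"
  proof -
    have "[1..<n + 1] = 1 # 2 # [3..<n + 1]" using assms by (simp add: upt_conv_Cons numeral_eq_Suc)
    then show ?thesis using assms by (simp add: filter_empty_conv)
  qed
  have f2: "filter (\<lambda>k. (n + 1, k) \<noteq> (1, 1) \<and> (if odd n then n + 1 + k \<le> n + 2 else n + 1 + k < n + 2))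
      [1..<n + 1 + 1] = [1]"
  proof -
    have "[1..<n + 1 + 1] = 1 # [2..<n + 2]" using assms by (simp add: upt_conv_Cons numeral_eq_Suc)
    then show ?thesis using assms by (simp add: filter_empty_conv)
  qed
  show ?thesis
    unfolding positions_eq split map_append concat_append list.map concat.simps f1 f2 by simp
qed

text \<open>The index of s_{n,1}. It is d - 2 for odd n \<ge> 5, but for n = 3 the skipped index n +
  2 = 5 equals d - 2 and falls between s_31 = t_4 and s_32 = t_6.\<close>

definition chart_partner :: "nat \<Rightarrow> nat" where
  "chart_partner n = (if n = 3 then 4 else dwork_d n - 2)"

lemma last_indices:
  assumes "odd n" "n \<ge> 3"
  shows "dwork_d n \<in> index_I n - {1, n + 2}" "position n (dwork_d n) = (n + 1, 1)"
    "chart_partner n \<in> index_I n - {1, n + 2}" "position n (chart_partner n) = (n, 1)"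
proof -
  obtain xs where xs: "positions n = xs @ [(n, 1), (n, 2), (n + 1, 1)]"
    using last_positions[OF assms] by blast
  have d: "dwork_d n = length xs + 5" using length_positions[of n] assms xs by simp
  have d': "dwork_d n = (n + 1) * (n + 3) div 4 + 1" using assms by (simp add: dwork_d_def)
  consider "n = 3" | "n \<ge> 5" using assms by (cases "n = 4") force+
  then have "dwork_d n \<in> index_I n - {1, n + 2} \<and> position n (dwork_d n) = (n + 1, 1) \<and>
    chart_partner n \<in> index_I n - {1, n + 2} \<and> position n (chart_partner n) = (n, 1)"
  proof cases
    case 1
    then have "length xs = 2" "dwork_d n = 7" using d d' by auto
    moreover have "positions 3 = xs @ [(3, 1), (3, 2), (4, 1)]" using xs 1 by simp
    ultimately show ?thesis using 1
      by (simp add: position_def nth_append index_I_def chart_partner_def)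
  next
    case 2
    have "6 * (n + 3) div 4 \<le> (n + 1) * (n + 3) div 4"
      using 2 by (intro div_le_mono mult_le_mono1) simp
    moreover have "n + 4 \<le> 6 * (n + 3) div 4" by presburger
    ultimately have "dwork_d n > n + 4" using d' by linarith
    then show ?thesis using 2 d
      by (auto simp: position_def xs nth_append index_I_def chart_partner_def)
  qed
  then show "dwork_d n \<in> index_I n - {1, n + 2}" "position n (dwork_d n) = (n + 1, 1)"
    "chart_partner n \<in> index_I n - {1, n + 2}" "position n (chart_partner n) = (n, 1)" by auto
qed

section \<open>The weights in the uniform form column part plus row part\<close>

lemma weight_basic:
  "n \<ge> 1 \<Longrightarrow> weight n 1 = col_weight n" "n \<ge> 1 \<Longrightarrow> weight n (n + 2) = col_weight n * int (n + 2)"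
  by (auto simp: weight_def col_weight_def)

lemma weight_position:
  assumes "n \<ge> 1" "j \<in> index_I n - {1, n + 2}" "position n j = (i, k)"
  shows "weight n j = col_weight n * int k + row_weight n i"
proof -
  have "(i, k) \<in> set (positions n)"
    using position_in[OF assms(1,2)] assms(3) by metis
  then have ik: "1 \<le> k" "k \<le> i" "(i, k) \<noteq> (1, 1)" "i \<le> n + 1"
    unfolding set_positions by blast+
  then have i: "i \<noteq> 1" by auto
  consider "n = 1" | "n = 2" | "n \<ge> 3" using assms(1) by linarith
  then show ?thesis
  proof cases
    case 1
    then have "j = 2" using assms(2) by (auto simp: index_I_def dwork_d_def)
    moreover have "(i, k) = (2, 1)" using calculation basic_indices(4)[OF assms(1)] assms(3) by metis
    ultimately
    show ?thesis using 1 by (simp add: weight_def col_weight_def row_weight_def)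
  next
    case 2
    then have "j = 2" using assms(2) by (auto simp: index_I_def)
    moreover have "(i, k) = (2, 1)" using calculation basic_indices(4)[OF assms(1)] assms(3) by metis
    ultimately
    show ?thesis using 2 by (simp add: weight_def col_weight_def row_weight_def)
  next
    case 3
    moreover have "j \<noteq> 1" "j \<noteq> n + 2" using assms(2) by auto
    ultimately show ?thesis using ik(1) i
      by (simp add: weight_def col_weight_def row_weight_def assms(3))
  qed
qed

lemma weight_u_eq:
  assumes "n \<ge> 1" "even n"
  shows "weight_u n = col_weight n * int ((n + 2) div 2) + row_weight n ((n + 2) div 2)"
  using assms by (auto simp: weight_u_def col_weight_def row_weight_def elim!: evenE)

text \<open>The diagonal matrix of row weights lies in the Lie algebra preserving Phi. This makes
  the right-hand side of the equation for \<open>S\<close> homogeneous: its nonzero entries sit at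
  (i, n + 2 - i), where the two row weights cancel.\<close>

lemma row_weight_reflect:
  assumes "n \<ge> 1" "i \<in> {1..n + 1}"
  shows "row_weight n (n + 2 - i) = - row_weight n i"
proof -
  have small: "i = 1 \<or> i = 2 \<or> i = 3" if "n \<le> 2" using that assms by auto
  consider "n = 1" | "n = 2" | "n \<ge> 3" using assms(1) by linarith
  then show ?thesis
  proof cases
    case 1
    then show ?thesis using small assms by (auto simp: row_weight_def)
  next
    case 2
    then show ?thesis using small by (auto simp: row_weight_def)
  next
    case 3
    then have "row_weight n k = (if k = 2 \<or> k = n + 1 then 1 else if k = 1 \<or> k = n then -1 else 0)" for k
      by (simp add: row_weight_def)
    moreover have "n + 2 - i = 2 \<longleftrightarrow> i = n" "n + 2 - i = n + 1 \<longleftrightarrow> i = 1"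
      "n + 2 - i = 1 \<longleftrightarrow> i = n + 1" "n + 2 - i = n \<longleftrightarrow> i = 2"
      using assms by auto
    moreover have "i = 2 \<Longrightarrow> i \<noteq> n" using 3 by simp
    ultimately show ?thesis using 3 by simp
  qed
qed

subsection \<open>The Gauss-Manin matrix and the intersection matrix\<close>

lemma entry_GM_B_upper:
  assumes "i \<in> {1..n}" "j \<in> {1..n + 1}"
  shows "entry (GM_B n a b x y) i j =
    (if j = i then - (of_nat i * (y / (of_nat (n + 2) * b)))
     else if j = i + 1 then x - a * (y / (of_nat (n + 2) * b)) else 0)"
  unfolding GM_B_def using assms by (subst entry_mat1) auto

text \<open>These entries are multiples of the same 1-form dt_1 - t_1 dt_{n+2} / ((n + 2) t_{n+2})
  as the superdiagonal. The final entry of the row is not, and is computed below in the direction of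
  t_1.\<close>

lemma entry_GM_B_last:
  assumes "j \<in> {1..n}"
  shows "entry (GM_B n a b x y) (n + 1) j =
    - (of_nat (Stirling (n + 2) j) * a ^ j * (1 / (a ^ (n + 2) - b)))
      * (x - a * (y / (of_nat (n + 2) * b)))"
proof -
  have eq: "- (S * a ^ j) / D * x + (S * a ^ (j + 1)) / (N * b * D) * y =
    - (S * a ^ j * (1 / D)) * (x - a * (y / (N * b)))" for S D N :: complex
    by (simp add: divide_inverse algebra_simps)
  show ?thesis
    unfolding GM_B_def eq[symmetric] using assms by (subst entry_mat1) auto
qed

lemma entry_GM_B_last_last:
  "entry (GM_B n a b x 0) (n + 1) (n + 1) =
     - (of_nat (Stirling (n + 2) (n + 1)) * a ^ (n + 1) * (1 / (a ^ (n + 2) - b))) * x"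
proof -
  have eq: "- (S * A * (1 / D)) * x = - (S * A) / D * x + E * 0" for S A D E :: complex
    by simp
  show ?thesis unfolding GM_B_def eq by (subst entry_mat1) auto
qed

lemma GM_B_carrier [simp]: "GM_B n a b x y \<in> carrier_mat (n + 1) (n + 1)"
  unfolding GM_B_def by (rule mat1_carrier)

lemma GM_B_linear:
  assumes "i \<in> {1..n + 1}" "j \<in> {1..n + 1}"
  shows "entry (GM_B n a b x 0) i j = x * entry (GM_B n a b 1 0) i j"
proof -
  consider "i \<in> {1..n}" | "i = n + 1" "j \<in> {1..n}" | "i = n + 1" "j = n + 1"
    using assms by force
  then show ?thesis
  proof cases
    case 1
    then show ?thesis using assms by (simp add: entry_GM_B_upper)
  next
    case 2
    show ?thesis unfolding 2(1) entry_GM_B_last[OF 2(2)] by simp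
  next
    case 3
    then show ?thesis by (simp only: entry_GM_B_last_last) simp
  qed
qed

text \<open>The row \<open>i + 1\<close> of \<open>\<Omega>\<close> is obtained from the row \<open>i\<close> by differentiation with respect to
  \<open>a = t\<^sub>1\<close>, an operation under which the following class of functions is closed.\<close>

inductive rational :: "nat \<Rightarrow> int \<Rightarrow> (complex \<Rightarrow> complex \<Rightarrow> complex) \<Rightarrow> bool" for n :: nat where
  const: "rational n 0 (\<lambda>a b. k)"
| zero: "rational n r (\<lambda>a b. 0)"
| fst: "rational n 1 (\<lambda>a b. a)"
| snd: "rational n (int n + 2) (\<lambda>a b. b)"
| disc: "rational n (- (int n + 2)) (\<lambda>a b. 1 / (a ^ (n + 2) - b))"
| add: "rational n r f \<Longrightarrow> rational n r g \<Longrightarrow> rational n r (\<lambda>a b. f a b + g a b)"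
| mult: "rational n r f \<Longrightarrow> rational n s g \<Longrightarrow> rational n (r + s) (\<lambda>a b. f a b * g a b)"

lemma rational_cmult: "rational n r f \<Longrightarrow> rational n r (\<lambda>a b. k * f a b)"
  using rational.mult[OF rational.const] by fastforce

lemma rational_power: "rational n (int k) (\<lambda>a b. a ^ k)"
proof (induction k)
  case 0
  then show ?case by (simp add: rational.const)
next
  case (Suc k)
  show ?case using rational.mult[OF rational.fst Suc] by simp
qed

lemma rational_sum:
  "(\<And>i. i \<in> A \<Longrightarrow> rational n r (f i)) \<Longrightarrow> rational n r (\<lambda>a b. \<Sum>i\<in>A. f i a b)"
  by (induction A rule: infinite_finite_induct) (auto intro: rational.add rational.zero)

lemma rational_deriv:
  assumes "rational n r f"
  shows "\<exists>g. rational n (r - 1) g \<and> (\<forall>a b. a ^ (n + 2) \<noteq> b \<longrightarrow>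
    ((\<lambda>a'. f a' b) has_field_derivative g a b) (at a))"
  using assms
proof (induction rule: rational.induct)
  case (const k)
  show ?case by (intro exI[of _ "\<lambda>a b. 0"]) (auto intro: rational.zero)
next
  case (zero r)
  show ?case by (intro exI[of _ "\<lambda>a b. 0"]) (auto intro: rational.zero)
next
  case fst
  show ?case using rational.const[of n 1] by (intro exI[of _ "\<lambda>a b. 1"]) auto
next
  case snd
  show ?case by (intro exI[of _ "\<lambda>a b. 0"]) (auto intro: rational.zero)
next
  case disc
  let ?g = "\<lambda>a b. - of_nat (n + 2) * (a ^ (n + 1) * (1 / (a ^ (n + 2) - b) * (1 / (a ^ (n + 2) - b))))"
  have "rational n (- (int n + 2) - 1) ?g"
    using rational_cmult[OF rational.mult[OF rational_power[of n "n + 1"]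
        rational.mult[OF rational.disc rational.disc]], of "- of_nat (n + 2)"]
    by (simp add: algebra_simps)
  moreover have "((\<lambda>a'. 1 / (a' ^ (n + 2) - b)) has_field_derivative ?g a b) (at a)"
    if "a ^ (n + 2) \<noteq> b" for a b :: complex
    by (rule derivative_eq_intros refl | use that in \<open>simp add: field_simps\<close>)+
  ultimately show ?case by blast
next
  case (add r f g)
  then obtain f' g' where *: "rational n (r - 1) f'" "rational n (r - 1) g'"
    "\<forall>a b. a ^ (n + 2) \<noteq> b \<longrightarrow> ((\<lambda>a'. f a' b) has_field_derivative f' a b) (at a)"
    "\<forall>a b. a ^ (n + 2) \<noteq> b \<longrightarrow> ((\<lambda>a'. g a' b) has_field_derivative g' a b) (at a)"
    by blast
  show ?case
    by (rule exI[of _ "\<lambda>a b. f' a b + g' a b"]) (use * in \<open>auto intro: rational.add DERIV_add\<close>)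
next
  case (mult r f s g)
  then obtain f' g' where *: "rational n (r - 1) f'" "rational n (s - 1) g'"
    "\<forall>a b. a ^ (n + 2) \<noteq> b \<longrightarrow> ((\<lambda>a'. f a' b) has_field_derivative f' a b) (at a)"
    "\<forall>a b. a ^ (n + 2) \<noteq> b \<longrightarrow> ((\<lambda>a'. g a' b) has_field_derivative g' a b) (at a)"
    by blast
  have "rational n (r + s - 1) (\<lambda>a b. f' a b * g a b + g' a b * f a b)"
    using rational.add[OF rational.mult[OF *(1) mult(2)], of "\<lambda>a b. g' a b * f a b"]
      rational.mult[OF *(2) mult(1)] by (simp add: algebra_simps)
  then show ?case
    by (intro exI[of _ "\<lambda>a b. f' a b * g a b + g' a b * f a b"]) (use * in \<open>auto intro!: DERIV_mult\<close>)
qed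

text \<open>The weight is dictated by d omega_j / da = sum_k B_jk omega_k when omega_j is given
  weight -j, since differentiation in a lowers weights by one.\<close>

lemma rational_GM_B:
  assumes "j \<in> {1..n + 1}" "k \<in> {1..n + 1}"
  shows "rational n (int k - int j - 1) (\<lambda>a b. entry (GM_B n a b 1 0) j k)"
proof (cases "j \<le> n")
  case True
  then have "(\<lambda>a b. entry (GM_B n a b 1 0) j k) = (\<lambda>a b. if k = j + 1 then 1 else 0)"
    using assms by (auto simp: entry_GM_B_upper fun_eq_iff)
  then show ?thesis by (auto intro: rational.zero rational.const)
next
  case False
  then have j: "j = n + 1" using assms by auto
  then have eq: "int k - int j - 1 = int k + - (int n + 2)" by simp
  have "(\<lambda>a b. entry (GM_B n a b 1 0) j k) =
    (\<lambda>a b. - of_nat (Stirling (n + 2) k) * (a ^ k * (1 / (a ^ (n + 2) - b))))"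
  proof (cases "k \<le> n")
    case True
    then have "k \<in> {1..n}" using assms by auto
    then show ?thesis unfolding j entry_GM_B_last[OF \<open>k \<in> {1..n}\<close>] by auto
  next
    case False
    then have k: "k = n + 1" using assms by auto
    show ?thesis unfolding j k entry_GM_B_last_last
      by (simp only: mult_1_right mult.assoc mult_minus_left)
  qed
  then show ?thesis
    using rational_cmult[OF rational.mult[OF rational_power[of n k] rational.disc], of "- of_nat (Stirling (n + 2) k)"]
    by (simp only: eq)
qed

locale dwork =
  fixes n :: nat and c :: complex and \<Omega> :: "complex \<Rightarrow> complex \<Rightarrow> complex mat"
  assumes n_pos: "n \<ge> 1" and c_nonzero: "c \<noteq> 0" and intersection: "intersection_matrix n c \<Omega>"
begin

context
  fixes a b :: complex
  assumes U: "b * (a ^ (n + 2) - b) \<noteq> 0"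
begin

lemma Omega_carrier: "\<Omega> a b \<in> carrier_mat (n + 1) (n + 1)"
  using intersection U unfolding intersection_matrix_def by blast

lemma Omega_zero:
  "i \<in> {1..n + 1} \<Longrightarrow> j \<in> {1..n + 1} \<Longrightarrow> i + j \<le> n + 1 \<Longrightarrow> entry (\<Omega> a b) i j = 0"
  using intersection U unfolding intersection_matrix_def by blast

lemma Omega_corner:
  "entry (\<Omega> a b) 1 (n + 1) = (- of_nat (n + 2)) ^ n * (c / (a ^ (n + 2) - b))"
  using intersection U unfolding intersection_matrix_def by blast

lemma Omega_antidiagonal:
  "j \<in> {1..n + 1} \<Longrightarrow> entry (\<Omega> a b) j (n + 2 - j) = (-1) ^ (j - 1) * entry (\<Omega> a b) 1 (n + 1)"
  using intersection U unfolding intersection_matrix_def by blast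

lemma Omega_symmetric:
  assumes "i \<in> {1..n + 1}" "j \<in> {1..n + 1}"
  shows "entry (\<Omega> a b) j i = (-1) ^ n * entry (\<Omega> a b) i j"
proof -
  have "transpose_mat (\<Omega> a b) = ((-1) ^ n) \<cdot>\<^sub>m \<Omega> a b"
    using intersection U unfolding intersection_matrix_def by blast
  then show ?thesis
    using entry_transpose[OF Omega_carrier assms] entry_smult[OF Omega_carrier assms] by metis
qed

lemma Omega_deriv:
  assumes ij: "i \<in> {1..n + 1}" "j \<in> {1..n + 1}"
  shows "((\<lambda>a'. entry (\<Omega> a' b) i j) has_field_derivative
    (\<Sum>k = 1..n + 1. entry (GM_B n a b 1 0) i k * entry (\<Omega> a b) k j)
    + (\<Sum>k = 1..n + 1. entry (\<Omega> a b) i k * entry (GM_B n a b 1 0) j k)) (at a)"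
    (is "(_ has_field_derivative ?D) _")
proof -
  let ?L = "\<lambda>x y. entry (GM_B n a b x y * \<Omega> a b + \<Omega> a b * transpose_mat (GM_B n a b x y)) i j"
  have "((\<lambda>(a', b'). entry (\<Omega> a' b') i j) has_derivative (\<lambda>(x, y). ?L x y)) (at (a, b))"
    using intersection U ij unfolding intersection_matrix_def by blast
  moreover have "((\<lambda>a'. (a', b)) has_derivative (\<lambda>x. (x, 0))) (at a)"
    by (auto intro!: derivative_eq_intros)
  ultimately have "((\<lambda>a'. entry (\<Omega> a' b) i j) has_derivative (\<lambda>x. ?L x 0)) (at a)"
    using has_derivative_compose[of "\<lambda>a'. (a', b)" "\<lambda>x. (x, 0)" a UNIV
        "\<lambda>(a', b'). entry (\<Omega> a' b') i j" "\<lambda>(x, y). ?L x y"] by simp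
  moreover have "?L x 0 = ?D * x" for x
  proof -
    have "?L x 0 = (\<Sum>k = 1..n + 1. entry (GM_B n a b x 0) i k * entry (\<Omega> a b) k j)
      + (\<Sum>k = 1..n + 1. entry (\<Omega> a b) i k * entry (transpose_mat (GM_B n a b x 0)) k j)"
      using Omega_carrier ij
      by (subst entry_add[where N = "n + 1"], simp_all only: mult_carrier_mat[OF GM_B_carrier Omega_carrier]
        mult_carrier_mat[OF Omega_carrier transpose_carrier_mat[THEN iffD2, OF GM_B_carrier]]
        entry_mult[OF GM_B_carrier Omega_carrier ij]
        entry_mult[OF Omega_carrier transpose_carrier_mat[THEN iffD2, OF GM_B_carrier] ij])
    also have "\<dots> = (\<Sum>k = 1..n + 1. (x * entry (GM_B n a b 1 0) i k) * entry (\<Omega> a b) k j)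
      + (\<Sum>k = 1..n + 1. entry (\<Omega> a b) i k * (x * entry (GM_B n a b 1 0) j k))"
      using ij by (intro arg_cong2[where f = "(+)"] sum.cong refl)
        (simp_all add: entry_transpose[OF GM_B_carrier] GM_B_linear[of _ n _ _ _ x])
    finally show ?thesis by (simp add: sum_distrib_left sum_distrib_right algebra_simps)
  qed
  ultimately show ?thesis by (simp add: has_field_derivative_def)
qed

end

text \<open>In the direction of t_1, row i \<le> n of B has a single nonzero entry, a 1 in column i
  + 1. Hence d Omega_ij / da = Omega_{i+1,j} + sum_k Omega_ik B_jk, and solving for row i + 1 gives
  the induction step. Row 1 consists of zeros and the corner entry.\<close>

lemma Omega_rational:
  assumes "i \<in> {1..n + 1}" "j \<in> {1..n + 1}"
  shows "\<exists>f. rational n (- (int i + int j)) f \<and>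
    (\<forall>a b. b * (a ^ (n + 2) - b) \<noteq> 0 \<longrightarrow> entry (\<Omega> a b) i j = f a b)"
proof -
  have "1 \<le> i" using assms by auto
  then show ?thesis using assms
  proof (induction i arbitrary: j rule: dec_induct)
    case base
    show ?case
    proof (cases "j = n + 1")
      case True
      define f where "f = (\<lambda>a b. ((- of_nat (n + 2)) ^ n * c) * (1 / (a ^ (n + 2) - b)))"
      have "rational n (- (int n + 2)) f"
        unfolding f_def by (intro rational_cmult rational.disc)
      moreover have "- (int 1 + int j) = - (int n + 2)"
        unfolding True by simp
      moreover have "\<forall>a b. b * (a ^ (n + 2) - b) \<noteq> 0 \<longrightarrow> entry (\<Omega> a b) 1 j = f a b"
        unfolding True f_def using Omega_corner by simp
      ultimately show ?thesis by metis
    next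
      case False
      then show ?thesis using base
        by (intro exI[of _ "\<lambda>a b. 0"]) (auto intro: rational.zero Omega_zero)
    qed
  next
    case (step i)
    then have i: "i \<in> {1..n}" "i \<in> {1..n + 1}" by auto
    have "\<forall>k\<in>{1..n + 1}. \<exists>f. rational n (- (int i + int k)) f \<and>
      (\<forall>a b. b * (a ^ (n + 2) - b) \<noteq> 0 \<longrightarrow> entry (\<Omega> a b) i k = f a b)"
      using step.IH i by blast
    then obtain F where F: "\<And>k. k \<in> {1..n + 1} \<Longrightarrow> rational n (- (int i + int k)) (F k)"
      "\<And>k a b. k \<in> {1..n + 1} \<Longrightarrow> b * (a ^ (n + 2) - b) \<noteq> 0 \<Longrightarrow> entry (\<Omega> a b) i k = F k a b"
      by metis
    obtain g where g: "rational n (- (int i + int j) - 1) g"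
      "\<And>a b. a ^ (n + 2) \<noteq> b \<Longrightarrow> ((\<lambda>a'. F j a' b) has_field_derivative g a b) (at a)"
      using rational_deriv[OF F(1)] step.prems by blast
    define h where "h = (\<lambda>a b. g a b + (-1) * (\<Sum>k = 1..n + 1. F k a b * entry (GM_B n a b 1 0) j k))"
    have "rational n (- (int i + int j) - 1) (\<lambda>a b. F k a b * entry (GM_B n a b 1 0) j k)"
      if "k \<in> {1..n + 1}" for k
      using rational.mult[OF F(1)[OF that] rational_GM_B[OF step.prems(2) that]] by (simp add: algebra_simps)
    then have "rational n (- (int i + int j) - 1) h"
      unfolding h_def by (intro rational.add rational_cmult rational_sum g(1))
    moreover have "- (int i + int j) - 1 = - (int (Suc i) + int j)" by simp
    ultimately have "rational n (- (int (Suc i) + int j)) h"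
      by (simp only:)
    moreover have "entry (\<Omega> a b) (Suc i) j = h a b" if U: "b * (a ^ (n + 2) - b) \<noteq> 0" for a b
    proof -
      \<comment> \<open>\<open>F j\<close> agrees with the entry of Omega on this set only; as it is
        open in a, the two have the same derivative there.\<close>
      have op: "open {a. b * (a ^ (n + 2) - b) \<noteq> 0}"
        by (intro open_Collect_neq continuous_intros)
      have "((\<lambda>a'. entry (\<Omega> a' b) i j) has_field_derivative g a b) (at a)"
        by (rule has_field_derivative_transform_within_open[OF g(2) op])
          (use U F(2)[OF step.prems(2)] in auto)
      then have "g a b = (\<Sum>k = 1..n + 1. entry (GM_B n a b 1 0) i k * entry (\<Omega> a b) k j)
        + (\<Sum>k = 1..n + 1. entry (\<Omega> a b) i k * entry (GM_B n a b 1 0) j k)"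
        using Omega_deriv[OF U i(2) step.prems(2)] by (rule DERIV_unique)
      also have "(\<Sum>k = 1..n + 1. entry (GM_B n a b 1 0) i k * entry (\<Omega> a b) k j) =
          entry (GM_B n a b 1 0) i (i + 1) * entry (\<Omega> a b) (i + 1) j"
        by (rule sum_single) (use i in \<open>auto simp: entry_GM_B_upper\<close>)
      also have "entry (GM_B n a b 1 0) i (i + 1) = 1"
        using i by (simp add: entry_GM_B_upper)
      also have "(\<Sum>k = 1..n + 1. entry (\<Omega> a b) i k * entry (GM_B n a b 1 0) j k) =
        (\<Sum>k = 1..n + 1. F k a b * entry (GM_B n a b 1 0) j k)"
        by (intro sum.cong refl) (simp add: F(2)[OF _ U])
      finally show ?thesis by (simp add: h_def)
    qed
    ultimately show ?case by blast
  qed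
qed

end

subsection \<open>Coordinates on the moduli space\<close>

definition phi :: "nat \<Rightarrow> nat \<Rightarrow> nat \<Rightarrow> complex" where
  "phi n i j = (if i + j = n + 2 then (if odd n \<and> i > dwork_m n then -1 else 1) else 0)"

lemma phi_nonzero: "i + j = n + 2 \<Longrightarrow> phi n i j \<noteq> 0"
  by (simp add: phi_def)

lemma phi_zero: "i + j \<noteq> n + 2 \<Longrightarrow> phi n i j = 0"
  by (simp add: phi_def)

context dwork
begin

abbreviation T :: "point set" where "T \<equiv> moduli_T n \<Omega>"

definition ta :: "point \<Rightarrow> complex" where "ta p = fst p"
definition tb :: "point \<Rightarrow> complex" where "tb p = fst (snd p)"
definition s :: "nat \<Rightarrow> nat \<Rightarrow> point \<Rightarrow> complex" where "s i j p = entry (snd (snd p)) i j"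

definition Om :: "nat \<Rightarrow> nat \<Rightarrow> point \<Rightarrow> complex" where
  "Om i j p = entry (\<Omega> (ta p) (tb p)) i j"

lemma T_disc:
  assumes "p \<in> T"
  shows "tb p * (ta p ^ (n + 2) - tb p) \<noteq> 0" "tb p \<noteq> 0" "ta p ^ (n + 2) - tb p \<noteq> 0"
  using assms by (auto simp: moduli_T_def ta_def tb_def)

lemma T_S:
  assumes "p \<in> T"
  shows "snd (snd p) \<in> carrier_mat (n + 1) (n + 1)"
    "snd (snd p) * \<Omega> (ta p) (tb p) * transpose_mat (snd (snd p)) = Phi n"
  using assms by (auto simp: moduli_T_def ta_def tb_def)

lemma s_upper:
  "p \<in> T \<Longrightarrow> 1 \<le> i \<Longrightarrow> i < j \<Longrightarrow> j \<le> n + 1 \<Longrightarrow> s i j p = 0"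
  by (cases p) (auto simp: moduli_T_def s_def)

lemma s_11: "p \<in> T \<Longrightarrow> s 1 1 p = 1"
  by (auto simp: moduli_T_def s_def)

lemma s_pairing:
  assumes "p \<in> T" "i \<in> {1..n + 1}" "j \<in> {1..n + 1}"
  shows "(\<Sum>k = 1..n + 1. \<Sum>l = 1..n + 1. s i k p * Om k l p * s j l p) = phi n i j"
proof -
  note S = T_S(1)[OF assms(1)] and O = Omega_carrier[OF T_disc(1)[OF assms(1)]]
  have St: "transpose_mat (snd (snd p)) \<in> carrier_mat (n + 1) (n + 1)" using S by simp
  have "phi n i j = entry (Phi n) i j"
    using assms(2,3) by (simp add: Phi_def phi_def)
  also have "\<dots> = (\<Sum>l = 1..n + 1. (\<Sum>k = 1..n + 1. s i k p * Om k l p) * s j l p)"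
    unfolding T_S(2)[OF assms(1), symmetric]
    by (subst entry_mult[OF mult_carrier_mat[OF S O] St assms(2,3)])
      (intro sum.cong refl, use assms in
        \<open>simp_all add: entry_mult[OF S O] entry_transpose[OF S] s_def Om_def\<close>)
  also have "\<dots> = (\<Sum>l = 1..n + 1. \<Sum>k = 1..n + 1. s i k p * Om k l p * s j l p)"
    by (simp only: sum_distrib_right)
  also have "\<dots> = (\<Sum>k = 1..n + 1. \<Sum>l = 1..n + 1. s i k p * Om k l p * s j l p)"
    by (rule sum.swap)
  finally show ?thesis ..
qed

lemma Om_zero:
  "p \<in> T \<Longrightarrow> i \<in> {1..n + 1} \<Longrightarrow> j \<in> {1..n + 1} \<Longrightarrow> i + j \<le> n + 1 \<Longrightarrow> Om i j p = 0"
  unfolding Om_def by (rule Omega_zero[OF T_disc(1)])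

lemma Om_symmetric:
  "p \<in> T \<Longrightarrow> i \<in> {1..n + 1} \<Longrightarrow> j \<in> {1..n + 1} \<Longrightarrow> Om j i p = (-1) ^ n * Om i j p"
  unfolding Om_def by (rule Omega_symmetric[OF T_disc(1)])

definition Om_const :: "nat \<Rightarrow> complex" where
  "Om_const j = (-1) ^ (j - 1) * (- of_nat (n + 2)) ^ n * c"

lemma Om_const_nonzero: "Om_const j \<noteq> 0"
proof -
  have "complex_of_nat (n + 2) \<noteq> 0" by (metis of_nat_eq_0_iff add_2_eq_Suc' nat.distinct(1))
  then show ?thesis using c_nonzero by (simp add: Om_const_def del: of_nat_add of_nat_Suc)
qed

lemma Om_antidiagonal:
  assumes "p \<in> T" "i \<in> {1..n + 1}" "i + j = n + 2"
  shows "Om i j p = Om_const i / (ta p ^ (n + 2) - tb p)"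
proof -
  have "j = n + 2 - i" using assms by auto
  then show ?thesis
    unfolding Om_def Om_const_def using Omega_antidiagonal[OF T_disc(1)[OF assms(1)] assms(2)]
      Omega_corner[OF T_disc(1)[OF assms(1)]] by simp
qed

text \<open>What a graded algebra must contain for the entries of Omega to be homogeneous in it.
  Kept abstract because the equation for S is solved over several sets of generators.\<close>

definition base :: "(int \<times> (point \<Rightarrow> complex)) set \<Rightarrow> bool" where
  "base G \<longleftrightarrow> weighted T G (col_weight n) ta \<and> weighted T G (col_weight n * int (n + 2)) tb \<and>
     weighted T G (- (col_weight n * int (n + 2))) (\<lambda>p. 1 / (ta p ^ (n + 2) - tb p))"

lemma rational_weighted:
  assumes "base G" "rational n r f"
  shows "weighted T G (col_weight n * r) (\<lambda>p. f (ta p) (tb p))"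
  using assms(2)
proof (induction rule: rational.induct)
  case (mult r f s g)
  then show ?case using weighted_mult[OF mult(3,4)] by (simp add: algebra_simps)
qed (use assms(1) in \<open>auto simp: base_def algebra_simps intro: weighted_const weighted_zero weighted_add\<close>)

lemma Om_weighted:
  assumes "base G" "i \<in> {1..n + 1}" "j \<in> {1..n + 1}"
  shows "weighted T G (- (col_weight n * (int i + int j))) (Om i j)"
proof -
  obtain f where f: "rational n (- (int i + int j)) f"
    "\<And>a b. b * (a ^ (n + 2) - b) \<noteq> 0 \<Longrightarrow> entry (\<Omega> a b) i j = f a b"
    using Omega_rational[OF assms(2,3)] by blast
  show ?thesis
    by (rule weighted_cong[OF rational_weighted[OF assms(1) f(1)]])
      (simp_all add: Om_def f(2)[OF T_disc(1)] right_diff_distrib distrib_left)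
qed

lemma disc_weighted:
  assumes "base G"
  shows "weighted T G (col_weight n * int (n + 2)) (\<lambda>p. ta p ^ (n + 2) - tb p)"
proof -
  have a: "weighted T G (col_weight n) ta" and b: "weighted T G (col_weight n * int (n + 2)) tb"
    using assms by (auto simp: base_def)
  show ?thesis
    by (rule weighted_diff[OF weighted_cong[OF weighted_power[OF a, of "n + 2"]] b])
      (auto simp: algebra_simps)
qed

text \<open>A triangular matrix of functions is determined by its independent entries through the
  equation \<open>\<sigma> \<Omega> \<sigma>\<^sup>t\<^sup>r = \<Phi>\<close>. Its \<open>(i, n + 2 + e - i)\<close> entry involves only entries of \<open>\<sigma>\<close> at distance
  at most \<open>e\<close> from the diagonal, and those at distance exactly \<open>e\<close> are the unknown \<open>\<sigma>\<^sub>i\<^sub>,\<^sub>i\<^sub>-\<^sub>e\<close> and its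
  mirror image under \<open>i \<mapsto> n + 2 + e - i\<close>. The bound \<open>E\<close> allows to leave out corner entries.\<close>

context
  fixes \<sigma> :: "nat \<Rightarrow> nat \<Rightarrow> point \<Rightarrow> complex"
  assumes tri: "\<And>p i j. p \<in> T \<Longrightarrow> 1 \<le> i \<Longrightarrow> i < j \<Longrightarrow> j \<le> n + 1 \<Longrightarrow> \<sigma> i j p = 0"
    and pairing: "\<And>p i j. p \<in> T \<Longrightarrow> i \<in> {1..n + 1} \<Longrightarrow> j \<in> {1..n + 1} \<Longrightarrow>
      (\<Sum>k = 1..n + 1. \<Sum>l = 1..n + 1. \<sigma> i k p * Om k l p * \<sigma> j l p) = phi n i j"
begin

lemma pairing_pairs:
  assumes "p \<in> T" "i \<in> {1..n + 1}" "j \<in> {1..n + 1}"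
  shows "(\<Sum>(k, l)\<in>{1..n + 1} \<times> {1..n + 1}. \<sigma> i k p * Om k l p * \<sigma> j l p) = phi n i j"
  using pairing[OF assms] unfolding sum.cartesian_product .

text \<open>For i + j = n + 2 only the summand (k, l) = (i, j) survives: k > i or l > j is killed by
  triangularity, and all other pairs have k + l \<le> n + 1, where Omega vanishes.\<close>

lemma diagonal_product:
  assumes "p \<in> T" "i \<in> {1..n + 1}" "i + j = n + 2"
  shows "\<sigma> i i p * Om i j p * \<sigma> j j p = phi n i j" "\<sigma> i i p \<noteq> 0"
proof -
  have j: "j \<in> {1..n + 1}" using assms by auto
  have zero: "\<sigma> i k p * Om k l p * \<sigma> j l p = 0"
    if kl: "k \<in> {1..n + 1}" "l \<in> {1..n + 1}" "(k, l) \<noteq> (i, j)" for k l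
  proof -
    consider "k > i" | "l > j" | "k + l \<le> n + 1" using kl assms by force
    then show ?thesis
      by cases (use tri[OF assms(1), of i k] tri[OF assms(1), of j l] Om_zero[OF assms(1) kl(1,2)]
        kl assms(2) j in auto)
  qed
  have "(\<Sum>x\<in>{1..n + 1} \<times> {1..n + 1}. case x of (k, l) \<Rightarrow> \<sigma> i k p * Om k l p * \<sigma> j l p) =
      (case (i, j) of (k, l) \<Rightarrow> \<sigma> i k p * Om k l p * \<sigma> j l p)"
  proof (rule sum_single)
    fix x assume "x \<in> {1..n + 1} \<times> {1..n + 1}" "x \<noteq> (i, j)"
    then show "(case x of (k, l) \<Rightarrow> \<sigma> i k p * Om k l p * \<sigma> j l p) = 0"
      using zero[of "fst x" "snd x"] by (simp only: mem_Times_iff prod.collapse case_prod_beta) simp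
  qed (use assms(2) j in simp_all)
  then show "\<sigma> i i p * Om i j p * \<sigma> j j p = phi n i j"
    using pairing_pairs[OF assms(1,2) j] by simp
  then show "\<sigma> i i p \<noteq> 0" using phi_nonzero[OF assms(3)] by auto
qed

context
  fixes G :: "(int \<times> (point \<Rightarrow> complex)) set" and E :: nat
  assumes base: "base G"
    and independent: "\<And>i j. 1 \<le> j \<Longrightarrow> j \<le> i \<Longrightarrow> i \<le> n + 1 \<Longrightarrow> i - j \<le> E \<Longrightarrow>
      i + j < n + 2 \<or> i + j = n + 2 \<and> (odd n \<or> i = j) \<Longrightarrow>
      weighted T G (col_weight n * int j + row_weight n i) (\<sigma> i j)"
    and inverse: "\<And>q. 1 \<le> q \<Longrightarrow> 2 * q < n + 2 \<Longrightarrow>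
      weighted T G (- (col_weight n * int q + row_weight n q)) (\<lambda>p. 1 / \<sigma> q q p)"
begin

text \<open>From the middle on, \<open>diagonal_product\<close> expresses the reciprocal through the
  mirrored entry: with r = n + 2 - q, the reciprocal of entry (q, q) of \<sigma> is entry (r, r)
  times Omega_qr / Phi_qr.\<close>

lemma inverse_diagonal:
  assumes q: "q \<in> {1..n + 1}"
  shows "weighted T G (- (col_weight n * int q + row_weight n q)) (\<lambda>p. 1 / \<sigma> q q p)"
proof (cases "2 * q < n + 2")
  case True
  then show ?thesis using inverse q by auto
next
  case False
  define r where "r = n + 2 - q"
  have r: "r \<in> {1..n + 1}" "q + r = n + 2" "r + r < n + 2 \<or> r + r = n + 2"
    using q False by (auto simp: r_def)
  have "weighted T G (col_weight n * int r + row_weight n r) (\<sigma> r r)"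
    using independent[of r r] r by auto
  note num = weighted_mult[OF this Om_weighted[OF base q r(1)]]
  show ?thesis
  proof (rule weighted_cong[OF weighted_cmult[OF num, of "1 / phi n q r"]])
    show "col_weight n * int r + row_weight n r + - (col_weight n * (int q + int r)) =
        - (col_weight n * int q + row_weight n q)"
      using row_weight_reflect[OF n_pos q] by (simp add: r_def algebra_simps)
    fix p assume p: "p \<in> T"
    show "1 / phi n q r * (\<sigma> r r p * Om q r p) = 1 / \<sigma> q q p"
      using diagonal_product[OF p q r(2)] phi_nonzero[OF r(2)] by (simp add: field_simps)
  qed
qed

lemma inverse_Om_antidiagonal:
  assumes "i \<in> {1..n + 1}" "i + j = n + 2"
  shows "weighted T G (col_weight n * int (n + 2)) (\<lambda>p. 1 / Om i j p)"
  by (rule weighted_cong[OF weighted_cmult[OF disc_weighted[OF base], of "1 / Om_const i"]])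
    (use assms in \<open>simp_all add: Om_antidiagonal\<close>)

lemma phi_weighted:
  assumes "i \<in> {1..n + 1}"
  shows "weighted T G (row_weight n i + row_weight n j) (\<lambda>p. phi n i j)"
proof (cases "i + j = n + 2")
  case True
  then have "j = n + 2 - i" by auto
  then show ?thesis
    using row_weight_reflect[OF n_pos assms] weighted_const by simp
next
  case False
  then show ?thesis by (simp add: phi_zero weighted_zero)
qed

lemma dependent_entries:
  assumes "e < i" "i \<le> n + 1" "e \<le> E"
  shows "weighted T G (col_weight n * int (i - e) + row_weight n i) (\<sigma> i (i - e))"
  using assms
proof (induction e arbitrary: i rule: less_induct)
  case (less e)
  \<comment> \<open>The unknown \<open>\<sigma> i j\<close> is read off from entry (i, q) of the
    equation, where its coefficient contains Omega_jq \<open>\<sigma> q q\<close> with j + q = n +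
    2, hence is invertible.\<close>
  define j q where "j = i - e" and "q = n + 2 + e - i"
  have ij: "1 \<le> j" "j \<le> i" "i \<in> {1..n + 1}" "i = j + e" "j \<in> {1..n + 1}"
    using less.prems by (auto simp: j_def)
  have qi: "q + i = n + 2 + e" using less.prems(2) by (simp add: q_def)
  have q: "q \<in> {1..n + 1}" "j + q = n + 2" "e < q" "q + i = n + 2 + e"
    unfolding atLeastAtMost_iff using qi ij(1,4) less.prems(2) by linarith+
  show ?case
  proof (cases "i + j < n + 2 \<or> i + j = n + 2 \<and> (odd n \<or> i = j)")
    case True
    have "i - j \<le> E" using ij(4) less.prems(3) by simp
    from independent[OF ij(1,2) less.prems(2) this True] show ?thesis by (simp only: j_def)
  next
    case False
    have summand: "weighted T G (row_weight n i + row_weight n q) (\<lambda>p. \<sigma> i k p * Om k l p * \<sigma> q l p)"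
      if kl: "k \<in> {1..n + 1}" "l \<in> {1..n + 1}" "(k, l) \<noteq> (j, q)" "i = q \<longrightarrow> (k, l) \<noteq> (q, j)" for k l
    proof (cases "k > i \<or> l > q \<or> k + l \<le> n + 1")
      case True
      then have "\<sigma> i k p * Om k l p * \<sigma> q l p = 0" if "p \<in> T" for p
        using tri[OF that, of i k] tri[OF that, of q l] Om_zero[OF that kl(1,2)] kl ij(3) q(1) by auto
      then show ?thesis by (intro weighted_cong[OF weighted_zero refl]) simp
    next
      case False': False
      \<comment> \<open>A surviving summand has k \<le> i, l \<le> q and k + l \<ge> n + 2 = j + q.
        Apart from the pair (j, q) this forces k > j, so \<open>\<sigma> i k\<close> is strictly
        nearer to the diagonal than the unknown.\<close>
      have k: "j < k"
      proof (rule ccontr)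
        assume "\<not> j < k"
        with False' q(2) have "k = j" "l = q" by auto
        with kl(3) show False by simp
      qed
      have eqs: "i - (i - k) = k" "q - (q - l) = l" using False' by linarith+
      have ik: "i - k < e" "i - k < i" "i - k \<le> E"
        using k False' ij(4) less.prems(3) by linarith+
      have 1: "weighted T G (col_weight n * int k + row_weight n i) (\<sigma> i k)"
        using less.IH[OF ik(1,2) less.prems(2) ik(3)] unfolding eqs(1) .
      have 2: "weighted T G (col_weight n * int l + row_weight n q) (\<sigma> q l)"
      proof (cases "q - l < e")
        case True
        then have "q - l < q" "q - l \<le> E" "q \<le> n + 1"
          using False' kl(2) q(1,3) less.prems(3) by auto
        with less.IH[OF True this(1,3,2)] show ?thesis unfolding eqs(2) by blast
      next
        case ge: False
        \<comment> \<open>At full distance e the factor \<open>\<sigma> q l\<close> is the mirror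
          image of the unknown. The two do not coincide here, so q + l < n + 2 and the mirror image
          is an independent entry.\<close>
        then have l: "l + e = q" and ki: "k = i" using False' q(2) ij(4) by linarith+
        have "i \<noteq> q"
        proof
          assume "i = q"
          then have "l = j" using l ij(4) by linarith
          with kl(4) ki \<open>i = q\<close> show False by blast
        qed
        then have "q + l < n + 2" using False q(2,4) ij(4) l by linarith
        moreover have "1 \<le> l" "l \<le> q" "q \<le> n + 1" "q - l \<le> E"
          using kl(2) q(1) l less.prems(3) by auto
        ultimately show ?thesis using independent by blast
      qed
      show ?thesis
        by (rule weighted_cong[OF weighted_mult[OF weighted_mult[OF 1 Om_weighted[OF base kl(1,2)]] 2]])
          (simp_all add: algebra_simps)
    qed
    let ?A = "{1..n + 1} \<times> {1..n + 1}"
    let ?X = "\<lambda>p (k, l). \<sigma> i k p * Om k l p * \<sigma> q l p"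
    \<comment> \<open>If i = q, the summands (j, q) and (q, j) both contain the unknown. Then i + j
      = n + 2, and as the entry is dependent n is even, Omega is symmetric and the two summands are
      equal. The unknown then occurs with the factor 2 = \<open>card B\<close>.\<close>
    define B where "B = (if i = q then {(j, q), (q, j)} else {(j, q)})"
    define rest where "rest = (\<lambda>p. \<Sum>x\<in>?A - B. ?X p x)"
    have "weighted T G (row_weight n i + row_weight n q) rest"
      unfolding rest_def
    proof (rule weighted_sum)
      fix x assume x: "x \<in> ?A - B"
      obtain k l where "x = (k, l)" by (cases x)
      with x show "weighted T G (row_weight n i + row_weight n q) (\<lambda>p. ?X p x)"
        using summand[of k l] by (auto simp: B_def split: if_splits)
    qed
    then have "weighted T G (row_weight n i + row_weight n q) (\<lambda>p. phi n i q - rest p)"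
      by (intro weighted_diff phi_weighted ij)
    note num = weighted_mult[OF weighted_mult[OF this inverse_diagonal[OF q(1)]]
        inverse_Om_antidiagonal[OF ij(5) q(2)]]
    have main: "of_nat (card B) * (\<sigma> i j p * Om j q p * \<sigma> q q p) = phi n i q - rest p"
      if p: "p \<in> T" for p
    proof -
      have "B \<subseteq> ?A" using ij q by (auto simp: B_def)
      then have "(\<Sum>x\<in>?A. ?X p x) = (\<Sum>x\<in>B. ?X p x) + rest p"
        unfolding rest_def by (simp add: sum.subset_diff[of B])
      moreover have "(\<Sum>x\<in>B. ?X p x) = of_nat (card B) * (\<sigma> i j p * Om j q p * \<sigma> q q p)"
      proof (cases "i = q")
        case True
        then have "even n" "j \<noteq> q" using False q(2,4) ij by auto
        then have "Om q j p = Om j q p" using Om_symmetric[OF p ij(5) q(1)] by simp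
        then show ?thesis using True \<open>j \<noteq> q\<close> by (simp add: B_def algebra_simps)
      qed (simp add: B_def)
      ultimately show ?thesis using pairing_pairs[OF p ij(3) q(1)] by (simp add: algebra_simps)
    qed
    have card: "card B \<noteq> 0" by (auto simp: B_def card_insert_if)
    show ?thesis
    proof (rule weighted_cong[OF weighted_cmult[OF num, of "1 / of_nat (card B)"]])
      show "row_weight n i + row_weight n q + - (col_weight n * int q + row_weight n q) +
          col_weight n * int (n + 2) = col_weight n * int (i - e) + row_weight n i"
        unfolding j_def[symmetric] q(2)[symmetric] by (simp add: algebra_simps)
      fix p assume p: "p \<in> T"
      have "Om j q p \<noteq> 0"
        using Om_antidiagonal[OF p ij(5) q(2)] Om_const_nonzero T_disc(3)[OF p] by simp
      moreover have "\<sigma> q q p \<noteq> 0" using diagonal_product(2)[OF p q(1)] q(2) by (metis add.commute)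
      ultimately show "1 / of_nat (card B) * ((phi n i q - rest p) * (1 / \<sigma> q q p) * (1 / Om j q p)) =
          \<sigma> i (i - e) p"
        using card unfolding main[OF p, symmetric] j_def[symmetric] by simp
    qed
  qed
qed

end

end

subsection \<open>Generators\<close>


lemma s_fun_eq: "s_fun n \<Omega> i j = on_set T (s i j)"
  unfolding s_fun_def s_def by (rule arg_cong[where f = "on_set T"]) auto

lemma t_fun_1: "t_fun n \<Omega> 1 = on_set T ta"
  unfolding t_fun_def ta_def by (auto intro!: arg_cong[where f = "on_set T"])

lemma t_fun_disc: "t_fun n \<Omega> (n + 2) = on_set T tb"
  unfolding t_fun_def tb_def by (auto intro!: arg_cong[where f = "on_set T"])

definition mid :: nat where "mid = (n + 2) div 2"

lemma u_fun_eq: "u_fun n \<Omega> = on_set T (s mid mid)"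
  unfolding u_fun_def s_fun_eq mid_def ..

definition special :: "variant \<Rightarrow> bool" where
  "special v \<longleftrightarrow> v = Option1 \<and> odd n \<and> n \<ge> 3"

definition corner :: "point \<Rightarrow> complex" where
  "corner p = s (n + 1) 1 p + s 2 1 p * s n 1 p"

lemma t_fun_position:
  assumes "j \<in> index_I n - {1, n + 2}" "position n j = (i, k)"
  shows "t_fun n \<Omega> j = on_set T (s i k)"
  using assms unfolding t_fun_def by (simp add: s_fun_eq)

lemma chart_not_special:
  assumes "j \<noteq> dwork_d n \<or> \<not> special v"
  shows "chart v n \<Omega> j = t_fun n \<Omega> j"
  unfolding chart_def by (rule if_not_P) (use assms in \<open>unfold special_def, blast\<close>)

lemma chart_basic:
  "chart v n \<Omega> 1 = on_set T ta" "chart v n \<Omega> (n + 2) = on_set T tb"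
proof -
  have *: "dwork_d n \<in> index_I n - {1, n + 2}" if "special v"
    using that last_indices(1) unfolding special_def by blast
  have "1 \<noteq> dwork_d n \<or> \<not> special v" using * by auto
  from trans[OF chart_not_special[OF this] t_fun_1]
  show "chart v n \<Omega> 1 = on_set T ta" .
  have "n + 2 \<noteq> dwork_d n \<or> \<not> special v" using * by auto
  from trans[OF chart_not_special[OF this] t_fun_disc]
  show "chart v n \<Omega> (n + 2) = on_set T tb" .
qed

lemma chart_position:
  assumes "j \<in> index_I n - {1, n + 2}" "position n j = (i, k)" "\<not> (special v \<and> (i, k) = (n + 1, 1))"
  shows "chart v n \<Omega> j = on_set T (s i k)"
proof -
  have "j \<noteq> dwork_d n \<or> \<not> special v"
    using assms(2,3) last_indices(2) unfolding special_def by metis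
  from trans[OF chart_not_special[OF this] t_fun_position[OF assms(1,2)]] show ?thesis .
qed

lemma chart_special:
  assumes "special v"
  shows "chart v n \<Omega> (dwork_d n) = on_set T corner"
proof -
  have n: "odd n" "n \<ge> 3" and v: "v = Option1" using assms by (auto simp: special_def)
  note L = last_indices[OF n]
  have t: "t_fun n \<Omega> (dwork_d n) = on_set T (s (n + 1) 1)"
    "t_fun n \<Omega> (chart_partner n) = on_set T (s n 1)" "t_fun n \<Omega> 2 = on_set T (s 2 1)"
    using t_fun_position L basic_indices[OF n_pos] by blast+
  have "chart v n \<Omega> (dwork_d n) =
    (\<lambda>p. t_fun n \<Omega> (dwork_d n) p + t_fun n \<Omega> 2 p * t_fun n \<Omega> (chart_partner n) p)"
    using n v by (simp add: chart_def chart_partner_def dwork_d_def)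
  then show ?thesis unfolding t corner_def by (auto simp: on_set_def fun_eq_iff)
qed

lemma chart_vanishing: "vanishing_outside T (chart v n \<Omega> j)"
proof (rule vanishing_outsideI)
  fix p assume p: "p \<notin> T"
  have z: "t_fun n \<Omega> j p = 0" for j
    unfolding t_fun_def s_fun_eq using p by (simp add: on_set_def)
  have "chart v n \<Omega> j = t_fun n \<Omega> j \<or>
      (\<exists>i k l. chart v n \<Omega> j = (\<lambda>p. t_fun n \<Omega> i p + t_fun n \<Omega> k p * t_fun n \<Omega> l p))"
    unfolding chart_def by metis
  then show "chart v n \<Omega> j p = 0"
    by (elim disjE exE) (simp_all only: z mult_zero_left add_0_left)
qed

text \<open>The flag chooses the algebra: \<open>True\<close> for quasi-modular forms,
  \<open>False\<close> for modular forms, where t_2 is left out. Statements valid in both are proved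
  for a variable flag.\<close>

definition idx :: "bool \<Rightarrow> nat set" where
  "idx full = (if full then index_I n else index_I n - {2})"

abbreviation Gen :: "variant \<Rightarrow> bool \<Rightarrow> (int \<times> (point \<Rightarrow> complex)) set" where
  "Gen v full \<equiv> generators v n \<Omega> (idx full)"

abbreviation WT :: "variant \<Rightarrow> bool \<Rightarrow> int \<Rightarrow> (point \<Rightarrow> complex) \<Rightarrow> bool" where
  "WT v full \<equiv> weighted T (Gen v full)"

definition entry_weight :: "nat \<Rightarrow> nat \<Rightarrow> int" where
  "entry_weight i k = col_weight n * int k + row_weight n i"

lemma entry_weight_1: "entry_weight 1 1 = 0"
  using n_pos by (simp add: entry_weight_def col_weight_def row_weight_def)

lemma idx_basic: "1 \<in> idx full" "n + 2 \<in> idx full"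
  using basic_indices[OF n_pos] n_pos by (auto simp: idx_def)

lemma gen_chart: "j \<in> idx full \<Longrightarrow> (weight n j, chart v n \<Omega> j) \<in> Gen v full"
  unfolding generators_def by blast

lemma gen_ta: "WT v full (col_weight n) ta"
  using gen_chart[OF idx_basic(1)] unfolding chart_basic weight_basic[OF n_pos] by (rule weighted_gen)

lemma gen_tb: "WT v full (col_weight n * int (n + 2)) tb"
  using gen_chart[OF idx_basic(2)] unfolding chart_basic weight_basic[OF n_pos] by (rule weighted_gen)

lemma gen_s:
  assumes "(i, k) \<in> set (positions n)" "full \<or> (i, k) \<noteq> (2, 1)" "\<not> (special v \<and> (i, k) = (n + 1, 1))"
  shows "WT v full (entry_weight i k) (s i k)"
proof -
  obtain j where j: "j \<in> index_I n - {1, n + 2}" "position n j = (i, k)"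
    using position_ex[OF n_pos assms(1)] by blast
  then have "j \<in> idx full" using assms(2) basic_indices(4)[OF n_pos] by (auto simp: idx_def)
  from gen_chart[OF this, of v] show ?thesis
    unfolding chart_position[OF j assms(3)] weight_position[OF n_pos j] entry_weight_def
    by (rule weighted_gen)
qed

lemma gen_u:
  assumes "even n"
  shows "WT v full (entry_weight mid mid) (s mid mid)"
proof -
  have "(weight_u n, u_fun n \<Omega>) \<in> Gen v full" using assms by (simp add: generators_def)
  then show ?thesis
    unfolding u_fun_eq weight_u_eq[OF n_pos assms] entry_weight_def mid_def[symmetric]
    by (rule weighted_gen)
qed

lemma gen_corner:
  assumes "special v"
  shows "WT v full (entry_weight (n + 1) 1) corner"
proof -
  have n: "odd n" "n \<ge> 3" using assms by (auto simp: special_def)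
  note L = last_indices[OF n]
  have "dwork_d n \<noteq> 2" using L(2) basic_indices(4)[OF n_pos] n by auto
  then have "dwork_d n \<in> idx full" using L(1) by (auto simp: idx_def)
  from gen_chart[OF this, of v] show ?thesis
    unfolding chart_special[OF assms] weight_position[OF n_pos L(1,2)] entry_weight_def
    by (rule weighted_gen)
qed

lemma s_diagonal_nonzero: "p \<in> T \<Longrightarrow> q \<in> {1..n + 1} \<Longrightarrow> s q q p \<noteq> 0"
  by (rule diagonal_product(2)[where \<sigma> = s and j = "n + 2 - q"]) (use s_upper s_pairing in auto)

text \<open>A diagonal coordinate is neither t_2 = s_21 nor the corner, so it is a generator of both
  algebras and the same function in both charts.\<close>

lemma diagonal_index:
  assumes "j \<in> diagonal_I n"
  obtains q where "q \<in> {2..n + 1}" "2 * q < n + 2 \<or> 2 * q = n + 2 \<and> odd n" "position n j = (q, q)"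
    "chart v n \<Omega> j = on_set T (s q q)" "j \<in> idx full"
proof -
  define q where "q = fst (position n j)"
  have j: "j \<in> index_I n - {1, n + 2}" and "fst (position n j) = snd (position n j)"
    using assms unfolding diagonal_I_def by blast+
  then have pos: "position n j = (q, q)" unfolding q_def by (metis prod.collapse)
  note j = j pos
  have "(q, q) \<in> set (positions n)" using position_in[OF n_pos j(1)] j(2) by simp
  then have q: "q \<in> {2..n + 1}" "2 * q < n + 2 \<or> 2 * q = n + 2 \<and> odd n"
    unfolding set_positions by (auto split: if_splits)
  have "chart v n \<Omega> j = on_set T (s q q)" by (rule chart_position[OF j]) (use n_pos in auto)
  moreover have "j \<in> idx full" using j basic_indices(4)[OF n_pos] by (auto simp: idx_def)
  ultimately show ?thesis using that q j(2) by blast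
qed

definition denominator :: "variant \<Rightarrow> point \<Rightarrow> complex" where
  "denominator v p = chart v n \<Omega> (n + 2) p * (chart v n \<Omega> (n + 2) p - chart v n \<Omega> 1 p ^ (n + 2))
     * (\<Prod>j\<in>diagonal_I n. chart v n \<Omega> j p)"

definition denominator_weight :: int where
  "denominator_weight = 2 * weight n (n + 2) + (\<Sum>j\<in>diagonal_I n. weight n j)"

lemma generators_eq:
  "Gen v full = (\<lambda>j. (weight n j, chart v n \<Omega> j)) ` idx full \<union>
     (if even n then {(weight_u n, u_fun n \<Omega>)} else {}) \<union>
     {(- denominator_weight, on_set T (\<lambda>p. 1 / denominator v p))}"
  unfolding generators_def denominator_weight_def denominator_def ..

lemma denominator_nonzero:
  assumes "p \<in> T"
  shows "denominator v p \<noteq> 0"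
proof -
  have "chart v n \<Omega> j p \<noteq> 0" if "j \<in> diagonal_I n" for j
    using that s_diagonal_nonzero[OF assms] assms by (elim diagonal_index[of _ v True]) auto
  then show ?thesis
    unfolding denominator_def chart_basic using assms T_disc[OF assms] by simp
qed

lemma gen_inverse: "WT v full (- denominator_weight) (\<lambda>p. 1 / denominator v p)"
  by (rule weighted_gen) (simp add: generators_eq)

lemma weighted_chart: "j \<in> idx full \<Longrightarrow> WT v full (weight n j) (chart v n \<Omega> j)"
  using homogeneous.gen[OF gen_chart] chart_vanishing by (simp add: weighted_def vanishing_outside_def)

lemma diagonal_subset: "diagonal_I n \<subseteq> idx full"
  by (meson diagonal_index subsetI)

lemma disc_power: "WT v full (weight n (n + 2)) (\<lambda>p. chart v n \<Omega> 1 p ^ (n + 2))"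
  by (rule weighted_cong[OF weighted_power[OF weighted_chart[OF idx_basic(1)], where k = "n + 2"]])
    (simp_all only: weight_basic[OF n_pos] mult.commute)

text \<open>The inverse generator times all factors of its denominator but one is the reciprocal of
  that factor. The sign appears because the denominator contains t_{n+2} - t_1^(n+2).\<close>

lemma generators_base: "base (Gen v full)"
  unfolding base_def
proof (intro conjI gen_ta gen_tb)
  have "WT v full ((- denominator_weight + weight n (n + 2)) + (\<Sum>j\<in>diagonal_I n. weight n j))
    (\<lambda>p. (1 / denominator v p * chart v n \<Omega> (n + 2) p) * (\<Prod>j\<in>diagonal_I n. chart v n \<Omega> j p))"
    by (intro weighted_mult gen_inverse weighted_prod weighted_chart idx_basic)
      (use diagonal_subset in blast)
  from weighted_minus[OF this]
  show "WT v full (- (col_weight n * int (n + 2))) (\<lambda>p. 1 / (ta p ^ (n + 2) - tb p))"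
  proof (rule weighted_cong)
    show "- denominator_weight + weight n (n + 2) + (\<Sum>j\<in>diagonal_I n. weight n j) =
        - (col_weight n * int (n + 2))"
      unfolding denominator_weight_def weight_basic(2)[OF n_pos, symmetric] by linarith
    fix p assume p: "p \<in> T"
    have "X \<noteq> 0 \<Longrightarrow> Y \<noteq> 0 \<Longrightarrow> Z - Y \<noteq> 0 \<Longrightarrow> - (1 / (Y * (Y - Z) * X) * Y * X) = 1 / (Z - Y)"
      for X Y Z :: complex by (simp add: divide_simps)
    then show "- (1 / denominator v p * chart v n \<Omega> (n + 2) p * (\<Prod>j\<in>diagonal_I n. chart v n \<Omega> j p)) =
        1 / (ta p ^ (n + 2) - tb p)"
      using denominator_nonzero[OF p, of v] T_disc[OF p] p
      unfolding denominator_def chart_basic by simp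
  qed
qed

text \<open>As for the discriminant, now leaving out the factor s_qq: a diagonal position with q > 1
  and 2q < n + 2 is always a coordinate. For q = 1 the entry is the constant 1.\<close>

lemma inverse_small_diagonal:
  assumes "1 \<le> q" "2 * q < n + 2"
  shows "WT v full (- entry_weight q q) (\<lambda>p. 1 / s q q p)"
proof (cases "q = 1")
  case True
  show ?thesis unfolding True using entry_weight_1
    by (intro weighted_cong[OF weighted_const[of _ _ 1]]) (simp_all only: s_11, simp_all)
next
  case False
  then have "(q, q) \<in> set (positions n)" unfolding set_positions using assms by simp
  then obtain j where j: "j \<in> index_I n - {1, n + 2}" "position n j = (q, q)"
    using position_ex[OF n_pos] by blast
  then have jd: "j \<in> diagonal_I n" by (simp add: diagonal_I_def)
  have cj: "chart v n \<Omega> j = on_set T (s q q)"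
    by (rule chart_position[OF j]) (use n_pos in auto)
  let ?R = "diagonal_I n - {j}"
  have "WT v full ((- denominator_weight + (weight n (n + 2) + weight n (n + 2))) + (\<Sum>j\<in>?R. weight n j))
    (\<lambda>p. (1 / denominator v p * (chart v n \<Omega> (n + 2) p * (chart v n \<Omega> (n + 2) p - chart v n \<Omega> 1 p ^ (n + 2))))
       * (\<Prod>j\<in>?R. chart v n \<Omega> j p))"
    by (intro weighted_mult gen_inverse weighted_prod weighted_chart weighted_diff disc_power idx_basic)
      (use diagonal_subset in blast)
  then show ?thesis
  proof (rule weighted_cong)
    show "- denominator_weight + (weight n (n + 2) + weight n (n + 2)) + (\<Sum>j\<in>?R. weight n j) =
        - entry_weight q q"
      using weight_position[OF n_pos j] sum.remove[OF finite_diagonal_I jd, of "weight n"]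
      by (simp add: denominator_weight_def entry_weight_def)
    fix p assume p: "p \<in> T"
    have eq: "denominator v p = chart v n \<Omega> (n + 2) p * (chart v n \<Omega> (n + 2) p - chart v n \<Omega> 1 p ^ (n + 2))
       * (s q q p * (\<Prod>j\<in>?R. chart v n \<Omega> j p))"
      unfolding denominator_def using prod.remove[OF finite_diagonal_I jd, of "\<lambda>j. chart v n \<Omega> j p"] cj p
      by simp
    have "X * (Y * Z) \<noteq> 0 \<Longrightarrow> 1 / (X * (Y * Z)) * X * Z = 1 / Y" for X Y Z :: complex
      by simp
    then show "1 / denominator v p * (chart v n \<Omega> (n + 2) p * (chart v n \<Omega> (n + 2) p - chart v n \<Omega> 1 p ^ (n + 2)))
       * (\<Prod>j\<in>?R. chart v n \<Omega> j p) = 1 / s q q p"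
      using denominator_nonzero[OF p, of v] unfolding eq by blast
  qed
qed

text \<open>The entries that \<open>dependent_entries\<close> takes as given are the coordinate
  positions together with s_11 = 1 and, for even n, u.\<close>

lemma gen_mid_or_position:
  assumes "1 \<le> j" "j \<le> i" "i \<le> n + 1" "i + j < n + 2 \<or> i + j = n + 2 \<and> (odd n \<or> i = j)"
    and "full \<or> (i, j) \<noteq> (2, 1)" "\<not> (special v \<and> (i, j) = (n + 1, 1))"
  shows "WT v full (entry_weight i j) (s i j)"
proof -
  consider "(i, j) = (1, 1)" | "even n" "i + j = n + 2" "i = j" | "(i, j) \<in> set (positions n)"
    using assms(1-4) unfolding set_positions by (cases "odd n"; cases "i = 1") auto
  then show ?thesis
  proof cases
    case 1
    show ?thesis using 1 entry_weight_1
      by (auto intro!: weighted_cong[OF weighted_const[of _ _ 1]] simp: s_11[simplified])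
  next
    case 2
    then have "i = mid" "j = mid" by (auto simp: mid_def)
    then show ?thesis using gen_u[OF 2(1)] by simp
  next
    case 3
    then show ?thesis using gen_s assms(5,6) by blast
  qed
qed

lemma s_21_weighted: "WT v True 2 (s 2 1)"
proof -
  have "WT v True (entry_weight 2 1) (s 2 1)"
    by (rule gen_s) (use position_in[OF n_pos basic_indices(3)[OF n_pos]] basic_indices(4)[OF n_pos]
      in \<open>auto simp: special_def\<close>)
  moreover have "entry_weight 2 1 = 2"
    using n_pos by (auto simp: entry_weight_def col_weight_def row_weight_def)
  ultimately show ?thesis by simp
qed

lemma s_weighted:
  assumes "1 \<le> j" "j \<le> i" "i \<le> n + 1"
  shows "WT v True (entry_weight i j) (s i j)"
proof -
  have ind: "WT v True (entry_weight i j) (s i j)"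
    if ij: "1 \<le> j" "j \<le> i" "i \<le> n + 1" "i + j < n + 2 \<or> i + j = n + 2 \<and> (odd n \<or> i = j)" for i j
  \<comment> \<open>In the modified chart s_{n+1,1} is recovered as \<open>corner\<close> minus t_2
    s_{n,1}, both of weight \<open>entry_weight (n + 1) 1\<close>.\<close>
  proof (cases "special v \<and> (i, j) = (n + 1, 1)")
    case True
    then have n: "odd n" "n \<ge> 3" by (auto simp: special_def)
    have "(n, 1) \<in> set (positions n)" using n by (simp add: set_positions)
    then have "WT v True (entry_weight n 1) (s n 1)" by (rule gen_s) auto
    moreover have "2 + entry_weight n 1 = entry_weight (n + 1) 1"
      using n by (auto simp: entry_weight_def row_weight_def)
    ultimately have "WT v True (entry_weight (n + 1) 1) (\<lambda>p. s 2 1 p * s n 1 p)"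
      using weighted_mult[OF s_21_weighted] by metis
    from weighted_diff[OF gen_corner this] True show ?thesis
      by (auto simp: corner_def)
  next
    case False
    then show ?thesis using gen_mid_or_position ij by blast
  qed
  have "WT v True (col_weight n * int (i - (i - j)) + row_weight n i) (s i (i - (i - j)))"
    by (rule dependent_entries[where E = n])
      (use assms s_upper s_pairing generators_base ind[unfolded entry_weight_def]
        inverse_small_diagonal[unfolded entry_weight_def] in auto)
  then show ?thesis using assms by (simp add: entry_weight_def)
qed

text \<open>Both charts generate the same graded algebra, and it contains the modular forms of
  either option. Weights may therefore be computed in whichever chart is convenient, and every
  homogeneous function lies in \<open>O_T\<close>, where vector fields act.\<close>

lemma generators_full_subset: "Gen v full \<subseteq> homogeneous T (Gen v' True)"
proof
  fix x assume "x \<in> Gen v full"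
  then consider j where "j \<in> idx full" "x = (weight n j, chart v n \<Omega> j)"
    | "even n" "x = (weight_u n, u_fun n \<Omega>)"
    | "x = (- denominator_weight, on_set T (\<lambda>p. 1 / denominator v p))"
    unfolding generators_eq by (auto split: if_splits)
  then show "x \<in> homogeneous T (Gen v' True)"
  proof cases
    case 1
    then have j: "j \<in> index_I n" by (auto simp: idx_def split: if_splits)
    consider "j = 1" | "j = n + 2" | "j \<in> index_I n - {1, n + 2}" using j by blast
    then have "WT v' True (weight n j) (chart v n \<Omega> j)"
    proof cases
      case 1
      then show ?thesis using gen_ta[of v' True] by (simp only: weighted_def chart_basic weight_basic[OF n_pos] on_set_idem)
    next
      case 2
      then show ?thesis using gen_tb[of v' True] by (simp only: weighted_def chart_basic weight_basic[OF n_pos] on_set_idem)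
    next
      case 3
      obtain i k where pos: "position n j = (i, k)" by (cases "position n j")
      have ik: "(i, k) \<in> set (positions n)" using position_in[OF n_pos 3] pos by simp
      then have ik': "1 \<le> k" "k \<le> i" "i \<le> n + 1" unfolding set_positions by auto
      have w: "weight n j = entry_weight i k" using weight_position[OF n_pos 3 pos] by (simp add: entry_weight_def)
      show ?thesis
      proof (cases "special v \<and> (i, k) = (n + 1, 1)")
        case True
        then have n: "odd n" "n \<ge> 3" by (auto simp: special_def)
        have "j = dwork_d n"
          using position_inj[OF n_pos 3 last_indices(1)[OF n]] last_indices(2)[OF n] pos True by simp
        then have "chart v n \<Omega> j = on_set T corner" using chart_special True by simp
        moreover have "2 + entry_weight n 1 = entry_weight (n + 1) 1"
          using n by (auto simp: entry_weight_def row_weight_def)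
        then have "WT v' True (entry_weight (n + 1) 1) corner"
          unfolding corner_def
          using weighted_add[OF s_weighted[of 1 "n + 1" v'] weighted_cong[OF weighted_mult[OF s_21_weighted s_weighted[of 1 n v']]]]
          using n by auto
        ultimately show ?thesis using w True by (simp add: weighted_def)
      next
        case False
        then show ?thesis using chart_position[OF 3 pos] s_weighted[OF ik', of v'] w by (simp add: weighted_def)
      qed
    qed
    then show ?thesis using 1 chart_vanishing by (simp add: weighted_def vanishing_outside_def)
  next
    case 2
    then have "x \<in> Gen v' True" by (simp add: generators_eq)
    then show ?thesis by (metis homogeneous.gen prod.collapse)
  next
    case 3
    have "denominator v p = denominator v' p" for p
    proof -
      have "chart v n \<Omega> j = chart v' n \<Omega> j" if "j \<in> diagonal_I n" for j
        using diagonal_index[OF that, of v True] diagonal_index[OF that, of v' True] by (metis prod.inject)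
      then show ?thesis unfolding denominator_def chart_basic by simp
    qed
    then have "x \<in> Gen v' True" using 3 by (simp add: generators_eq)
    then show ?thesis by (metis homogeneous.gen prod.collapse)
  qed
qed

subsection \<open>Vector fields\<close>


abbreviation OT :: "(point \<Rightarrow> complex) set" where "OT \<equiv> O_T n \<Omega>"

lemma generator_vanishing: "(r, g) \<in> Gen v full \<Longrightarrow> vanishing_outside T g"
  unfolding generators_eq using chart_vanishing by (auto simp: u_fun_eq split: if_splits)

lemma homogeneous_vanishing_T: "(r, f) \<in> homogeneous T (Gen v full) \<Longrightarrow> vanishing_outside T f"
  using homogeneous_vanishing generator_vanishing by blast

lemma O_T_eq: "OT = generated_algebra T (snd ` Gen Option2 True)"
  by (simp add: O_T_def idx_def)

lemma O_T_vanishing: "f \<in> OT \<Longrightarrow> vanishing_outside T f"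
  unfolding O_T_eq using generator_vanishing by (elim generated_vanishing) fastforce

lemma homogeneous_O_T: "(r, f) \<in> homogeneous T (Gen v full) \<Longrightarrow> f \<in> OT"
  unfolding O_T_eq using homogeneous_subst[OF _ generators_full_subset] homogeneous_generated by blast

section \<open>Regular functions and derivations on them\<close>

definition regular :: "(point \<Rightarrow> complex) \<Rightarrow> bool" where
  "regular f \<longleftrightarrow> on_set T f \<in> OT"

lemma weighted_regular: "WT v full r f \<Longrightarrow> regular f"
  unfolding weighted_def regular_def by (rule homogeneous_O_T)

lemma regular_O_T: "f \<in> OT \<Longrightarrow> regular f"
  using O_T_vanishing by (simp add: regular_def vanishing_outside_def)

lemma regular_const: "regular (\<lambda>_. k)"
  using weighted_regular[OF weighted_const] .

lemma regular_add: "regular f \<Longrightarrow> regular g \<Longrightarrow> regular (\<lambda>p. f p + g p)"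
proof -
  assume "regular f" "regular g"
  moreover have "on_set T (\<lambda>p. f p + g p) = (\<lambda>p. on_set T f p + on_set T g p)" by (auto simp: on_set_def)
  ultimately show ?thesis unfolding regular_def O_T_eq by (simp add: generated_algebra.add)
qed

lemma regular_mult: "regular f \<Longrightarrow> regular g \<Longrightarrow> regular (\<lambda>p. f p * g p)"
proof -
  assume "regular f" "regular g"
  moreover have "on_set T (\<lambda>p. f p * g p) = (\<lambda>p. on_set T f p * on_set T g p)" by (auto simp: on_set_def)
  ultimately show ?thesis unfolding regular_def O_T_eq by (simp add: generated_algebra.mult)
qed

lemma regular_cong: "regular f \<Longrightarrow> (\<And>p. p \<in> T \<Longrightarrow> f p = g p) \<Longrightarrow> regular g"
  unfolding regular_def by (metis on_set_eq_iff)

lemma regular_cmult: "regular f \<Longrightarrow> regular (\<lambda>p. k * f p)"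
  using regular_mult[OF regular_const] by blast

lemma regular_power: "regular f \<Longrightarrow> regular (\<lambda>p. f p ^ k)"
  by (induction k) (auto intro: regular_const regular_mult)

text \<open>Vector fields are constrained only on \<open>O_T\<close>, whose elements vanish outside
  \<open>T\<close>. Restricting first allows them to be applied to functions such as
  \<open>ta\<close> that are not zero there.\<close>

definition der :: "vfield \<Rightarrow> (point \<Rightarrow> complex) \<Rightarrow> point \<Rightarrow> complex" where
  "der E f = E (on_set T f)"

lemma der_cong: "(\<And>p. p \<in> T \<Longrightarrow> f p = g p) \<Longrightarrow> der E f = der E g"
  unfolding der_def by (metis on_set_eq_iff)

lemma der_on_set: "der E (on_set T f) = der E f"
  by (simp add: der_def)

context
  fixes E :: vfield
  assumes E: "vector_field n \<Omega> E"
begin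

lemma der_O_T: "regular f \<Longrightarrow> der E f \<in> OT"
  using E unfolding vector_field_def der_def regular_def by blast

lemma der_add:
  assumes "regular f" "regular g"
  shows "der E (\<lambda>p. f p + g p) = (\<lambda>p. der E f p + der E g p)"
proof -
  have "on_set T (\<lambda>p. f p + g p) = (\<lambda>p. on_set T f p + on_set T g p)" by (auto simp: on_set_def)
  moreover have "E (\<lambda>p. on_set T f p + on_set T g p) = (\<lambda>p. E (on_set T f) p + E (on_set T g) p)"
    using E assms unfolding vector_field_def regular_def by blast
  ultimately show ?thesis by (simp add: der_def)
qed

lemma der_mult:
  assumes "regular f" "regular g" "p \<in> T"
  shows "der E (\<lambda>p. f p * g p) p = der E f p * g p + f p * der E g p"
proof -
  have "on_set T (\<lambda>p. f p * g p) = (\<lambda>p. on_set T f p * on_set T g p)" by (auto simp: on_set_def)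
  moreover have "E (\<lambda>p. on_set T f p * on_set T g p) =
      (\<lambda>p. E (on_set T f) p * on_set T g p + on_set T f p * E (on_set T g) p)"
    using E assms(1,2) unfolding vector_field_def regular_def by blast
  ultimately show ?thesis using assms(3) by (simp add: der_def)
qed

lemma der_cmult:
  assumes "regular f"
  shows "der E (\<lambda>p. k * f p) = (\<lambda>p. k * der E f p)"
proof -
  have "on_set T (\<lambda>p. k * f p) = (\<lambda>p. k * on_set T f p)" by (auto simp: on_set_def)
  moreover have "E (\<lambda>p. k * on_set T f p) = (\<lambda>p. k * E (on_set T f) p)"
    using E assms unfolding vector_field_def regular_def by blast
  ultimately show ?thesis by (simp add: der_def)
qed

lemma der_const:
  assumes "p \<in> T"
  shows "der E (\<lambda>_. k) p = 0"
proof -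
  have "der E (\<lambda>_. 1) p = 0"
    using der_mult[OF regular_const regular_const assms, of 1 1] by simp
  then show ?thesis
    using fun_cong[OF der_cmult[OF regular_const, of k 1], of p] by simp
qed

lemma der_diff:
  assumes "regular f" "regular g" "p \<in> T"
  shows "der E (\<lambda>p. f p - g p) p = der E f p - der E g p"
proof -
  have "der E (\<lambda>p. f p + (-1) * g p) p = der E f p + (-1) * der E g p"
    by (simp only: der_add[OF assms(1) regular_cmult[OF assms(2)]] der_cmult[OF assms(2)])
  then show ?thesis by simp
qed

lemma der_power:
  assumes "regular f" "p \<in> T"
  shows "der E (\<lambda>p. f p ^ Suc k) p = of_nat (Suc k) * f p ^ k * der E f p"
proof (induction k)
  case 0
  then show ?case by simp
next
  case (Suc k)
  have "der E (\<lambda>p. f p ^ Suc (Suc k)) p = der E (\<lambda>p. f p * f p ^ Suc k) p" by simp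
  also have "\<dots> = der E f p * f p ^ Suc k + f p * der E (\<lambda>p. f p ^ Suc k) p"
    by (rule der_mult[OF assms(1) regular_power[OF assms(1)] assms(2)])
  finally show ?case unfolding Suc by (simp add: algebra_simps)
qed

lemma der_inverse:
  assumes "regular f" "regular g" "\<And>p. p \<in> T \<Longrightarrow> f p * g p = 1" "p \<in> T"
  shows "der E g p = - (g p * g p * der E f p)"
proof -
  have "der E (\<lambda>p. f p * g p) = der E (\<lambda>_. 1)" by (rule der_cong) (rule assms(3))
  then have "der E f p * g p + f p * der E g p = 0"
    using der_mult[OF assms(1,2,4)] der_const[OF assms(4), of 1] by simp
  then have *: "f p * der E g p = - (der E f p * g p)"
    by (simp add: eq_neg_iff_add_eq_0 add.commute)
  have "der E g p = (f p * g p) * der E g p" using assms(3)[OF assms(4)] by simp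
  also have "\<dots> = g p * (f p * der E g p)" by (simp only: ac_simps)
  finally show ?thesis unfolding * by (simp only: mult_minus_right ac_simps)
qed

end

section \<open>Combinations and commutators of vector fields\<close>

lemma vector_field_combination:
  assumes E: "vector_field n \<Omega> E" "vector_field n \<Omega> E'" and g: "regular g" "regular g'"
    and F: "\<And>f. f \<in> OT \<Longrightarrow> F f = (\<lambda>p. g p * E f p + g' p * E' f p)"
  shows "vector_field n \<Omega> F"
proof -
  have in_OT: "E f \<in> OT" "E' f \<in> OT" if "f \<in> OT" for f
    using E that unfolding vector_field_def by blast+
  have F_in: "F f \<in> OT" if "f \<in> OT" for f
  proof -
    have "regular (\<lambda>p. g p * E f p + g' p * E' f p)"
      by (intro regular_add regular_mult g regular_O_T in_OT that)
    moreover have "on_set T (\<lambda>p. g p * E f p + g' p * E' f p) = F f"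
      unfolding F[OF that] using in_OT[OF that, THEN O_T_vanishing, THEN vanishing_outsideD]
      by (auto simp: on_set_def fun_eq_iff)
    ultimately show ?thesis by (simp add: regular_def)
  qed
  have closed: "(\<lambda>p. f p + h p) \<in> OT" "(\<lambda>p. a * f p) \<in> OT" "(\<lambda>p. f p * h p) \<in> OT"
    if "f \<in> OT" "h \<in> OT" for f h a
  proof -
    show "(\<lambda>p. f p + h p) \<in> OT" "(\<lambda>p. f p * h p) \<in> OT"
      using that unfolding O_T_eq by (auto intro: generated_algebra.intros)
    have "on_set T (\<lambda>p. a * f p) = (\<lambda>p. a * f p)"
      using O_T_vanishing[OF that(1), THEN vanishing_outsideD] by (auto simp: on_set_def)
    then show "(\<lambda>p. a * f p) \<in> OT"
      using regular_cmult[OF regular_O_T[OF that(1)], of a] by (simp add: regular_def)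
  qed
  have lin: "E (\<lambda>p. f p + h p) = (\<lambda>p. E f p + E h p)" "E' (\<lambda>p. f p + h p) = (\<lambda>p. E' f p + E' h p)"
    "E (\<lambda>p. a * f p) = (\<lambda>p. a * E f p)" "E' (\<lambda>p. a * f p) = (\<lambda>p. a * E' f p)"
    "E (\<lambda>p. f p * h p) = (\<lambda>p. E f p * h p + f p * E h p)"
    "E' (\<lambda>p. f p * h p) = (\<lambda>p. E' f p * h p + f p * E' h p)"
    if "f \<in> OT" "h \<in> OT" for f h a
    using E that unfolding vector_field_def by blast+
  show ?thesis
    unfolding vector_field_def
    by (intro conjI ballI allI F_in)
      (simp_all add: F closed lin fun_eq_iff algebra_simps)
qed

lemma vector_field_commutator:
  assumes E: "vector_field n \<Omega> E" "vector_field n \<Omega> E'"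
  shows "vector_field n \<Omega> (commutator E E')"
proof -
  have in_OT: "E f \<in> OT" "E' f \<in> OT" if "f \<in> OT" for f
    using E that unfolding vector_field_def by blast+
  have lin: "E (\<lambda>p. f p + h p) = (\<lambda>p. E f p + E h p)" "E' (\<lambda>p. f p + h p) = (\<lambda>p. E' f p + E' h p)"
    "E (\<lambda>p. a * f p) = (\<lambda>p. a * E f p)" "E' (\<lambda>p. a * f p) = (\<lambda>p. a * E' f p)"
    "E (\<lambda>p. f p * h p) = (\<lambda>p. E f p * h p + f p * E h p)"
    "E' (\<lambda>p. f p * h p) = (\<lambda>p. E' f p * h p + f p * E' h p)"
    if "f \<in> OT" "h \<in> OT" for f h a
    using E that unfolding vector_field_def by blast+
  have mult: "(\<lambda>p. f p * h p) \<in> OT" if "f \<in> OT" "h \<in> OT" for f h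
    using that unfolding O_T_eq by (rule generated_algebra.mult)
  have comm_in: "commutator E E' f \<in> OT" if "f \<in> OT" for f
  proof -
    have "regular (\<lambda>p. E (E' f) p + (-1) * E' (E f) p)"
      by (intro regular_add regular_cmult regular_O_T in_OT that)
    moreover have "on_set T (\<lambda>p. E (E' f) p + (-1) * E' (E f) p) = commutator E E' f"
      unfolding commutator_def
      using in_OT(1)[OF in_OT(2)[OF that], THEN O_T_vanishing, THEN vanishing_outsideD]
        in_OT(2)[OF in_OT(1)[OF that], THEN O_T_vanishing, THEN vanishing_outsideD]
      by (auto simp: on_set_def fun_eq_iff)
    ultimately show ?thesis by (simp add: regular_def)
  qed
  show ?thesis
    unfolding vector_field_def
    by (intro conjI ballI allI comm_in)
      (simp_all add: commutator_def lin in_OT mult fun_eq_iff algebra_simps)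
qed

text \<open>Trades the explicit inverse generator for a closure property: \<open>Q\<close> passes
  from \<open>f\<close> to its reciprocal. A property stable under sums, products and reciprocals
  then has to be checked only on the constants, the coordinates and u.\<close>

lemma WT_induct [consumes 1, case_names cong const zero chart mid add mult inverse]:
  assumes "WT v full r f"
    and cong: "\<And>r f g. Q r f \<Longrightarrow> (\<And>p. p \<in> T \<Longrightarrow> f p = g p) \<Longrightarrow> Q r g"
    and const: "\<And>k. Q 0 (\<lambda>_. k)"
    and zero: "\<And>r. Q r (\<lambda>_. 0)"
    and chart: "\<And>j. j \<in> idx full \<Longrightarrow> Q (weight n j) (chart v n \<Omega> j)"
    and mid: "even n \<Longrightarrow> Q (entry_weight mid mid) (s mid mid)"
    and add: "\<And>r f g. Q r f \<Longrightarrow> Q r g \<Longrightarrow> Q r (\<lambda>p. f p + g p)"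
    and mult: "\<And>r s f g. Q r f \<Longrightarrow> Q s g \<Longrightarrow> Q (r + s) (\<lambda>p. f p * g p)"
    and inverse: "\<And>r f g. Q r f \<Longrightarrow> WT v full (- r) g \<Longrightarrow> (\<And>p. p \<in> T \<Longrightarrow> f p * g p = 1) \<Longrightarrow> Q (- r) g"
  shows "Q r f"
proof -
  have prod: "Q (\<Sum>j\<in>A. weight n j) (\<lambda>p. \<Prod>j\<in>A. chart v n \<Omega> j p)" if "finite A" "A \<subseteq> idx full" for A
    using that
  proof (induction A rule: finite_induct)
    case empty
    then show ?case using const[of 1] by simp
  next
    case (insert j A)
    then show ?case using mult[OF chart[of j] insert(3)] by simp
  qed
  have power: "Q (int k * weight n 1) (\<lambda>p. chart v n \<Omega> 1 p ^ k)" for k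
  proof (induction k)
    case 0
    then show ?case using const[of 1] by simp
  next
    case (Suc k)
    show ?case using mult[OF chart[OF idx_basic(1)] Suc] by (simp add: algebra_simps)
  qed
  have w: "int (n + 2) * weight n 1 = weight n (n + 2)"
    using weight_basic[OF n_pos] by (simp only: mult.commute)
  have "Q (weight n (n + 2)) (\<lambda>p. chart v n \<Omega> (n + 2) p + (-1) * chart v n \<Omega> 1 p ^ (n + 2))"
    using add[OF chart[OF idx_basic(2)]] mult[OF const[of "-1"] power[of "n + 2", unfolded w]]
    by (simp only: add_0_left)
  from mult[OF mult[OF chart[OF idx_basic(2)] this] prod[OF finite_diagonal_I diagonal_subset]]
  have "Q denominator_weight (\<lambda>p. chart v n \<Omega> (n + 2) p *
      (chart v n \<Omega> (n + 2) p + (-1) * chart v n \<Omega> 1 p ^ (n + 2)) * (\<Prod>j\<in>diagonal_I n. chart v n \<Omega> j p))"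
    unfolding denominator_weight_def by (simp only: mult_2)
  then have "Q denominator_weight (denominator v)"
    by (rule cong) (simp add: denominator_def)
  from inverse[OF this gen_inverse] have "Q (- denominator_weight) (\<lambda>p. 1 / denominator v p)"
    using denominator_nonzero by simp
  then have inv: "Q (- denominator_weight) (on_set T (\<lambda>p. 1 / denominator v p))"
    by (rule cong) simp
  have "(r, on_set T f) \<in> homogeneous T (Gen v full)"
    using assms(1) by (simp add: weighted_def)
  then have "Q r (on_set T f)"
  proof (induction rule: homogeneous.induct)
    case (const k)
    show ?case by (rule cong[OF \<open>\<And>k. Q 0 (\<lambda>_. k)\<close>]) simp
  next
    case (gen r g)
    then consider j where "j \<in> idx full" "r = weight n j" "g = chart v n \<Omega> j"
      | "even n" "r = weight_u n" "g = u_fun n \<Omega>"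
      | "r = - denominator_weight" "g = on_set T (\<lambda>p. 1 / denominator v p)"
      unfolding generators_eq by (auto split: if_splits)
    then show ?case
    proof cases
      case 2
      have "Q (entry_weight mid mid) (on_set T (s mid mid))"
        by (rule cong[OF mid[OF 2(1)]]) simp
      then show ?thesis
        using 2 weight_u_eq[OF n_pos 2(1)] by (simp add: u_fun_eq entry_weight_def mid_def)
    qed (use chart inv in auto)
  qed (auto intro: zero add mult)
  then show ?thesis by (rule cong) simp
qed

text \<open>Weights add under multiplication, so E f + \<kappa> r \<tau> f again obeys the product
  rule on homogeneous functions, and the reciprocal g of f gets -g^2 times the value at f. With
  \<kappa> = 0 this tests the degree of \<open>E\<close>; with \<tau> = t_2 it gives the
  Ramanujan-Serre derivation.\<close>

lemma twisted_derivation: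
  assumes E: "vector_field n \<Omega> E"
    and chart: "\<And>j. j \<in> idx full \<Longrightarrow> WT v full (weight n j + \<delta>)
      (\<lambda>p. der E (chart v n \<Omega> j) p + \<kappa> * of_int (weight n j) * \<tau> p * chart v n \<Omega> j p)"
    and mid: "even n \<Longrightarrow> WT v full (entry_weight mid mid + \<delta>)
      (\<lambda>p. der E (s mid mid) p + \<kappa> * of_int (entry_weight mid mid) * \<tau> p * s mid mid p)"
    and f: "WT v full r f"
  shows "WT v full (r + \<delta>) (\<lambda>p. der E f p + \<kappa> * of_int r * \<tau> p * f p)"
proof -
  define tw where "tw = (\<lambda>r f p. der E f p + \<kappa> * complex_of_int r * \<tau> p * f p)"
  have "WT v full r f \<and> WT v full (r + \<delta>) (tw r f)"
    using f
  proof (induction rule: WT_induct)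
    case (cong r f g)
    have "der E f = der E g" using cong(2) by (rule der_cong)
    then show ?case
      using cong by (auto intro: weighted_cong[OF _ refl] simp: tw_def)
  next
    case (const k)
    show ?case
      by (auto intro!: weighted_const weighted_cong[OF weighted_zero] simp: tw_def der_const[OF E])
  next
    case (zero r)
    show ?case
      by (auto intro!: weighted_zero weighted_cong[OF weighted_zero] simp: tw_def der_const[OF E])
  next
    case (chart j)
    then show ?case using weighted_chart assms(2) by (simp add: tw_def)
  next
    case mid
    then show ?case using gen_u assms(3) by (simp add: tw_def)
  next
    case (add r f g)
    then have reg: "regular f" "regular g" using weighted_regular by blast+
    have "WT v full (r + \<delta>) (\<lambda>p. tw r f p + tw r g p)" using add by (intro weighted_add) auto
    then have "WT v full (r + \<delta>) (tw r (\<lambda>p. f p + g p))"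
      by (rule weighted_cong) (simp_all add: tw_def der_add[OF E reg] algebra_simps)
    then show ?case using add by (auto intro: weighted_add)
  next
    case (mult r s f g)
    then have reg: "regular f" "regular g" using weighted_regular by blast+
    have "WT v full (r + s + \<delta>) (\<lambda>p. tw r f p * g p + f p * tw s g p)"
    proof (rule weighted_add)
      show "WT v full (r + s + \<delta>) (\<lambda>p. tw r f p * g p)"
        by (rule weighted_cong[OF weighted_mult[of _ _ "r + \<delta>" _ s]]) (use mult in auto)
      show "WT v full (r + s + \<delta>) (\<lambda>p. f p * tw s g p)"
        by (rule weighted_cong[OF weighted_mult[of _ _ r _ "s + \<delta>"]]) (use mult in auto)
    qed
    then have "WT v full (r + s + \<delta>) (tw (r + s) (\<lambda>p. f p * g p))"
      by (rule weighted_cong) (simp_all add: tw_def der_mult[OF E reg] algebra_simps)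
    then show ?case using mult by (auto intro: weighted_mult)
  next
    case (inverse r f g)
    then have reg: "regular f" "regular g" using weighted_regular by blast+
    have "WT v full (- r + - r + (r + \<delta>)) (\<lambda>p. - (g p * g p * tw r f p))"
      using inverse by (intro weighted_minus weighted_mult) auto
    then have "WT v full (- r + \<delta>) (tw (- r) g)"
    proof (rule weighted_cong)
      fix p assume p: "p \<in> T"
      have "g p * g p * (\<kappa> * of_int r * \<tau> p * f p) = \<kappa> * of_int r * \<tau> p * g p * (f p * g p)"
        by (simp add: algebra_simps)
      then show "- (g p * g p * tw r f p) = tw (- r) g p"
        unfolding tw_def using inverse(3)[OF p] der_inverse[OF E reg inverse(3) p]
        by (simp add: algebra_simps)
    qed simp
    then show ?case using inverse by auto
  qed
  then show ?thesis by (simp add: tw_def)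
qed

text \<open>Used with \<mu> = 1 for H, which is the Euler field of the weights, and with \<mu> = 0
  for the derivative by t_2 on functions that do not involve t_2.\<close>

lemma eigenfunction:
  assumes E: "vector_field n \<Omega> E"
    and chart: "\<And>j p. j \<in> idx full \<Longrightarrow> p \<in> T \<Longrightarrow>
      der E (chart v n \<Omega> j) p = \<mu> * of_int (weight n j) * chart v n \<Omega> j p"
    and mid: "\<And>p. even n \<Longrightarrow> p \<in> T \<Longrightarrow>
      der E (s mid mid) p = \<mu> * of_int (entry_weight mid mid) * s mid mid p"
    and f: "WT v full r f" and p: "p \<in> T"
  shows "der E f p = \<mu> * of_int r * f p"
proof -
  have "regular f \<and> (\<forall>p\<in>T. der E f p = \<mu> * of_int r * f p)"
    using f
  proof (induction rule: WT_induct)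
    case (cong r f g)
    then show ?case using der_cong[of f g E] regular_cong[of f g] by auto
  next
    case (chart j)
    then show ?case using weighted_regular[OF weighted_chart] assms(2) by blast
  next
    case mid
    then show ?case using weighted_regular[OF gen_u] assms(3) by blast
  next
    case (add r f g)
    then show ?case by (simp add: regular_add der_add[OF E] algebra_simps)
  next
    case (mult r s f g)
    then show ?case by (simp add: regular_mult der_mult[OF E] algebra_simps)
  next
    case (inverse r f g)
    then have g: "regular g" using weighted_regular by blast
    have "der E g p = \<mu> * of_int (- r) * g p" if p: "p \<in> T" for p
    proof -
      have "g p * g p * (\<mu> * of_int r * f p) = \<mu> * of_int r * g p * (f p * g p)"
        by (simp add: algebra_simps)
      then show ?thesis
        using der_inverse[OF E _ g inverse(3) p] inverse(1) inverse(3)[OF p] p by simp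
    qed
    with g show ?case by blast
  qed (simp_all add: regular_const der_const[OF E])
  then show ?thesis using p by blast
qed

subsection \<open>Derivatives of the entries of \<open>S\<close>\<close>


text \<open>Outside its last diagonal entry, B evaluated on \<open>E\<close> depends on
  \<open>E\<close> through two functions only: \<open>eta\<close>, the coefficient on the diagonal,
  and \<open>theta\<close>, the value of the 1-form common to the superdiagonal and the last
  row.\<close>

definition eta :: "vfield \<Rightarrow> point \<Rightarrow> complex" where
  "eta E p = der E tb p / (of_nat (n + 2) * tb p)"

definition theta :: "vfield \<Rightarrow> point \<Rightarrow> complex" where
  "theta E p = der E ta p - ta p * eta E p"

definition s_prev :: "nat \<Rightarrow> nat \<Rightarrow> point \<Rightarrow> complex" where
  "s_prev i j p = (if 2 \<le> j then s i (j - 1) p else 0)"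

definition B_entry :: "vfield \<Rightarrow> point \<Rightarrow> nat \<Rightarrow> nat \<Rightarrow> complex" where
  "B_entry E p k j = entry (GM_B n (ta p) (tb p) (der E ta p) (der E tb p)) k j"

lemma der_tb: "p \<in> T \<Longrightarrow> der E tb p = of_nat (n + 2) * tb p * eta E p"
  using T_disc(2)[of p] by (simp add: eta_def del: of_nat_add of_nat_Suc)

lemma der_ta: "der E ta p = theta E p + ta p * eta E p"
  by (simp add: theta_def)

lemma B_entry_upper:
  assumes "k \<in> {1..n}" "j \<in> {1..n + 1}"
  shows "B_entry E p k j =
    (if j = k then - (of_nat k * eta E p) else if j = k + 1 then theta E p else 0)"
  unfolding B_entry_def theta_def eta_def by (rule entry_GM_B_upper[OF assms])

lemma B_entry_last:
  assumes "j \<in> {1..n}"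
  shows "B_entry E p (n + 1) j =
    - (of_nat (Stirling (n + 2) j) * ta p ^ j * (1 / (ta p ^ (n + 2) - tb p))) * theta E p"
  unfolding B_entry_def theta_def eta_def by (rule entry_GM_B_last[OF assms])

text \<open>The sum leaves out the last row of B. The assumption \<open>last\<close> takes care of
  column n + 1, whose diagonal term belongs to that row.\<close>

lemma sum_B_upper:
  assumes "j \<in> {1..n + 1}" and last: "j = n + 1 \<longrightarrow> s i j p = 0"
  shows "(\<Sum>k = 1..n. s i k p * B_entry E p k j) =
    - (of_nat j * eta E p) * s i j p + theta E p * s_prev i j p"
proof -
  have "s i k p * B_entry E p k j = (if k = j then - (of_nat j * eta E p) * s i j p else 0)
      + (if k = j - 1 then theta E p * s_prev i j p else 0)" if "k \<in> {1..n}" for k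
    using that assms(1) unfolding B_entry_upper[OF that assms(1)] by (auto simp: s_prev_def)
  then have "(\<Sum>k = 1..n. s i k p * B_entry E p k j) =
      (\<Sum>k = 1..n. if k = j then - (of_nat j * eta E p) * s i j p else 0)
      + (\<Sum>k = 1..n. if k = j - 1 then theta E p * s_prev i j p else 0)"
    by (simp add: sum.distrib)
  moreover have "(\<Sum>k = 1..n. if k = j then - (of_nat j * eta E p) * s i j p else 0) =
      - (of_nat j * eta E p) * s i j p"
    using assms by (cases "j = n + 1") (simp_all add: sum.delta)
  moreover have "(\<Sum>k = 1..n. if k = j - 1 then theta E p * s_prev i j p else 0) =
      theta E p * s_prev i j p"
    using assms by (auto simp: sum.delta s_prev_def)
  ultimately show ?thesis by simp
qed

context
  fixes E :: vfield and A :: "point \<Rightarrow> complex mat" and p :: point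
  assumes gm: "gauss_manin_matrix n \<Omega> E A" and p: "p \<in> T"
begin

lemma der_s:
  assumes "i \<in> {1..n + 1}" "j \<in> {1..n + 1}"
  shows "der E (s i j) p =
    (\<Sum>k = 1..n + 1. entry (A p) i k * s k j p) - (\<Sum>k = 1..n + 1. s i k p * B_entry E p k j)"
proof -
  obtain a b S where pe: "p = (a, b, S)" by (cases p)
  let ?B = "GM_B n a b (der E ta p) (der E tb p)"
  have A: "A p \<in> carrier_mat (n + 1) (n + 1)"
    and eq: "mat1 (n + 1) (\<lambda>i j. E (s_fun n \<Omega> i j) p) =
      A p * S - S * GM_B n a b (E (t_fun n \<Omega> 1) p) (E (t_fun n \<Omega> (n + 2)) p)"
    using gm p unfolding gauss_manin_matrix_def pe by auto
  have S: "S \<in> carrier_mat (n + 1) (n + 1)" using T_S(1)[OF p] by (simp add: pe)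
  have "der E (s i j) p = entry (mat1 (n + 1) (\<lambda>i j. E (s_fun n \<Omega> i j) p)) i j"
    using assms by (simp add: der_def s_fun_eq)
  also have "\<dots> = entry (A p * S - S * ?B) i j"
    unfolding eq t_fun_1 t_fun_disc der_def ..
  also have "\<dots> = entry (A p * S) i j - entry (S * ?B) i j"
    by (rule entry_minus[OF mult_carrier_mat[OF A S] mult_carrier_mat[OF S GM_B_carrier] assms])
  also have "\<dots> = (\<Sum>k = 1..n + 1. entry (A p) i k * entry S k j) - (\<Sum>k = 1..n + 1. entry S i k * entry ?B k j)"
    by (simp only: entry_mult[OF A S assms] entry_mult[OF S GM_B_carrier assms])
  finally show ?thesis by (simp only: s_def B_entry_def ta_def tb_def pe fst_conv snd_conv)
qed

lemma der_s_upper: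
  assumes "i \<in> {1..n}" "j \<in> {1..n + 1}"
  shows "der E (s i j) p = (\<Sum>k = 1..n + 1. entry (A p) i k * s k j p)
    + of_nat j * eta E p * s i j p - theta E p * s_prev i j p"
proof -
  have "s i (n + 1) p = 0" using s_upper[OF p, of i "n + 1"] assms by simp
  then have "(\<Sum>k = 1..n + 1. s i k p * B_entry E p k j) =
      - (of_nat j * eta E p) * s i j p + theta E p * s_prev i j p"
    using sum_B_upper[OF assms(2), of i p E] by simp
  with der_s[of i j] assms show ?thesis by simp
qed

text \<open>The Stirling terms come from the last row of B. Column n + 1 is excluded because B has
  an entry of another shape there; s_{n+1,n+1} is never a coordinate.\<close>

lemma der_s_last:
  assumes "j \<in> {1..n}"
  shows "der E (s (n + 1) j) p = (\<Sum>k = 1..n + 1. entry (A p) (n + 1) k * s k j p)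
    + of_nat j * eta E p * s (n + 1) j p - theta E p * s_prev (n + 1) j p
    + of_nat (Stirling (n + 2) j) * ta p ^ j * (s (n + 1) (n + 1) p * (1 / (ta p ^ (n + 2) - tb p))) * theta E p"
proof -
  have "(\<Sum>k = 1..n + 1. s (n + 1) k p * B_entry E p k j) =
      (\<Sum>k = 1..n. s (n + 1) k p * B_entry E p k j) + s (n + 1) (n + 1) p * B_entry E p (n + 1) j"
    by simp
  also have "(\<Sum>k = 1..n. s (n + 1) k p * B_entry E p k j) =
      - (of_nat j * eta E p) * s (n + 1) j p + theta E p * s_prev (n + 1) j p"
    by (rule sum_B_upper) (use assms in auto)
  finally have eq: "(\<Sum>k = 1..n + 1. s (n + 1) k p * B_entry E p k j) =
      - (of_nat j * eta E p) * s (n + 1) j p + theta E p * s_prev (n + 1) j p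
      + s (n + 1) (n + 1) p * B_entry E p (n + 1) j" .
  have "j \<in> {1..n + 1}" "n + 1 \<in> {1..n + 1}" using assms by auto
  note der = der_s[OF this(2,1)]
  have alg: "X - (- (u * h) * a + b + z * (- (K * t * w) * th)) =
    X + u * h * a - b + K * t * (z * w) * th" for X u h a b z K t w th :: complex
    by (simp add: algebra_simps)
  show ?thesis using der unfolding eq B_entry_last[OF assms] alg .
qed

end

lemma der_s_11: "vector_field n \<Omega> E \<Longrightarrow> p \<in> T \<Longrightarrow> der E (s 1 1) p = 0"
  using der_cong[of "s 1 1" "\<lambda>_. 1" E] s_11 der_const[of E p 1] by simp

lemma der_s_upper_zero:
  assumes "vector_field n \<Omega> E" "p \<in> T" "1 \<le> i" "i < j" "j \<le> n + 1"
  shows "der E (s i j) p = 0"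
proof -
  have "der E (s i j) = der E (\<lambda>_. 0)" using assms(3-5) by (intro der_cong s_upper)
  then show ?thesis using der_const[OF assms(1,2)] by simp
qed

definition superdiagonal :: "(nat \<Rightarrow> point \<Rightarrow> complex) \<Rightarrow> nat \<Rightarrow> point \<Rightarrow> complex" where
  "superdiagonal Y i p = (if i = 1 then 1 else if i = n then -1 else Y (i - 1) p)"

lemma sum_Y_matrix:
  assumes "i \<in> {1..n + 1}" "j \<in> {1..n + 1}"
  shows "(\<Sum>k = 1..n + 1. entry (Y_matrix n Y p) i k * s k j p) =
    (if i \<le> n then superdiagonal Y i p * s (i + 1) j p else 0)"
proof -
  have "(\<Sum>k = 1..n + 1. entry (Y_matrix n Y p) i k * s k j p) =
      (\<Sum>k = 1..n + 1. if k = i + 1 then superdiagonal Y i p * s (i + 1) j p else 0)"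
    using assms by (intro sum.cong refl) (auto simp: Y_matrix_def superdiagonal_def)
  then show ?thesis using assms by (auto simp: sum.delta)
qed

text \<open>The constant entries of S turn the Gauss-Manin equation into equations for the unknowns:
  entry (1, 1) gives \<open>eta\<close>, entry (1, 2) gives \<open>theta\<close>, and the zero at
  (i, i + 1) gives the superdiagonal of Y.\<close>

lemma modular_derivatives:
  assumes "modular_vector_field n \<Omega> R"
  obtains y where
    "\<And>p. y 1 p = 1" "\<And>p. n \<ge> 2 \<Longrightarrow> y n p = -1"
    "\<And>p i. p \<in> T \<Longrightarrow> i \<in> {1..n} \<Longrightarrow> y i p * s (i + 1) (i + 1) p = s i i p * s 2 2 p"
    "\<And>p. p \<in> T \<Longrightarrow> der R ta p = s 2 2 p - ta p * s 2 1 p"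
    "\<And>p. p \<in> T \<Longrightarrow> der R tb p = - of_nat (n + 2) * tb p * s 2 1 p"
    "\<And>p i j. p \<in> T \<Longrightarrow> i \<in> {1..n} \<Longrightarrow> j \<in> {1..n + 1} \<Longrightarrow>
      der R (s i j) p = y i p * s (i + 1) j p - s 2 2 p * s_prev i j p - of_nat j * s 2 1 p * s i j p"
    "\<And>p j. p \<in> T \<Longrightarrow> j \<in> {1..n} \<Longrightarrow>
      der R (s (n + 1) j) p = of_nat (Stirling (n + 2) j) * ta p ^ j *
        (s (n + 1) (n + 1) p * (1 / (ta p ^ (n + 2) - tb p))) * s 2 2 p
        - s 2 2 p * s_prev (n + 1) j p - of_nat j * s 2 1 p * s (n + 1) j p"
proof -
  obtain Y where R: "vector_field n \<Omega> R" and Y: "gauss_manin_matrix n \<Omega> R (Y_matrix n Y)"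
    using assms unfolding modular_vector_field_def by blast
  define y where "y = superdiagonal Y"
  have upper: "der R (s i j) p = y i p * s (i + 1) j p + of_nat j * eta R p * s i j p - theta R p * s_prev i j p"
    if "p \<in> T" "i \<in> {1..n}" "j \<in> {1..n + 1}" for p i j
    using der_s_upper[OF Y that] sum_Y_matrix[of i j Y p] that by (simp add: y_def)
  have y1: "y 1 p = 1" for p by (simp add: y_def superdiagonal_def)
  have eta: "eta R p = - s 2 1 p" if p: "p \<in> T" for p
  proof -
    have "0 = s 2 1 p + eta R p"
      using upper[OF p, of 1 1] der_s_11[OF R p] n_pos y1[of p] s_11[OF p]
      by (simp add: s_prev_def numeral_2_eq_2)
    then show ?thesis by (simp add: eq_neg_iff_add_eq_0 add.commute)
  qed
  have theta: "theta R p = s 2 2 p" if p: "p \<in> T" for p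
    using upper[OF p, of 1 2] der_s_upper_zero[OF R p, of 1 2] s_upper[OF p, of 1 2] n_pos y1[of p] s_11[OF p]
    by (simp add: s_prev_def numeral_2_eq_2)
  show ?thesis
  proof (rule that[of y])
    show "y 1 p = 1" for p by (rule y1)
    show "y n p = -1" if "n \<ge> 2" for p using that by (simp add: y_def superdiagonal_def)
    show "y i p * s (i + 1) (i + 1) p = s i i p * s 2 2 p" if p: "p \<in> T" and i: "i \<in> {1..n}" for p i
      using upper[OF p i, of "i + 1"] der_s_upper_zero[OF R p, of i "i + 1"] s_upper[OF p, of i "i + 1"] i
        theta[OF p] by (simp add: s_prev_def)
    show "der R ta p = s 2 2 p - ta p * s 2 1 p" if "p \<in> T" for p
      using eta[OF that] theta[OF that] by (simp add: der_ta)
    show "der R tb p = - of_nat (n + 2) * tb p * s 2 1 p" if "p \<in> T" for p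
      unfolding der_tb[OF that] eta[OF that] by (simp only: mult_minus_left mult_minus_right ac_simps)
    show "der R (s i j) p = y i p * s (i + 1) j p - s 2 2 p * s_prev i j p - of_nat j * s 2 1 p * s i j p"
      if "p \<in> T" "i \<in> {1..n}" "j \<in> {1..n + 1}" for p i j
      unfolding upper[OF that] eta[OF that(1)] theta[OF that(1)] by (simp add: algebra_simps)
    show "der R (s (n + 1) j) p = of_nat (Stirling (n + 2) j) * ta p ^ j *
        (s (n + 1) (n + 1) p * (1 / (ta p ^ (n + 2) - tb p))) * s 2 2 p
        - s 2 2 p * s_prev (n + 1) j p - of_nat j * s 2 1 p * s (n + 1) j p"
      if "p \<in> T" "j \<in> {1..n}" for p j
    proof -
      have "(\<Sum>k = 1..n + 1. entry (Y_matrix n Y p) (n + 1) k * s k j p) = 0"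
        using sum_Y_matrix[of "n + 1" j Y p] that by simp
      then show ?thesis
        unfolding der_s_last[OF Y that] eta[OF that(1)] theta[OF that(1)] by (simp only: algebra_simps) simp
    qed
  qed
qed

text \<open>As for R, entries (1, 1) and (1, 2) determine \<open>eta\<close> and
  \<open>theta\<close>. Here \<open>theta\<close> vanishes, and with it the terms mixing columns and
  the Stirling terms, so each entry is an eigenfunction.\<close>

lemma diagonal_derivatives:
  assumes E: "lie_vector_field n \<Omega> \<gg> E" and carrier: "\<gg> \<in> carrier_mat (n + 1) (n + 1)"
    and diag: "\<And>i j. i \<in> {1..n + 1} \<Longrightarrow> j \<in> {1..n + 1} \<Longrightarrow> entry \<gg> i j = (if i = j then \<alpha> i else 0)"
    and p: "p \<in> T"
  shows "der E ta p = - \<alpha> 1 * ta p" "der E tb p = - of_nat (n + 2) * \<alpha> 1 * tb p"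
    "i \<in> {1..n + 1} \<Longrightarrow> j \<in> {1..n + 1} \<Longrightarrow> i \<le> n \<or> j \<le> n \<Longrightarrow>
      der E (s i j) p = (\<alpha> i - of_nat j * \<alpha> 1) * s i j p"
proof -
  have vf: "vector_field n \<Omega> E" and gm: "gauss_manin_matrix n \<Omega> E (\<lambda>_. transpose_mat \<gg>)"
    using E by (auto simp: lie_vector_field_def)
  have sum: "(\<Sum>k = 1..n + 1. entry (transpose_mat \<gg>) i k * s k j p) = \<alpha> i * s i j p"
    if "i \<in> {1..n + 1}" for i j
  proof -
    have "(\<Sum>k = 1..n + 1. entry (transpose_mat \<gg>) i k * s k j p) =
        (\<Sum>k = 1..n + 1. if k = i then \<alpha> i * s i j p else 0)"
      using that by (intro sum.cong refl) (auto simp: entry_transpose[OF carrier] diag)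
    then show ?thesis using that by (auto simp: sum.delta)
  qed
  have upper: "der E (s i j) p = \<alpha> i * s i j p + of_nat j * eta E p * s i j p - theta E p * s_prev i j p"
    if "i \<in> {1..n}" "j \<in> {1..n + 1}" for i j
    using der_s_upper[OF gm p that] sum[of i j] that by simp
  have eta: "eta E p = - \<alpha> 1"
  proof -
    have "0 = \<alpha> 1 + eta E p"
      using upper[of 1 1] der_s_11[OF vf p] n_pos s_11[OF p] by (simp add: s_prev_def)
    then show ?thesis by (simp add: eq_neg_iff_add_eq_0 add.commute)
  qed
  have theta: "theta E p = 0"
    using upper[of 1 2] der_s_upper_zero[OF vf p, of 1 2] s_upper[OF p, of 1 2] n_pos s_11[OF p]
    by (simp add: s_prev_def)
  show "der E ta p = - \<alpha> 1 * ta p" by (simp add: der_ta eta theta)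
  show "der E tb p = - of_nat (n + 2) * \<alpha> 1 * tb p" 
    unfolding der_tb[OF p] eta by (simp only: mult_minus_left mult_minus_right ac_simps)
  show "der E (s i j) p = (\<alpha> i - of_nat j * \<alpha> 1) * s i j p"
    if ij: "i \<in> {1..n + 1}" "j \<in> {1..n + 1}" "i \<le> n \<or> j \<le> n"
  proof (cases "i \<le> n")
    case True
    then show ?thesis using upper[of i j] ij by (simp add: eta theta algebra_simps)
  next
    case False
    then have i: "i = n + 1" "j \<in> {1..n}" using ij by auto
    show ?thesis
      using der_s_last[OF gm p i(2)] sum[of "n + 1" j] unfolding i(1) eta theta
      by (simp add: algebra_simps)
  qed
qed

lemma entry_matrix_unit:
  "i \<in> {1..n + 1} \<Longrightarrow> j \<in> {1..n + 1} \<Longrightarrow>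
    entry (matrix_unit n k l) i j = (if i = k \<and> j = l then 1 else 0)"
  by (simp add: matrix_unit_def)

lemma matrix_unit_carrier: "matrix_unit n k l \<in> carrier_mat (n + 1) (n + 1)"
  unfolding matrix_unit_def by (rule mat1_carrier)

lemma entry_unit_diff:
  assumes "i \<in> {1..n + 1}" "j \<in> {1..n + 1}"
  shows "entry (matrix_unit n k k - matrix_unit n l l) i j =
    (if i = j then of_bool (i = k) - of_bool (i = l) else 0)"
  using assms
  by (simp add: entry_minus[OF matrix_unit_carrier matrix_unit_carrier] entry_matrix_unit del: One_nat_def)

lemma H_derivatives:
  assumes "H_vector_field n \<Omega> H"
  shows "vector_field n \<Omega> H"
    "p \<in> T \<Longrightarrow> der H ta p = of_int (col_weight n) * ta p"
    "p \<in> T \<Longrightarrow> der H tb p = of_int (col_weight n * int (n + 2)) * tb p"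
    "p \<in> T \<Longrightarrow> i \<in> {1..n + 1} \<Longrightarrow> j \<in> {1..n + 1} \<Longrightarrow> i \<le> n \<or> j \<le> n \<Longrightarrow>
      der H (s i j) p = of_int (entry_weight i j) * s i j p"
proof -
  define \<alpha> \<beta> :: "nat \<Rightarrow> complex" where
    "\<alpha> = (\<lambda>i. of_bool (i = 1) - of_bool (i = n + 1))" and
    "\<beta> = (\<lambda>i. of_bool (i = 2) - of_bool (i = n))"
  \<comment> \<open>All cases are brought to the form H = k E + l F; for n \<le> 2, where g_22 does
    not enter, E is repeated with coefficient 0.\<close>
  obtain E F :: vfield and k l :: int where E: "lie_vector_field n \<Omega> (g11 n) E" and
    F: "lie_vector_field n \<Omega> (if n \<ge> 3 then g22 n else g11 n) F" and
    H: "\<And>f. f \<in> OT \<Longrightarrow> H f = (\<lambda>p. of_int k * E f p + of_int l * F f p)" and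
    kl: "k = - col_weight n" "l = (if n \<ge> 3 then 1 else 0)"
  proof -
    consider "n = 1" | "n = 2" | "n \<ge> 3" using n_pos by linarith
    then show ?thesis
    proof cases
      case 1
      then obtain E where "lie_vector_field n \<Omega> (g11 n) E" "\<forall>f\<in>OT. H f = (\<lambda>p. - E f p)"
        using assms unfolding H_vector_field_def by auto
      with 1 show ?thesis by (intro that[of E E "-1" 0]) (auto simp: col_weight_def)
    next
      case 2
      then obtain E where "lie_vector_field n \<Omega> (g11 n) E" "\<forall>f\<in>OT. H f = (\<lambda>p. - 2 * E f p)"
        using assms unfolding H_vector_field_def by auto
      with 2 show ?thesis by (intro that[of E E "-2" 0]) (auto simp: col_weight_def)
    next
      case 3
      then obtain E F where "lie_vector_field n \<Omega> (g11 n) E" "lie_vector_field n \<Omega> (g22 n) F"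
        "\<forall>f\<in>OT. H f = (\<lambda>p. F f p - E f p)"
        using assms unfolding H_vector_field_def by auto
      with 3 show ?thesis by (intro that[of E F "-1" 1]) (auto simp: col_weight_def)
    qed
  qed
  define \<gamma> where "\<gamma> = (if n \<ge> 3 then \<beta> else \<alpha>)"
  have c11: "g11 n \<in> carrier_mat (n + 1) (n + 1)" and c22: "g22 n \<in> carrier_mat (n + 1) (n + 1)"
    unfolding g11_def g22_def by (intro minus_carrier_mat matrix_unit_carrier)+
  have e11: "entry (g11 n) i j = (if i = j then \<alpha> i else 0)"
    if "i \<in> {1..n + 1}" "j \<in> {1..n + 1}" for i j
    unfolding g11_def \<alpha>_def by (rule entry_unit_diff[OF that])
  have e22: "entry (if n \<ge> 3 then g22 n else g11 n) i j = (if i = j then \<gamma> i else 0)"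
    if "i \<in> {1..n + 1}" "j \<in> {1..n + 1}" for i j
  proof (cases "n \<ge> 3")
    case True
    show ?thesis
      unfolding \<gamma>_def if_P[OF True] g22_def \<beta>_def by (rule entry_unit_diff[OF that])
  next
    case False
    show ?thesis unfolding \<gamma>_def if_not_P[OF False] by (rule e11[OF that])
  qed
  have c: "(if n \<ge> 3 then g22 n else g11 n) \<in> carrier_mat (n + 1) (n + 1)"
    using c11 c22 by simp
  have vf: "vector_field n \<Omega> E" "vector_field n \<Omega> F"
    using E F by (auto simp: lie_vector_field_def)
  show "vector_field n \<Omega> H"
    by (rule vector_field_combination[OF vf regular_const regular_const H])
  have derH: "der H f p = of_int k * der E f p + of_int l * der F f p" if "regular f" for f p
    using H that by (simp add: der_def regular_def)
  have \<alpha>1: "\<alpha> 1 = 1" using n_pos by (simp add: \<alpha>_def)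
  \<comment> \<open>For n \<ge> 3 the first diagonal entry of g_22 is 0, so the second summand
    contributes to the row weights but not to the column weights.\<close>
  have l\<gamma>: "l = 0 \<or> \<gamma> 1 = 0" using kl by (simp add: \<gamma>_def \<beta>_def)
  have dE: "der E ta p = - \<alpha> 1 * ta p" "der E tb p = - of_nat (n + 2) * \<alpha> 1 * tb p"
    "i \<in> {1..n + 1} \<Longrightarrow> j \<in> {1..n + 1} \<Longrightarrow> i \<le> n \<or> j \<le> n \<Longrightarrow>
      der E (s i j) p = (\<alpha> i - of_nat j * \<alpha> 1) * s i j p" if "p \<in> T" for p i j
    using diagonal_derivatives[OF E c11 _ that] e11 by blast+
  have dF: "der F ta p = - \<gamma> 1 * ta p" "der F tb p = - of_nat (n + 2) * \<gamma> 1 * tb p"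
    "i \<in> {1..n + 1} \<Longrightarrow> j \<in> {1..n + 1} \<Longrightarrow> i \<le> n \<or> j \<le> n \<Longrightarrow>
      der F (s i j) p = (\<gamma> i - of_nat j * \<gamma> 1) * s i j p" if "p \<in> T" for p i j
    using diagonal_derivatives[OF F c _ that] e22 by blast+
  have reg: "regular ta" "regular tb" using weighted_regular gen_ta gen_tb by blast+
  show "der H ta p = of_int (col_weight n) * ta p" if p: "p \<in> T"
    unfolding derH[OF reg(1)] dE(1)[OF p] dF(1)[OF p] \<alpha>1 kl(1) using l\<gamma> by (elim disjE) simp_all
  show "der H tb p = of_int (col_weight n * int (n + 2)) * tb p" if p: "p \<in> T"
    unfolding derH[OF reg(2)] dE(2)[OF p] dF(2)[OF p] \<alpha>1 kl(1)
    using l\<gamma> by (elim disjE) (simp_all add: algebra_simps)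
  show "der H (s i j) p = of_int (entry_weight i j) * s i j p"
    if p: "p \<in> T" and ij: "i \<in> {1..n + 1}" "j \<in> {1..n + 1}" "i \<le> n \<or> j \<le> n"
  proof -
    have "regular (s i j)"
    proof (cases "j \<le> i")
      case True
      then show ?thesis using weighted_regular[OF s_weighted] ij by simp
    next
      case False
      then show ?thesis by (intro regular_cong[OF regular_const[of 0]]) (use s_upper ij in auto)
    qed
    then have "der H (s i j) p =
        (of_int k * (\<alpha> i - of_nat j * \<alpha> 1) + of_int l * (\<gamma> i - of_nat j * \<gamma> 1)) * s i j p"
      unfolding derH[OF \<open>regular (s i j)\<close>] dE(3)[OF p ij] dF(3)[OF p ij] by (simp add: algebra_simps)
    moreover have "of_int k * (\<alpha> i - of_nat j * \<alpha> 1) + of_int l * (\<gamma> i - of_nat j * \<gamma> 1) =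
        of_int (entry_weight i j)"
    proof -
      have "of_int l * (\<gamma> i - of_nat j * \<gamma> 1) = of_int l * \<gamma> i" using l\<gamma> by auto
      moreover have "of_int k * \<alpha> i + of_int l * \<gamma> i = complex_of_int (row_weight n i)"
        using kl n_pos ij(1)
        by (auto simp: col_weight_def row_weight_def \<alpha>_def \<beta>_def \<gamma>_def)
      ultimately show ?thesis
        unfolding \<alpha>1 kl(1) by (simp add: entry_weight_def algebra_simps)
    qed
    ultimately show ?thesis by simp
  qed
qed

subsection \<open>Weights of the derivatives\<close>


lemma entry_weight_21: "entry_weight 2 1 = 2"
  using n_pos by (auto simp: entry_weight_def col_weight_def row_weight_def)

lemma entry_weight_22: "entry_weight 2 2 = col_weight n + 2"
  using n_pos by (auto simp: entry_weight_def col_weight_def row_weight_def)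

lemma weighted_variant: "WT v full r f \<Longrightarrow> WT v' True r f"
  using weighted_subst generators_full_subset by blast

lemma position_2: "chart v n \<Omega> 2 = on_set T (s 2 1)"
  by (rule chart_position[OF basic_indices(3,4)[OF n_pos]]) (auto simp: special_def)

text \<open>The bound \<open>E = 0\<close> confines \<open>dependent_entries\<close> to the
  diagonal, where t_2 does not occur, so the result holds in both algebras.\<close>

lemma diagonal_weighted:
  assumes "q \<in> {1..n + 1}"
  shows "WT v full (entry_weight q q) (s q q)" "WT v full (- entry_weight q q) (\<lambda>p. 1 / s q q p)"
proof -
  have ind: "WT v full (col_weight n * int j + row_weight n i) (s i j)"
    if "1 \<le> j" "j \<le> i" "i \<le> n + 1" "i - j \<le> 0" "i + j < n + 2 \<or> i + j = n + 2 \<and> (odd n \<or> i = j)" for i j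
    unfolding entry_weight_def[symmetric]
    by (rule gen_mid_or_position) (use that n_pos in auto)
  have inv: "WT v full (- (col_weight n * int q + row_weight n q)) (\<lambda>p. 1 / s q q p)"
    if "1 \<le> q" "2 * q < n + 2" for q
    using inverse_small_diagonal[OF that] by (simp only: entry_weight_def)
  have "WT v full (col_weight n * int (q - 0) + row_weight n q) (s q (q - 0))"
    by (rule dependent_entries[where E = 0])
      (use assms s_upper s_pairing generators_base ind inv in auto)
  then show "WT v full (entry_weight q q) (s q q)" by (simp add: entry_weight_def)
  show "WT v full (- entry_weight q q) (\<lambda>p. 1 / s q q p)"
    unfolding entry_weight_def
    by (rule inverse_diagonal[where E = 0])
      (use assms s_upper s_pairing generators_base ind inv in auto)
qed

lemma mid_range: "even n \<Longrightarrow> mid \<in> {1..n + 1} \<and> mid + mid = n + 2"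
  by (auto simp: mid_def)

lemma row_weight_mid: "even n \<Longrightarrow> row_weight n mid = 0"
  using row_weight_reflect[OF n_pos, of mid] mid_range by (auto simp: mid_def)

text \<open>The quadratic relation for u, from entry (\<open>mid\<close>, \<open>mid\<close>) of the
  equation for S. Differentiating it determines the action of a vector field on u.\<close>

lemma s_mid_square:
  assumes "even n" "p \<in> T"
  shows "s mid mid p * s mid mid p = 1 / Om_const mid * (ta p ^ (n + 2) - tb p)"
proof -
  have "s mid mid p * Om mid mid p * s mid mid p = phi n mid mid"
    by (rule diagonal_product(1)[where \<sigma> = s]) (use assms mid_range s_upper s_pairing in auto)
  also have "phi n mid mid = 1" using assms(1) mid_range by (simp add: phi_def)
  also have "Om mid mid p = Om_const mid / (ta p ^ (n + 2) - tb p)"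
    using mid_range[OF assms(1)] by (intro Om_antidiagonal assms(2)) auto
  finally show ?thesis
    using T_disc(3)[OF assms(2)] Om_const_nonzero[of mid] by (simp add: field_simps)
qed

lemma der_mid:
  assumes E: "vector_field n \<Omega> E" and "even n" and p: "p \<in> T"
  shows "2 * s mid mid p * der E (s mid mid) p =
    1 / Om_const mid * (of_nat (n + 2) * ta p ^ (n + 1) * der E ta p - der E tb p)"
proof -
  have reg: "regular (s mid mid)" "regular ta" "regular tb"
    using weighted_regular gen_u[OF assms(2)] gen_ta gen_tb by blast+
  have reg': "regular (\<lambda>p. ta p ^ Suc (n + 1) - tb p)"
    using regular_add[OF regular_power[OF reg(2), of "Suc (n + 1)"] regular_cmult[OF reg(3), of "-1"]]
    by simp
  have "der E (\<lambda>p. s mid mid p * s mid mid p) =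
      der E (\<lambda>p. 1 / Om_const mid * (ta p ^ Suc (n + 1) - tb p))"
    by (rule der_cong) (use s_mid_square[OF assms(2)] in simp)
  then have "der E (\<lambda>p. s mid mid p * s mid mid p) p =
      1 / Om_const mid * der E (\<lambda>p. ta p ^ Suc (n + 1) - tb p) p"
    by (simp only: der_cmult[OF E reg'])
  also have "der E (\<lambda>p. ta p ^ Suc (n + 1) - tb p) p =
      of_nat (Suc (n + 1)) * ta p ^ (n + 1) * der E ta p - der E tb p"
    unfolding der_diff[OF E regular_power[OF reg(2)] reg(3) p] der_power[OF E reg(2) p] ..
  finally show ?thesis
    unfolding der_mult[OF E reg(1) reg(1) p] by (simp add: mult.assoc)
qed

section \<open>Degrees of H, of R and of the derivative by t_2\<close>

lemma H_eigen:
  assumes H: "H_vector_field n \<Omega> H" and "WT v full r f" "p \<in> T"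
  shows "der H f p = of_int r * f p"
proof -
  note dH = H_derivatives[OF H]
  have "der H f p = 1 * of_int r * f p"
  proof (rule eigenfunction[OF dH(1) _ _ weighted_variant[OF assms(2)] assms(3)])
    fix p assume p: "p \<in> T"
    show "der H (s mid mid) p = 1 * of_int (entry_weight mid mid) * s mid mid p" if "even n"
      using dH(4)[OF p, of mid mid] mid_range[OF that] n_pos by simp
    fix j assume "j \<in> idx True"
    then consider "j = 1" | "j = n + 2" | "j \<in> index_I n - {1, n + 2}" by (auto simp: idx_def)
    then show "der H (chart Option2 n \<Omega> j) p = 1 * of_int (weight n j) * chart Option2 n \<Omega> j p"
    proof cases
      case 1
      show ?thesis unfolding 1 chart_basic der_on_set weight_basic[OF n_pos]
        using dH(2)[OF p] p by simp
    next
      case 2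
      show ?thesis unfolding 2 chart_basic der_on_set weight_basic[OF n_pos] dH(3)[OF p]
        using p by simp
    next
      case 3
      obtain i k where pos: "position n j = (i, k)" by (cases "position n j")
      have "(i, k) \<in> set (positions n)" using position_in[OF n_pos 3] pos by simp
      then have ik: "i \<in> {1..n + 1}" "k \<in> {1..n + 1}" "i \<le> n \<or> k \<le> n"
        unfolding set_positions by (auto split: if_splits)
      have c: "chart Option2 n \<Omega> j = on_set T (s i k)"
        by (rule chart_position[OF 3 pos]) (simp add: special_def)
      show ?thesis
        unfolding c der_on_set dH(4)[OF p ik] weight_position[OF n_pos 3 pos]
        using p by (simp add: entry_weight_def)
    qed
  qed
  then show ?thesis by simp
qed

lemma modular_weighted:
  assumes R: "modular_vector_field n \<Omega> R" and f: "WT v full r f"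
  shows "WT v' True (r + 2) (der R f)"
proof -
  have vf: "vector_field n \<Omega> R" using R by (auto simp: modular_vector_field_def)
  obtain y where "\<And>p. y 1 p = 1" and "\<And>p. n \<ge> 2 \<Longrightarrow> y n p = -1"
    and y: "\<And>p i. p \<in> T \<Longrightarrow> i \<in> {1..n} \<Longrightarrow> y i p * s (i + 1) (i + 1) p = s i i p * s 2 2 p"
    and da: "\<And>p. p \<in> T \<Longrightarrow> der R ta p = s 2 2 p - ta p * s 2 1 p"
    and db: "\<And>p. p \<in> T \<Longrightarrow> der R tb p = - of_nat (n + 2) * tb p * s 2 1 p"
    and upper: "\<And>p i j. p \<in> T \<Longrightarrow> i \<in> {1..n} \<Longrightarrow> j \<in> {1..n + 1} \<Longrightarrow>
      der R (s i j) p = y i p * s (i + 1) j p - s 2 2 p * s_prev i j p - of_nat j * s 2 1 p * s i j p"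
    and last: "\<And>p j. p \<in> T \<Longrightarrow> j \<in> {1..n} \<Longrightarrow>
      der R (s (n + 1) j) p = of_nat (Stirling (n + 2) j) * ta p ^ j *
        (s (n + 1) (n + 1) p * (1 / (ta p ^ (n + 2) - tb p))) * s 2 2 p
        - s 2 2 p * s_prev (n + 1) j p - of_nat j * s 2 1 p * s (n + 1) j p"
    by (rule modular_derivatives[OF R]) (rule that)
  note s22 = diagonal_weighted(1)[of 2, unfolded entry_weight_22]
  have 2: "2 \<in> {1..n + 1}" using n_pos by auto
  have prev: "WT Option2 True (entry_weight i j - col_weight n) (s_prev i j)"
    if "1 \<le> j" "j \<le> i" "i \<le> n + 1" for i j
  proof (cases "2 \<le> j")
    case True
    then have "s_prev i j = s i (j - 1)" "entry_weight i (j - 1) = entry_weight i j - col_weight n"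
      by (auto simp: s_prev_def entry_weight_def algebra_simps of_nat_diff)
    then show ?thesis using s_weighted[of "j - 1" i Option2] that True by simp
  next
    case False
    then show ?thesis by (intro weighted_cong[OF weighted_zero refl]) (simp add: s_prev_def)
  qed
  have tail: "WT Option2 True (entry_weight i j + 2)
      (\<lambda>p. s 2 2 p * s_prev i j p + of_nat j * (s 2 1 p * s i j p))"
    if ij: "1 \<le> j" "j \<le> i" "i \<le> n + 1" for i j
  proof (rule weighted_add)
    show "WT Option2 True (entry_weight i j + 2) (\<lambda>p. s 2 2 p * s_prev i j p)"
      by (rule weighted_cong[OF weighted_mult[OF s22[OF 2] prev[OF ij]]]) simp_all
    show "WT Option2 True (entry_weight i j + 2) (\<lambda>p. of_nat j * (s 2 1 p * s i j p))"
      by (rule weighted_cong[OF weighted_cmult[OF weighted_mult[OF s_21_weighted s_weighted[OF ij]], where k = "of_nat j"]]) simp_all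
  qed
  have entry: "WT Option2 True (entry_weight i j + 2) (der R (s i j))"
    if ij: "1 \<le> j" "j \<le> i" "i \<le> n + 1" "i \<le> n \<or> j \<le> n" for i j
  proof (cases "i \<le> n")
    case True
    then have i: "i \<in> {1..n}" "i \<in> {1..n + 1}" "i + 1 \<in> {1..n + 1}" "j \<in> {1..n + 1}" using ij by auto
    have "WT Option2 True (entry_weight i i + (col_weight n + 2) + - entry_weight (i + 1) (i + 1) + entry_weight (i + 1) j)
        (\<lambda>p. s i i p * s 2 2 p * (1 / s (i + 1) (i + 1) p) * s (i + 1) j p)"
      by (intro weighted_mult diagonal_weighted i s22 2 s_weighted) (use ij i in auto)
    then have "WT Option2 True (entry_weight i j + 2)
        (\<lambda>p. s i i p * s 2 2 p * (1 / s (i + 1) (i + 1) p) * s (i + 1) j p)"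
      by (rule weighted_cong) (simp_all add: entry_weight_def algebra_simps)
    from weighted_diff[OF this tail[OF ij(1-3)]] show ?thesis
    proof (rule weighted_cong)
      fix p assume p: "p \<in> T"
      have "y i p = s i i p * s 2 2 p * (1 / s (i + 1) (i + 1) p)"
        using y[OF p i(1)] s_diagonal_nonzero[OF p i(3)] by (simp add: field_simps)
      then show "s i i p * s 2 2 p * (1 / s (i + 1) (i + 1) p) * s (i + 1) j p -
          (s 2 2 p * s_prev i j p + of_nat j * (s 2 1 p * s i j p)) = der R (s i j) p"
        unfolding upper[OF p i(1,4)] by (simp add: algebra_simps)
    qed simp
  next
    case False
    then have i: "i = n + 1" "j \<in> {1..n}" using ij by auto
    have "WT Option2 True (int j * col_weight n + (entry_weight (n + 1) (n + 1) + - (col_weight n * int (n + 2)))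
          + (col_weight n + 2))
        (\<lambda>p. of_nat (Stirling (n + 2) j) * (ta p ^ j * (s (n + 1) (n + 1) p * (1 / (ta p ^ (n + 2) - tb p))) * s 2 2 p))"
      by (intro weighted_cmult weighted_mult weighted_power gen_ta diagonal_weighted s22 2)
        (use generators_base in \<open>auto simp: base_def\<close>)
    then have "WT Option2 True (entry_weight (n + 1) j + 2)
        (\<lambda>p. of_nat (Stirling (n + 2) j) * (ta p ^ j * (s (n + 1) (n + 1) p * (1 / (ta p ^ (n + 2) - tb p))) * s 2 2 p))"
      by (rule weighted_cong) (simp_all add: entry_weight_def algebra_simps)
    from weighted_diff[OF this tail[of j "n + 1"]] show ?thesis
      unfolding i(1)
    proof (rule weighted_cong)
      fix p assume p: "p \<in> T"
      show "of_nat (Stirling (n + 2) j) * (ta p ^ j * (s (n + 1) (n + 1) p * (1 / (ta p ^ (n + 2) - tb p))) * s 2 2 p)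
          - (s 2 2 p * s_prev (n + 1) j p + of_nat j * (s 2 1 p * s (n + 1) j p)) = der R (s (n + 1) j) p"
        unfolding last[OF p i(2)] by (simp only: algebra_simps)
    qed (use i in auto)
  qed
  \<comment> \<open>With \<kappa> = 0 there is no twist. The test is made in the original chart, and
    \<open>weighted_variant\<close> transfers the result to the other one.\<close>
  have "WT Option2 True (r + 2) (\<lambda>p. der R f p + 0 * of_int r * 0 * f p)"
  proof (rule twisted_derivation[OF vf _ _ weighted_variant[OF f]])
    show "WT Option2 True (entry_weight mid mid + 2)
        (\<lambda>p. der R (s mid mid) p + 0 * of_int (entry_weight mid mid) * 0 * s mid mid p)" if "even n"
      using entry[of mid mid] mid_range[OF that] n_pos by simp
    fix j assume "j \<in> idx True"
    then consider "j = 1" | "j = n + 2" | "j \<in> index_I n - {1, n + 2}" by (auto simp: idx_def)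
    then have "WT Option2 True (weight n j + 2) (der R (chart Option2 n \<Omega> j))"
    proof cases
      case 1
      have "WT Option2 True (col_weight n + 2) (\<lambda>p. s 2 2 p - ta p * s 2 1 p)"
        by (intro weighted_diff weighted_mult gen_ta s_21_weighted s22 2)
      then show ?thesis unfolding 1 chart_basic der_on_set weight_basic[OF n_pos]
        by (rule weighted_cong) (simp_all add: da)
    next
      case 2
      have "WT Option2 True (col_weight n * int (n + 2) + 2) (\<lambda>p. - of_nat (n + 2) * (tb p * s 2 1 p))"
        by (intro weighted_cmult weighted_mult gen_tb s_21_weighted)
      then show ?thesis unfolding 2 chart_basic der_on_set weight_basic[OF n_pos]
        by (rule weighted_cong) (simp_all only: db mult.assoc)
    next
      case 3
      obtain i k where pos: "position n j = (i, k)" by (cases "position n j")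
      have "(i, k) \<in> set (positions n)" using position_in[OF n_pos 3] pos by simp
      then have ik: "1 \<le> k" "k \<le> i" "i \<le> n + 1" "i \<le> n \<or> k \<le> n"
        unfolding set_positions by (auto split: if_splits)
      have c: "chart Option2 n \<Omega> j = on_set T (s i k)"
        by (rule chart_position[OF 3 pos]) (simp add: special_def)
      show ?thesis
        unfolding c der_on_set weight_position[OF n_pos 3 pos]
        using entry[OF ik] by (simp add: entry_weight_def)
    qed
    then show "WT Option2 True (weight n j + 2)
        (\<lambda>p. der R (chart Option2 n \<Omega> j) p + 0 * of_int (weight n j) * 0 * chart Option2 n \<Omega> j p)"
      by simp
  qed
  then show ?thesis using weighted_variant by simp
qed

lemma partial_chart:
  assumes P: "partial_vector_field n \<Omega> 2 P" and "j \<in> index_I n" "p \<in> T"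
  shows "der P (chart Option2 n \<Omega> j) p = (if j = 2 then 1 else 0)"
proof -
  have "chart Option2 n \<Omega> j = t_fun n \<Omega> j" by (rule chart_not_special) (simp add: special_def)
  moreover have "on_set T (chart Option2 n \<Omega> j) = chart Option2 n \<Omega> j"
    using chart_vanishing by (simp add: vanishing_outside_def)
  ultimately show ?thesis
    using assms unfolding partial_vector_field_def der_def by simp
qed

text \<open>u^2 is a function of t_1 and t_{n+2}, both killed by \<open>P\<close>, and u has no
  zeros.\<close>

lemma partial_mid:
  assumes P: "partial_vector_field n \<Omega> 2 P" and "even n" and p: "p \<in> T"
  shows "der P (s mid mid) p = 0"
proof -
  have vf: "vector_field n \<Omega> P" using P by (simp add: partial_vector_field_def)
  have "der P ta p = 0" "der P tb p = 0"
    using partial_chart[OF P basic_indices(1)[OF n_pos] p] partial_chart[OF P basic_indices(2)[OF n_pos] p]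
      n_pos unfolding chart_basic der_on_set by simp_all
  then have "2 * s mid mid p * der P (s mid mid) p = 0"
    using der_mid[OF vf assms(2) p] by simp
  moreover have "s mid mid p \<noteq> 0" using s_diagonal_nonzero[OF p] mid_range[OF assms(2)] by simp
  ultimately show ?thesis by simp
qed

lemma partial_zero:
  assumes P: "partial_vector_field n \<Omega> 2 P" and "WT Option2 False r f" "p \<in> T"
  shows "der P f p = 0"
proof -
  have vf: "vector_field n \<Omega> P" using P by (simp add: partial_vector_field_def)
  have "der P f p = 0 * of_int r * f p"
    by (rule eigenfunction[OF vf _ _ assms(2,3)])
      (auto simp: partial_chart[OF P] partial_mid[OF P] idx_def)
  then show ?thesis by simp
qed

lemma partial_weighted:
  assumes P: "partial_vector_field n \<Omega> 2 P" and f: "WT v full r f"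
  shows "WT v' True (r - 2) (der P f)"
proof -
  have vf: "vector_field n \<Omega> P" using P by (simp add: partial_vector_field_def)
  have "WT Option2 True (r + - 2) (\<lambda>p. der P f p + 0 * of_int r * 0 * f p)"
  proof (rule twisted_derivation[OF vf _ _ weighted_variant[OF f]])
    show "WT Option2 True (entry_weight mid mid + - 2)
        (\<lambda>p. der P (s mid mid) p + 0 * of_int (entry_weight mid mid) * 0 * s mid mid p)" if "even n"
      by (rule weighted_cong[OF weighted_zero refl]) (simp add: partial_mid[OF P that])
    fix j assume j: "j \<in> idx True"
    show "WT Option2 True (weight n j + - 2)
        (\<lambda>p. der P (chart Option2 n \<Omega> j) p + 0 * of_int (weight n j) * 0 * chart Option2 n \<Omega> j p)"
    proof (cases "j = 2")
      case True
      have "weight n 2 = 2"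
        using weight_position[OF n_pos basic_indices(3,4)[OF n_pos]] entry_weight_21
        by (simp add: entry_weight_def)
      then show ?thesis unfolding True
        using partial_chart[OF P, of 2] basic_indices(3)[OF n_pos]
        by (intro weighted_cong[OF weighted_const[of _ _ 1]]) auto
    next
      case False
      then show ?thesis
        by (intro weighted_cong[OF weighted_zero refl]) (use partial_chart[OF P] j in \<open>simp add: idx_def\<close>)
    qed
  qed
  then show ?thesis using weighted_variant by simp
qed

lemma partial_s_21:
  assumes "partial_vector_field n \<Omega> 2 P" "p \<in> T"
  shows "der P (s 2 1) p = 1"
  using partial_chart[OF assms(1) _ assms(2), of 2] basic_indices(3)[OF n_pos]
  unfolding position_2 der_on_set by simp

text \<open>The constant 1 + \<delta> of the commutator is rewritten as \<open>col_weight n\<close>,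
  the form in which it cancels against \<open>serre_factor\<close>.\<close>

lemma D_option2:
  assumes "D_vector_field Option2 n \<Omega> D"
  obtains R P H where "modular_vector_field n \<Omega> R" "partial_vector_field n \<Omega> 2 P"
    "H_vector_field n \<Omega> H" "vector_field n \<Omega> D"
    "\<And>f p. regular f \<Longrightarrow> der D f p = der R f p + on_set T (s 2 1) p *
      (of_int (col_weight n) * (der R (der P f) p - der P (der R f) p) - der H f p)"
proof -
  obtain R P H where R: "modular_vector_field n \<Omega> R" and P: "partial_vector_field n \<Omega> 2 P"
    and H: "H_vector_field n \<Omega> H" and D: "\<And>f. f \<in> OT \<Longrightarrow> D f = (\<lambda>p. R f p + t_fun n \<Omega> 2 p *
      (commutator R (\<lambda>g q. (1 + of_bool (n = 2)) * P g q) f p - H f p))"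
    using assms unfolding D_vector_field_def by auto
  define k where "k = (1 + of_bool (n = 2) :: complex)"
  have k: "k = of_int (col_weight n)" by (simp add: k_def col_weight_def)
  define C where "C = commutator R (\<lambda>g q. k * P g q)"
  have t2: "t_fun n \<Omega> 2 = on_set T (s 2 1)"
    using t_fun_position[OF basic_indices(3,4)[OF n_pos]] .
  have vR: "vector_field n \<Omega> R" and vP: "vector_field n \<Omega> P"
    using R P by (auto simp: modular_vector_field_def partial_vector_field_def)
  have vH: "vector_field n \<Omega> H" by (rule H_derivatives(1)[OF H])
  have vkP: "vector_field n \<Omega> (\<lambda>g q. k * P g q)"
    by (rule vector_field_combination[OF vP vP regular_const[of k] regular_const[of 0]]) simp
  have vC: "vector_field n \<Omega> C" unfolding C_def by (rule vector_field_commutator[OF vR vkP])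
  have vX: "vector_field n \<Omega> (\<lambda>f p. C f p - H f p)"
    by (rule vector_field_combination[OF vC vH regular_const[of 1] regular_const[of "-1"]]) simp
  have reg: "regular (on_set T (s 2 1))"
    using weighted_regular[OF s_21_weighted] by (simp add: regular_def)
  have vD: "vector_field n \<Omega> D"
    by (rule vector_field_combination[OF vR vX regular_const[of 1] reg]) (simp add: D t2 C_def k_def)
  have formula: "der D f p = der R f p + on_set T (s 2 1) p *
      (of_int (col_weight n) * (der R (der P f) p - der P (der R f) p) - der H f p)" if f: "regular f" for f p
  proof -
    have "on_set T f \<in> OT" using f by (simp add: regular_def)
    note Df = D[OF this]
    have Pf: "P (on_set T f) \<in> OT" and Rf: "R (on_set T f) \<in> OT"
      using der_O_T[OF vP f] der_O_T[OF vR f] by (simp_all add: der_def)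
    have "R (\<lambda>q. k * P (on_set T f) q) = (\<lambda>p. k * R (P (on_set T f)) p)"
      using vR Pf unfolding vector_field_def by blast
    moreover have "on_set T (P (on_set T f)) = P (on_set T f)" "on_set T (R (on_set T f)) = R (on_set T f)"
      using O_T_vanishing Pf Rf by (auto simp: vanishing_outside_def)
    ultimately show ?thesis
      unfolding der_def Df commutator_def t2 k_def[symmetric] k[symmetric]
      by (simp add: algebra_simps)
  qed
  show ?thesis using that[OF R P H vD formula] .
qed

lemma D_vector_field_vf: "D_vector_field v n \<Omega> D \<Longrightarrow> vector_field n \<Omega> D"
proof (cases v)
  case Option1
  then show "D_vector_field v n \<Omega> D \<Longrightarrow> ?thesis"
    by (simp add: D_vector_field_def modular_vector_field_def)
next
  case Option2
  assume "D_vector_field v n \<Omega> D"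
  then show ?thesis unfolding Option2 by (elim D_option2)
qed

lemma D_weighted:
  assumes D: "D_vector_field v n \<Omega> D" and f: "WT v' full r f"
  shows "WT v' True (r + 2) (der D f)"
proof (cases v)
  case Option1
  then show ?thesis using D modular_weighted[OF _ f] by (simp add: D_vector_field_def)
next
  case Option2
  obtain R P H where R: "modular_vector_field n \<Omega> R" and P: "partial_vector_field n \<Omega> 2 P"
    and H: "H_vector_field n \<Omega> H" and "vector_field n \<Omega> D" and formula: "\<And>f p. regular f \<Longrightarrow>
      der D f p = der R f p + on_set T (s 2 1) p *
      (of_int (col_weight n) * (der R (der P f) p - der P (der R f) p) - der H f p)"
    by (rule D_option2[OF D[unfolded Option2]]) (rule that)
  \<comment> \<open>R has degree 2 and \<open>P\<close> degree -2, so their commutator has degree 0,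
    like H.\<close>
  have RP: "WT v' True r (der R (der P f))"
    using modular_weighted[OF R partial_weighted[OF P f], of v'] by simp
  have PR: "WT v' True r (der P (der R f))"
    using partial_weighted[OF P modular_weighted[OF R f], of v'] by simp
  have H': "WT v' True r (der H f)"
    by (rule weighted_cong[OF weighted_cmult[OF weighted_variant[OF f], where k = "of_int r"]])
      (simp_all add: H_eigen[OF H f])
  have "WT v' True (r + 2) (\<lambda>p. der R f p + s 2 1 p *
      (of_int (col_weight n) * (der R (der P f) p - der P (der R f) p) - der H f p))"
  proof (rule weighted_add[OF modular_weighted[OF R f]])
    show "WT v' True (r + 2) (\<lambda>p. s 2 1 p *
        (of_int (col_weight n) * (der R (der P f) p - der P (der R f) p) - der H f p))"
      by (rule weighted_cong[OF weighted_mult[OF s_21_weighted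
          weighted_diff[OF weighted_cmult[OF weighted_diff[OF RP PR], where k = "of_int (col_weight n)"] H']]]) simp_all
  qed
  then show ?thesis
    by (rule weighted_cong) (simp_all add: formula[OF weighted_regular[OF f]])
qed

subsection \<open>The Ramanujan-Serre derivation\<close>


text \<open>\<open>sp = exp (- t\<^sub>2 (E\<^sub>2\<^sub>1 - E\<^sub>n\<^sub>+\<^sub>1\<^sub>,\<^sub>n)) S\<close>. The exponential preserves \<open>\<Phi>\<close>, so \<open>sp\<close> satisfies the same
  equation as \<open>S\<close>; but \<open>sp\<^sub>2\<^sub>1 = 0\<close>, so its dependent entries do not involve \<open>t\<^sub>2\<close>. Its corner
  \<open>sp\<^sub>n\<^sub>+\<^sub>1\<^sub>,\<^sub>1\<close> is the coordinate introduced in Option 1.\<close>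

definition shift :: "nat \<Rightarrow> point \<Rightarrow> complex" where
  "shift i p = (if i = 2 then - s 2 1 p else if i = n + 1 then s 2 1 p else 0)"

definition source :: "nat \<Rightarrow> nat" where
  "source i = (if i = 2 then 1 else n)"

definition sp :: "nat \<Rightarrow> nat \<Rightarrow> point \<Rightarrow> complex" where
  "sp i j p = s i j p + shift i p * s (source i) j p"

text \<open>For n \<ge> 3 the matrix E_21 - E_{n+1,n} has square zero, so its exponential is the row
  operation in \<open>sp\<close>. It could change Phi only at (2, n + 1) and (n + 1, 2), where two
  contributions meet; they cancel because 2 \<le> m < n gives the entries of Phi involved equal
  signs.\<close>

lemma phi_shift:
  assumes "n \<ge> 3" "i \<in> {1..n + 1}" "j \<in> {1..n + 1}"
  shows "phi n i j + shift j p * phi n i (source j) + shift i p * phi n (source i) j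
    + shift i p * shift j p * phi n (source i) (source j) = phi n i j"
proof -
  have m: "2 \<le> dwork_m n" "dwork_m n < n" using assms(1) by (auto simp: dwork_m_def)
  consider "i = 2" "j = n + 1" | "i = n + 1" "j = 2" | "i = 2" "j \<noteq> n + 1" | "i = n + 1" "j \<noteq> 2"
    | "i \<noteq> 2" "i \<noteq> n + 1" by blast
  then show ?thesis
  proof cases
    case 1
    then show ?thesis using assms m by (simp add: shift_def source_def phi_def)
  next
    case 2
    then show ?thesis using assms m by (simp add: shift_def source_def phi_def)
  next
    case 3
    then show ?thesis using assms by (simp add: shift_def source_def phi_def)
  next
    case 4
    then show ?thesis using assms by (simp add: shift_def source_def phi_def)
  next
    case 5
    then show ?thesis using assms by (simp add: shift_def source_def phi_def)
  qed
qed

lemma sp_pairing: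
  assumes "n \<ge> 3" "p \<in> T" "i \<in> {1..n + 1}" "j \<in> {1..n + 1}"
  shows "(\<Sum>k = 1..n + 1. \<Sum>l = 1..n + 1. sp i k p * Om k l p * sp j l p) = phi n i j"
proof -
  have src: "source i \<in> {1..n + 1}" for i using assms(1) by (simp add: source_def)
  let ?F = "\<lambda>i j. \<Sum>k = 1..n + 1. \<Sum>l = 1..n + 1. s i k p * Om k l p * s j l p"
  have "(\<Sum>k = 1..n + 1. \<Sum>l = 1..n + 1. sp i k p * Om k l p * sp j l p) =
      ?F i j + shift j p * ?F i (source j) + shift i p * ?F (source i) j
      + shift i p * shift j p * ?F (source i) (source j)"
    unfolding sp_def sum_distrib_left sum.distrib[symmetric]
    by (intro sum.cong refl) (simp only: algebra_simps)
  also have "\<dots> = phi n i j + shift j p * phi n i (source j) + shift i p * phi n (source i) j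
      + shift i p * shift j p * phi n (source i) (source j)"
    by (simp only: s_pairing[OF assms(2)] assms src)
  also have "\<dots> = phi n i j" by (rule phi_shift[OF assms(1,3,4)])
  finally show ?thesis .
qed

lemma sp_upper:
  assumes "n \<ge> 3" "p \<in> T" "1 \<le> i" "i < j" "j \<le> n + 1"
  shows "sp i j p = 0"
  using assms s_upper[OF assms(2), of i j] s_upper[OF assms(2), of 1 j]
  by (auto simp: sp_def shift_def source_def)

lemma sp_eq_s:
  assumes "i \<noteq> 2 \<or> j \<noteq> 1" "i \<noteq> n + 1" "p \<in> T" "1 \<le> j" "j \<le> n + 1"
  shows "sp i j p = s i j p"
  using assms s_upper[OF assms(3), of 1 j] by (auto simp: sp_def shift_def source_def)

lemma sp_21: "n \<ge> 3 \<Longrightarrow> p \<in> T \<Longrightarrow> sp 2 1 p = 0"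
  using s_11[of p] by (simp add: sp_def shift_def source_def)

lemma sp_last: "n \<ge> 3 \<Longrightarrow> sp (n + 1) j p = s (n + 1) j p + s 2 1 p * s n j p"
  by (simp add: sp_def shift_def source_def)

text \<open>Only the corner (n + 1, 1) has distance n from the diagonal. For n \<ge> 3 the corner of
  \<open>sp\<close> is a dependent entry if n is even and a generator if n is odd in Option 1. In
  Option 2 with n odd the generator is s_{n+1,1} instead, from which it differs by t_2 s_{n,1}, so
  it is left out.\<close>

definition corner_bound :: "variant \<Rightarrow> nat" where
  "corner_bound v = (if special v \<or> even n then n else n - 1)"

text \<open>The independent entries of \<open>sp\<close> are available without t_2: entry (2, 1) is
  0, the corner is a generator where the bound admits it among them, and the others are those of
  S.\<close>

lemma sp_weighted:
  assumes n: "n \<ge> 3" and "1 \<le> j" "j \<le> i" "i \<le> n + 1" "i - j \<le> corner_bound v"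
  shows "WT v False (entry_weight i j) (sp i j)"
proof -
  have ind: "WT v False (col_weight n * int j + row_weight n i) (sp i j)"
    if ij: "1 \<le> j" "j \<le> i" "i \<le> n + 1" "i - j \<le> corner_bound v"
      "i + j < n + 2 \<or> i + j = n + 2 \<and> (odd n \<or> i = j)" for i j
    unfolding entry_weight_def[symmetric]
  proof -
    consider "(i, j) = (2, 1)" | "i = n + 1" | "(i, j) \<noteq> (2, 1)" "i \<noteq> n + 1" by blast
    then show "WT v False (entry_weight i j) (sp i j)"
    proof cases
      case 1
      then show ?thesis
        by (intro weighted_cong[OF weighted_zero refl]) (use sp_21[OF n] in simp)
    next
      case 2
      then have "j = 1" "odd n" using ij n by auto
      then have sv: "special v" using ij(4) 2 n by (auto simp: corner_bound_def split: if_splits)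
      show ?thesis
        unfolding 2 \<open>j = 1\<close>
        by (rule weighted_cong[OF gen_corner[OF sv] refl]) (simp only: corner_def sp_last[OF n])
    next
      case 3
      then have "WT v False (entry_weight i j) (s i j)"
        using gen_mid_or_position[of j i False v] ij by auto
      then show ?thesis
        by (rule weighted_cong) (use sp_eq_s 3 ij in auto)
    qed
  qed
  have inv: "WT v False (- (col_weight n * int q + row_weight n q)) (\<lambda>p. 1 / sp q q p)"
    if "1 \<le> q" "2 * q < n + 2" for q
    using inverse_small_diagonal[OF that] unfolding entry_weight_def
    by (rule weighted_cong) (use sp_eq_s[of q q] that in auto)
  have "WT v False (col_weight n * int (i - (i - j)) + row_weight n i) (sp i (i - (i - j)))"
    by (rule dependent_entries[where E = "corner_bound v"])
      (use assms sp_upper[OF n] sp_pairing[OF n] generators_base ind inv in auto)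
  then show ?thesis using assms by (simp add: entry_weight_def)
qed

text \<open>In the rows up to n the shift changes only s_21, so all other entries there are already
  free of t_2.\<close>

lemma s_weighted_modular:
  assumes n: "n \<ge> 3" and "1 \<le> j" "j \<le> i" "i \<le> n" "(i, j) \<noteq> (2, 1)"
  shows "WT v False (entry_weight i j) (s i j)"
  by (rule weighted_cong[OF sp_weighted[OF n, of j i v]])
    (use assms sp_eq_s in \<open>auto simp: corner_bound_def\<close>)

text \<open>The reciprocal of the weight of t_1; with this factor the Ramanujan-Serre term cancels
  -t_1 t_2 in R t_1.\<close>

definition serre_factor :: complex where
  "serre_factor = 1 - of_bool (n = 2) / 2"

lemma serre_factor_col: "serre_factor * of_int (col_weight n) = 1"
  by (simp add: serre_factor_def col_weight_def)

text \<open>In Option 1 one can take \<open>C = 0\<close>. In Option 2 the correction of the vector field removes the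
  term \<open>t\<^sub>2 C\<close>.\<close>

definition modular_generator :: "vfield \<Rightarrow> variant \<Rightarrow> int \<Rightarrow> (point \<Rightarrow> complex) \<Rightarrow> bool" where
  "modular_generator R v w f \<longleftrightarrow> (\<exists>A C. WT v False (w + 2) A \<and> WT v False w C \<and>
     (\<forall>p\<in>T. der R f p + serre_factor * of_int w * s 2 1 p * f p = A p + s 2 1 p * C p) \<and>
     (\<forall>p\<in>T. C p = 0 \<or> v = Option2 \<and> n \<ge> 3))"

lemma modular_generatorI:
  assumes "WT v False (w + 2) A"
    "\<And>p. p \<in> T \<Longrightarrow> der R f p + serre_factor * of_int w * s 2 1 p * f p = A p"
  shows "modular_generator R v w f"
  unfolding modular_generator_def
  by (rule exI[of _ A], rule exI[of _ "\<lambda>_. 0"]) (use assms weighted_zero in auto)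

lemma modular_generatorI_correction:
  assumes "WT v False (w + 2) A" "WT v False w C" "v = Option2" "n \<ge> 3"
    "\<And>p. p \<in> T \<Longrightarrow> der R f p + serre_factor * of_int w * s 2 1 p * f p = A p + s 2 1 p * C p"
  shows "modular_generator R v w f"
  unfolding modular_generator_def using assms by blast

text \<open>When the relation for u^2 is differentiated, the t_2 terms combine to -(n + 2) t_2 u^2.
  The Ramanujan-Serre term cancels them because u^2 has the weight of t_{n+2}.\<close>

lemma modular_generator_mid:
  assumes vR: "vector_field n \<Omega> R" and n: "even n"
    and da: "\<And>p. p \<in> T \<Longrightarrow> der R ta p = s 2 2 p - ta p * s 2 1 p"
    and db: "\<And>p. p \<in> T \<Longrightarrow> der R tb p = - of_nat (n + 2) * tb p * s 2 1 p"
  shows "modular_generator R v (entry_weight mid mid) (s mid mid)"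
proof -
  note mid = mid_range[OF n]
  have w: "2 * entry_weight mid mid = col_weight n * int (n + 2)"
    using mid row_weight_mid[OF n] by (simp add: entry_weight_def flip: distrib_left of_nat_add)
  \<comment> \<open>After the cancellation (n + 2) t_1^(n+1) s_22 / \<open>Om_const mid\<close>
    remains, to be divided by 2 u.\<close>
  define k where "k = of_nat (n + 2) / (2 * Om_const mid)"
  let ?A = "\<lambda>p. k * (ta p ^ (n + 1) * s 2 2 p * (1 / s mid mid p))"
  have "2 \<in> {1..n + 1}" using n_pos by auto
  then have "WT v False (int (n + 1) * col_weight n + (col_weight n + 2) + - entry_weight mid mid) ?A"
    using diagonal_weighted(1)[of 2 v False, unfolded entry_weight_22] mid
    by (intro weighted_cmult weighted_mult weighted_power gen_ta diagonal_weighted(2)) auto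
  then have "WT v False (entry_weight mid mid + 2) ?A"
    by (rule weighted_cong) (use w in \<open>simp_all add: algebra_simps\<close>)
  then show ?thesis
  proof (rule modular_generatorI)
    fix p assume p: "p \<in> T"
    define u where "u = s mid mid p"
    have u0: "u \<noteq> 0" using s_diagonal_nonzero[OF p] mid by (simp add: u_def)
    define x where "x = 1 / Om_const mid"
    have uu: "u * u = x * (ta p ^ (n + 2) - tb p)" unfolding u_def x_def by (rule s_mid_square[OF n p])
    have du: "2 * u * der R (s mid mid) p =
        x * (of_nat (n + 2) * ta p ^ (n + 1) * (s 2 2 p - ta p * s 2 1 p)
          + of_nat (n + 2) * tb p * s 2 1 p)"
      unfolding u_def x_def der_mid[OF vR n p] da[OF p] db[OF p]
      by (simp only: mult_minus_left diff_minus_eq_add)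
    have "2 * (serre_factor * of_int (entry_weight mid mid)) =
        serre_factor * complex_of_int (2 * entry_weight mid mid)" by simp
    also have "\<dots> = of_nat (n + 2)"
      unfolding w using serre_factor_col by (simp add: mult.assoc[symmetric])
    finally have k2: "2 * (serre_factor * of_int (entry_weight mid mid)) = complex_of_nat (n + 2)" .
    have "2 * u * (der R (s mid mid) p + serre_factor * of_int (entry_weight mid mid) * s 2 1 p * u) =
        2 * u * der R (s mid mid) p
        + 2 * (serre_factor * of_int (entry_weight mid mid)) * s 2 1 p * (u * u)"
      by (simp add: algebra_simps)
    also have "\<dots> = x * of_nat (n + 2) * ta p ^ (n + 1) * s 2 2 p"
      unfolding du k2 uu by (simp add: algebra_simps)
    also have "\<dots> = 2 * u * (k * (ta p ^ (n + 1) * s 2 2 p * (1 / u)))"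
      using u0 by (simp add: k_def x_def)
    finally have eq: "2 * u * (der R (s mid mid) p + serre_factor * of_int (entry_weight mid mid) * s 2 1 p * u) =
        2 * u * (k * (ta p ^ (n + 1) * s 2 2 p * (1 / u)))" .
    have "2 * u \<noteq> 0" using u0 by simp
    from iffD1[OF mult_left_cancel[OF this] eq]
    show "der R (s mid mid) p + serre_factor * of_int (entry_weight mid mid) * s 2 1 p * s mid mid p
        = k * (ta p ^ (n + 1) * s 2 2 p * (1 / s mid mid p))"
      unfolding u_def .
  qed
qed

lemma Stirling_1': "Stirling (n + 2) 1 = 1"
  using Stirling_1[of "n + 1"] by simp

text \<open>For an entry in column k, the term -k t_2 s_ik of its derivative is compensated by the
  column part of the weight. What the row part adds must be matched by another t_2 term, which
  depends on the row.\<close>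

lemma modular_generator_chart:
  assumes R: "modular_vector_field n \<Omega> R" and j: "j \<in> idx False"
  shows "modular_generator R v (weight n j) (chart v n \<Omega> j)"
proof -
  have vR: "vector_field n \<Omega> R" using R by (auto simp: modular_vector_field_def)
  obtain y where y1: "\<And>p. y 1 p = 1" and yn: "\<And>p. n \<ge> 2 \<Longrightarrow> y n p = -1"
    and y: "\<And>p i. p \<in> T \<Longrightarrow> i \<in> {1..n} \<Longrightarrow> y i p * s (i + 1) (i + 1) p = s i i p * s 2 2 p"
    and da: "\<And>p. p \<in> T \<Longrightarrow> der R ta p = s 2 2 p - ta p * s 2 1 p"
    and db: "\<And>p. p \<in> T \<Longrightarrow> der R tb p = - of_nat (n + 2) * tb p * s 2 1 p"
    and upper: "\<And>p i j. p \<in> T \<Longrightarrow> i \<in> {1..n} \<Longrightarrow> j \<in> {1..n + 1} \<Longrightarrow>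
      der R (s i j) p = y i p * s (i + 1) j p - s 2 2 p * s_prev i j p - of_nat j * s 2 1 p * s i j p"
    and last: "\<And>p j. p \<in> T \<Longrightarrow> j \<in> {1..n} \<Longrightarrow>
      der R (s (n + 1) j) p = of_nat (Stirling (n + 2) j) * ta p ^ j *
        (s (n + 1) (n + 1) p * (1 / (ta p ^ (n + 2) - tb p))) * s 2 2 p
        - s 2 2 p * s_prev (n + 1) j p - of_nat j * s 2 1 p * s (n + 1) j p"
    by (rule modular_derivatives[OF R]) (rule that)
  have s22: "WT v False (col_weight n + 2) (s 2 2)"
    using diagonal_weighted(1)[of 2 v False, unfolded entry_weight_22] n_pos by auto
  consider "j = 1" | "j = n + 2" | "j \<in> index_I n - {1, n + 2}" "j \<noteq> 2"
    using j by (auto simp: idx_def)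
  then show ?thesis
  proof cases
    case 1
    show ?thesis
      unfolding 1 chart_basic weight_basic[OF n_pos]
    proof (rule modular_generatorI[OF s22])
      fix p assume p: "p \<in> T"
      then show "der R (on_set T ta) p + serre_factor * of_int (col_weight n) * s 2 1 p * on_set T ta p = s 2 2 p"
        unfolding der_on_set da[OF p] serre_factor_col by simp
    qed
  next
    case 2
    show ?thesis
      unfolding 2 chart_basic weight_basic[OF n_pos]
    proof (rule modular_generatorI[OF weighted_zero])
      fix p assume p: "p \<in> T"
      have k: "serre_factor * complex_of_int (col_weight n * int (n + 2)) = of_nat (n + 2)"
        unfolding of_int_mult mult.assoc[symmetric] serre_factor_col by simp
      show "der R (on_set T tb) p + serre_factor * of_int (col_weight n * int (n + 2)) * s 2 1 p * on_set T tb p = 0"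
        unfolding der_on_set db[OF p] k on_set_in[OF p] by (simp add: algebra_simps)
    qed
  next
    case 3
    obtain i k where pos: "position n j = (i, k)" by (cases "position n j")
    have ik_pos: "(i, k) \<in> set (positions n)" using position_in[OF n_pos 3(1)] pos by simp
    have ne: "(i, k) \<noteq> (2, 1)"
      using position_inj[OF n_pos 3(1) basic_indices(3)[OF n_pos]] pos basic_indices(4)[OF n_pos] 3(2) by auto
    have ik: "1 \<le> k" "k \<le> i" "i \<le> n + 1" "2 \<le> i" "i + k \<le> n + 2" "even n \<longrightarrow> i + k < n + 2"
      using ik_pos unfolding set_positions by (auto split: if_splits)
    \<comment> \<open>For n \<le> 2 the only position is (2, 1), that of t_2.\<close>
    have n: "n \<ge> 3" using ik ne by (cases "n = 1"; cases "n = 2") auto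
    have odd_cases: "i = n + 1 \<Longrightarrow> k = 1 \<and> odd n" using ik by auto
    have sf: "serre_factor = 1" and cw: "col_weight n = 1"
      using n by (simp_all add: serre_factor_def col_weight_def)
    have w: "weight n j = entry_weight i k"
      using weight_position[OF n_pos 3(1) pos] by (simp add: entry_weight_def)
    have prev: "WT v False (entry_weight i k + 2) (\<lambda>p. s 2 2 p * s_prev i k p)"
      if "i \<noteq> 2" "i \<le> n"
    proof (cases "2 \<le> k")
      case True
      have "WT v False (entry_weight i (k - 1)) (s i (k - 1))"
        by (rule s_weighted_modular[OF n]) (use True ik that in auto)
      from weighted_mult[OF s22 this] show ?thesis
        by (rule weighted_cong) (use True in \<open>auto simp: s_prev_def entry_weight_def cw\<close>)
    next
      case False
      then show ?thesis by (intro weighted_cong[OF weighted_zero refl]) (simp add: s_prev_def)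
    qed
    have next_row: "WT v False (entry_weight i k + 2) (\<lambda>p. y i p * s (i + 1) k p)" if i: "i < n"
    proof -
      have "WT v False (entry_weight (i + 1) k) (s (i + 1) k)"
        by (rule s_weighted_modular[OF n]) (use i ik in auto)
      moreover have "i \<in> {1..n + 1}" "i + 1 \<in> {1..n + 1}" using i ik by auto
      ultimately have "WT v False (entry_weight i i + (col_weight n + 2) + - entry_weight (i + 1) (i + 1) + entry_weight (i + 1) k)
          (\<lambda>p. s i i p * s 2 2 p * (1 / s (i + 1) (i + 1) p) * s (i + 1) k p)"
        by (intro weighted_mult diagonal_weighted s22)
      then show ?thesis
      proof (rule weighted_cong)
        fix p assume p: "p \<in> T"
        have "y i p = s i i p * s 2 2 p * (1 / s (i + 1) (i + 1) p)"
          using y[OF p, of i] s_diagonal_nonzero[OF p, of "i + 1"] i ik by (simp add: field_simps)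
        then show "s i i p * s 2 2 p * (1 / s (i + 1) (i + 1) p) * s (i + 1) k p = y i p * s (i + 1) k p"
          by simp
      qed (simp add: entry_weight_def algebra_simps)
    qed
    show ?thesis
    proof (cases "special v \<and> (i, k) = (n + 1, 1)")
      case True
      then have c: "chart v n \<Omega> j = on_set T corner"
        using position_inj[OF n_pos 3(1) last_indices(1)] last_indices(2) pos chart_special
        by (metis special_def)
      have w2: "entry_weight (n + 1) 1 = 2" "entry_weight n 1 = 0"
        using n by (auto simp: entry_weight_def col_weight_def row_weight_def)
      have n1: "n \<in> {1..n}" "n \<in> {1..n + 1}" "1 \<in> {1..n}" "1 \<in> {1..n + 1}" "n + 1 \<in> {1..n + 1}" "2 \<in> {1..n}" "3 \<in> {1..n + 1}"
        using n by auto
      define Z where "Z = (\<lambda>p. ta p * (s (n + 1) (n + 1) p * (1 / (ta p ^ (n + 2) - tb p))) * s 2 2 p)"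
      have three: "2 + 1 = (3 :: nat)" by simp
      define Y2 where "Y2 = (\<lambda>p. s 2 2 p * s 2 2 p * (1 / s 3 3 p) * s 3 1 p)"
      have Y2: "y 2 p * s 3 1 p = Y2 p" if p: "p \<in> T" for p
        using y[OF p n1(6), unfolded three] s_diagonal_nonzero[OF p n1(7)] by (simp add: Y2_def field_simps)
      have "WT v False (col_weight n + (entry_weight (n + 1) (n + 1) + - (col_weight n * int (n + 2))) + (col_weight n + 2)) Z"
        unfolding Z_def
        by (intro weighted_mult gen_ta diagonal_weighted s22 n1)
          (use generators_base in \<open>auto simp: base_def\<close>)
      then have Z: "WT v False (2 + 2) Z"
        by (rule weighted_cong) (use w2(1) in \<open>simp_all add: entry_weight_def cw\<close>)
      have sn1: "WT v False 0 (s n 1)"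
        using s_weighted_modular[OF n, of 1 n v] n w2 by auto
      have s31: "WT v False (entry_weight 3 1) (s 3 1)"
        using s_weighted_modular[OF n, of 1 3 v] n by auto
      have "WT v False ((col_weight n + 2) + (col_weight n + 2) + - entry_weight 3 3 + entry_weight 3 1) Y2"
        unfolding Y2_def by (intro weighted_mult s22 diagonal_weighted s31 n1)
      then have "WT v False (2 + 2) Y2"
        by (rule weighted_cong) (simp_all add: entry_weight_def cw)
      from weighted_add[OF Z weighted_cong[OF weighted_mult[OF this sn1]]]
      have A: "WT v False (2 + 2) (\<lambda>p. Z p + Y2 p * s n 1 p)" by simp
      have reg: "regular (s (n + 1) 1)" "regular (s 2 1)" "regular (s n 1)"
        using weighted_regular[OF s_weighted] n by simp_all
      show ?thesis
        unfolding w c True[THEN conjunct2, unfolded prod.inject, THEN conjunct1]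
          True[THEN conjunct2, unfolded prod.inject, THEN conjunct2] w2(1)
      proof (rule modular_generatorI[OF A])
        fix p assume p: "p \<in> T"
        \<comment> \<open>Since y_n = -1, the t_2 terms outside the derivative of s_21 in row 3 add
          up to -2 t_2 s_{n+1,1} - 2 t_2^2 s_{n,1} = -2 t_2 \<open>corner\<close>, and 2 is the
          weight of \<open>corner\<close>.\<close>
        have "der R corner p = der R (s (n + 1) 1) p + der R (\<lambda>p. s 2 1 p * s n 1 p) p"
          using fun_cong[OF der_add[OF vR reg(1) regular_mult[OF reg(2,3)]], of p]
          by (simp only: corner_def[abs_def])
        also have "der R (\<lambda>p. s 2 1 p * s n 1 p) p = der R (s 2 1) p * s n 1 p + s 2 1 p * der R (s n 1) p"
          by (rule der_mult[OF vR reg(2,3) p])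
        also have "der R (s 2 1) p = Y2 p - s 2 1 p * s 2 1 p"
          using upper[OF p n1(6) n1(4), unfolded three] Y2[OF p] by (simp add: s_prev_def)
        also have "der R (s n 1) p = - s (n + 1) 1 p - s 2 1 p * s n 1 p"
          using upper[OF p n1(1) n1(4)] yn[of p] n by (simp add: s_prev_def)
        also have "der R (s (n + 1) 1) p = Z p - s 2 1 p * s (n + 1) 1 p"
          using last[OF p n1(3), unfolded Stirling_1'] by (simp add: s_prev_def Z_def)
        finally have dc: "der R corner p = Z p - s 2 1 p * s (n + 1) 1 p +
          ((Y2 p - s 2 1 p * s 2 1 p) * s n 1 p + s 2 1 p * (- s (n + 1) 1 p - s 2 1 p * s n 1 p))" .
        show "der R (on_set T corner) p + serre_factor * of_int 2 * s 2 1 p * on_set T corner p =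
            Z p + Y2 p * s n 1 p"
          unfolding der_on_set sf on_set_in[OF p] dc by (simp add: corner_def algebra_simps)
      qed
    next
      case False
      then have c: "chart v n \<Omega> j = on_set T (s i k)" by (intro chart_position[OF 3(1) pos])
      have not_special: "v = Option2" if "\<not> special v" "odd n"
        using that n by (cases v) (auto simp: special_def)
      consider "i = 2" | "3 \<le> i" "i < n" | "i = n" | "i = n + 1" using ik n by linarith
      then show ?thesis
        unfolding w c
      proof cases
        case 1
        then have k: "k = 2" using ik ne by auto
        have i: "i < n" "i \<in> {1..n}" "k \<in> {1..n + 1}" using 1 n k by auto
        show "modular_generator R v (entry_weight i k) (on_set T (s i k))"
        proof (rule modular_generatorI[OF next_row[OF i(1)]])
          fix p assume p: "p \<in> T"
          \<comment> \<open>Here \<open>s_prev\<close> is t_2 itself, so -s_22 t_2 joins -2 t_2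
            s_22; the total coefficient 3 is the weight.\<close>
          have "entry_weight i k = 3" using n 1 k by (simp add: entry_weight_def row_weight_def cw)
          then show "der R (on_set T (s i k)) p + serre_factor * of_int (entry_weight i k) * s 2 1 p * on_set T (s i k) p
              = y i p * s (i + 1) k p"
            unfolding der_on_set upper[OF p i(2,3)] sf using p 1 k by (simp add: s_prev_def algebra_simps)
        qed
      next
        case 2
        then have i: "i \<in> {1..n}" "k \<in> {1..n + 1}" "i \<noteq> 2" "i \<le> n" using ik by auto
        show "modular_generator R v (entry_weight i k) (on_set T (s i k))"
        proof (rule modular_generatorI[OF weighted_diff[OF next_row[OF 2(2)] prev[OF i(3,4)]]])
          fix p assume p: "p \<in> T"
          have "entry_weight i k = int k" using n 2 by (simp add: entry_weight_def row_weight_def cw)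
          then show "der R (on_set T (s i k)) p + serre_factor * of_int (entry_weight i k) * s 2 1 p * on_set T (s i k) p
              = y i p * s (i + 1) k p - s 2 2 p * s_prev i k p"
            unfolding der_on_set upper[OF p i(1,2)] sf using p by simp
        qed
      next
        case 3
        then have i: "n \<in> {1..n}" "k \<in> {1..n + 1}" "n \<noteq> 2" "n \<le> n" using ik n by auto
        have ew: "entry_weight n k = int k - 1" "entry_weight (n + 1) k = entry_weight n k + 2"
          using n by (auto simp: entry_weight_def row_weight_def cw)
        \<comment> \<open>Row n has weight k - 1, so -t_2 s_{n,k} is left over; as y_n = -1, it
          combines with -s_{n+1,k} to minus the shifted entry.\<close>
        have der: "der R (on_set T (s n k)) p + serre_factor * of_int (entry_weight n k) * s 2 1 p * on_set T (s n k) p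
            = - sp (n + 1) k p - s 2 2 p * s_prev n k p" if p: "p \<in> T" for p
          unfolding der_on_set upper[OF p i(1,2)] sf ew(1) sp_last[OF n] using p n yn[of p]
          by (simp add: algebra_simps)
        show "modular_generator R v (entry_weight i k) (on_set T (s i k))"
          unfolding 3
        proof (cases "n + 1 - k \<le> corner_bound v")
          case True
          have "WT v False (entry_weight n k + 2) (\<lambda>p. s 2 2 p * s_prev n k p)"
            using prev i(3,4) unfolding 3 by blast
          moreover have "WT v False (entry_weight n k + 2) (sp (n + 1) k)"
            using sp_weighted[OF n, of k "n + 1" v] True ik 3 ew(2) by simp
          ultimately have "WT v False (entry_weight n k + 2) (\<lambda>p. - sp (n + 1) k p - s 2 2 p * s_prev n k p)"
            by (intro weighted_diff weighted_minus)
          then show "modular_generator R v (entry_weight n k) (on_set T (s n k))"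
            by (rule modular_generatorI) (rule der)
        next
          case False
          \<comment> \<open>What remains is the corner in Option 2 with n odd: s_{n+1,1} is a
            generator there, and the term with t_2 goes into C.\<close>
          then have k: "k = 1" and "\<not> special v" "odd n"
            using ik(1) by (auto simp: corner_bound_def split: if_splits)
          then have v: "v = Option2" using not_special by blast
          have pos1: "(n + 1, 1) \<in> set (positions n)" using \<open>odd n\<close> n by (simp add: set_positions)
          have "WT v False (entry_weight (n + 1) 1) (s (n + 1) 1)"
            by (rule gen_s[OF pos1]) (use n \<open>\<not> special v\<close> in auto)
          then have A: "WT v False (entry_weight n 1 + 2) (\<lambda>p. - s (n + 1) 1 p)"
            using ew(2) k by (intro weighted_minus) simp
          have C: "WT v False (entry_weight n 1) (\<lambda>p. - s n 1 p)"
            by (intro weighted_minus s_weighted_modular[OF n]) (use n in auto)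
          show "modular_generator R v (entry_weight n k) (on_set T (s n k))"
            unfolding k
          proof (rule modular_generatorI_correction[OF A C v n])
            fix p assume p: "p \<in> T"
            show "der R (on_set T (s n 1)) p + serre_factor * of_int (entry_weight n 1) * s 2 1 p * on_set T (s n 1) p
              = - s (n + 1) 1 p + s 2 1 p * - s n 1 p"
              unfolding der[OF p, unfolded k] sp_last[OF n] by (simp add: s_prev_def)
          qed
        qed
      next
        case 4
        then have k: "k = 1" and "odd n" using odd_cases by auto
        then have v: "v = Option2" using False 4 not_special by auto
        have w2: "entry_weight (n + 1) 1 = 2"
          using n by (auto simp: entry_weight_def row_weight_def cw)
        have n1: "n + 1 \<in> {1..n + 1}" "1 \<in> {1..n}" using n by auto
        define Z where "Z = (\<lambda>p. ta p * (s (n + 1) (n + 1) p * (1 / (ta p ^ (n + 2) - tb p))) * s 2 2 p)"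
        have "WT v False (col_weight n + (entry_weight (n + 1) (n + 1) + - (col_weight n * int (n + 2))) + (col_weight n + 2)) Z"
          unfolding Z_def
          by (intro weighted_mult gen_ta diagonal_weighted s22 n1)
            (use generators_base in \<open>auto simp: base_def\<close>)
        then have Z: "WT v False (entry_weight (n + 1) 1 + 2) Z"
          by (rule weighted_cong) (use w2 in \<open>simp_all add: entry_weight_def cw\<close>)
        \<comment> \<open>The weight 2 exceeds by one the factor of -t_2 s_{n+1,1} in the
          derivative; the excess is C.\<close>
        have C: "WT v False (entry_weight (n + 1) 1) (s (n + 1) 1)"
          by (rule gen_s) (use n ik_pos 4 k False in auto)
        show "modular_generator R v (entry_weight i k) (on_set T (s i k))"
          unfolding 4 k
        proof (rule modular_generatorI_correction[OF Z C v n])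
          fix p assume p: "p \<in> T"
          show "der R (on_set T (s (n + 1) 1)) p
              + serre_factor * of_int (entry_weight (n + 1) 1) * s 2 1 p * on_set T (s (n + 1) 1) p
            = Z p + s 2 1 p * s (n + 1) 1 p"
            unfolding der_on_set last[OF p n1(2)] Stirling_1' sf w2 using p by (simp add: s_prev_def Z_def)
        qed
      qed
    qed
  qed
qed

text \<open>In Option 2, R g = A + t_2 X with A and X free of t_2. The derivative by t_2 kills g, A
  and X, so its commutator with R sends g to -X. For n \<ge> 3 the correction thus replaces t_2 X by
  -w t_2 g, which the Ramanujan-Serre term cancels. For n \<le> 2 one has C = 0, and the correction
  vanishes on g.\<close>

lemma D_modular_generator:
  assumes D: "D_vector_field v n \<Omega> D" and g: "WT v False w g"
    and gen: "\<And>R. modular_vector_field n \<Omega> R \<Longrightarrow> modular_generator R v w g"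
  shows "WT v False (w + 2) (\<lambda>p. der D g p + serre_factor * of_int w * s 2 1 p * g p)"
proof (cases v)
  case Option1
  then have "modular_vector_field n \<Omega> D" using D by (simp add: D_vector_field_def)
  from gen[OF this] obtain A C where A: "WT v False (w + 2) A"
    and eq: "\<And>p. p \<in> T \<Longrightarrow> der D g p + serre_factor * of_int w * s 2 1 p * g p = A p + s 2 1 p * C p"
    and C: "\<And>p. p \<in> T \<Longrightarrow> C p = 0"
    unfolding modular_generator_def using Option1 by auto
  show ?thesis
  proof (rule weighted_cong[OF A refl])
    fix p assume p: "p \<in> T"
    show "A p = der D g p + serre_factor * of_int w * s 2 1 p * g p"
      unfolding eq[OF p] C[OF p] by simp
  qed
next
  case Option2
  obtain R P H where R: "modular_vector_field n \<Omega> R" and P: "partial_vector_field n \<Omega> 2 P"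
    and H: "H_vector_field n \<Omega> H" and "vector_field n \<Omega> D" and formula: "\<And>f p. regular f \<Longrightarrow>
      der D f p = der R f p + on_set T (s 2 1) p *
      (of_int (col_weight n) * (der R (der P f) p - der P (der R f) p) - der H f p)"
    by (rule D_option2[OF D[unfolded Option2]]) (rule that)
  have vR: "vector_field n \<Omega> R" and vP: "vector_field n \<Omega> P"
    using R P by (auto simp: modular_vector_field_def partial_vector_field_def)
  from gen[OF R] obtain A C where A: "WT v False (w + 2) A" and C: "WT v False w C"
    and eq: "\<And>p. p \<in> T \<Longrightarrow> der R g p + serre_factor * of_int w * s 2 1 p * g p = A p + s 2 1 p * C p"
    and C0: "\<And>p. p \<in> T \<Longrightarrow> C p = 0 \<or> n \<ge> 3"
    unfolding modular_generator_def by blast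
  define X where "X = (\<lambda>p. C p + - (serre_factor * of_int w) * g p)"
  have X: "WT v False w X" unfolding X_def by (intro weighted_add C weighted_cmult g)
  have Rg: "der R g p = A p + s 2 1 p * X p" if "p \<in> T" for p
    using eq[OF that] by (simp add: X_def algebra_simps)
  have reg: "regular A" "regular (s 2 1)" "regular X"
    using weighted_regular A X s_21_weighted by blast+
  show ?thesis
  proof (rule weighted_cong[OF A refl])
    fix p assume p: "p \<in> T"
    note zero = partial_zero[OF P _ p]
    have "der R (der P g) = der R (\<lambda>_. 0)"
      by (rule der_cong) (use partial_zero[OF P] g Option2 in auto)
    then have 1: "der R (der P g) p = 0" using der_const[OF vR p] by simp
    have "der P (der R g) = der P (\<lambda>p. A p + s 2 1 p * X p)" by (rule der_cong) (rule Rg)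
    then have "der P (der R g) p = der P A p + der P (\<lambda>p. s 2 1 p * X p) p"
      using der_add[OF vP reg(1) regular_mult[OF reg(2,3)]] by simp
    also have "\<dots> = X p"
      using der_mult[OF vP reg(2,3) p] partial_s_21[OF P p] zero A X Option2 by simp
    finally have 2: "der P (der R g) p = X p" .
    define q where "q = s 2 1 p * X p + s 2 1 p * (of_int (col_weight n) * (0 - X p) - of_int w * g p)"
    have d: "der D g p = A p + q"
      unfolding q_def using formula[OF weighted_regular[OF g]] p Rg[OF p] 1 2 H_eigen[OF H g p] by simp
    have z: "q + serre_factor * of_int w * s 2 1 p * g p = 0"
      using C0[OF p]
    proof
      assume "C p = 0"
      then have "of_int (col_weight n) * X p = - (serre_factor * of_int (col_weight n)) * of_int w * g p"
        by (simp add: X_def algebra_simps)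
      then have "of_int (col_weight n) * X p = - of_int w * g p" unfolding serre_factor_col by simp
      then show ?thesis using \<open>C p = 0\<close> serre_factor_col by (simp add: q_def X_def algebra_simps)
    next
      assume "n \<ge> 3"
      then have "serre_factor = 1" "col_weight n = 1" by (simp_all add: serre_factor_def col_weight_def)
      then show ?thesis by (simp add: q_def X_def algebra_simps)
    qed
    show "A p = der D g p + serre_factor * of_int w * s 2 1 p * g p"
      unfolding d add.assoc z by simp
  qed
qed

lemma D_modular:
  assumes D: "D_vector_field v n \<Omega> D" and f: "WT v False r f"
  shows "WT v False (r + 2) (\<lambda>p. der D f p + serre_factor * of_int r * s 2 1 p * f p)"
proof (rule twisted_derivation[OF D_vector_field_vf[OF D] _ _ f])
  show "WT v False (weight n j + 2)
      (\<lambda>p. der D (chart v n \<Omega> j) p + serre_factor * of_int (weight n j) * s 2 1 p * chart v n \<Omega> j p)"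
    if "j \<in> idx False" for j
    by (rule D_modular_generator[OF D weighted_chart[OF that] modular_generator_chart[OF _ that]])
  show "WT v False (entry_weight mid mid + 2)
      (\<lambda>p. der D (s mid mid) p + serre_factor * of_int (entry_weight mid mid) * s 2 1 p * s mid mid p)"
    if "even n"
  proof (rule D_modular_generator[OF D gen_u[OF that]])
    fix R assume R: "modular_vector_field n \<Omega> R"
    obtain y where "\<And>p. y 1 p = 1" and "\<And>p. n \<ge> 2 \<Longrightarrow> y n p = -1"
      and "\<And>p i. p \<in> T \<Longrightarrow> i \<in> {1..n} \<Longrightarrow> y i p * s (i + 1) (i + 1) p = s i i p * s 2 2 p"
      and da: "\<And>p. p \<in> T \<Longrightarrow> der R ta p = s 2 2 p - ta p * s 2 1 p"
      and db: "\<And>p. p \<in> T \<Longrightarrow> der R tb p = - of_nat (n + 2) * tb p * s 2 1 p"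
      and "\<And>p i j. p \<in> T \<Longrightarrow> i \<in> {1..n} \<Longrightarrow> j \<in> {1..n + 1} \<Longrightarrow>
        der R (s i j) p = y i p * s (i + 1) j p - s 2 2 p * s_prev i j p - of_nat j * s 2 1 p * s i j p"
      and "\<And>p j. p \<in> T \<Longrightarrow> j \<in> {1..n} \<Longrightarrow>
        der R (s (n + 1) j) p = of_nat (Stirling (n + 2) j) * ta p ^ j *
          (s (n + 1) (n + 1) p * (1 / (ta p ^ (n + 2) - tb p))) * s 2 2 p
          - s 2 2 p * s_prev (n + 1) j p - of_nat j * s 2 1 p * s (n + 1) j p"
      by (rule modular_derivatives[OF R]) (rule that)
    then show "modular_generator R v (entry_weight mid mid) (s mid mid)"
      using modular_generator_mid[of R v] R \<open>even n\<close> by (simp add: modular_vector_field_def)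
  qed
qed

section \<open>Back to the graded algebras of forms\<close>

lemma homogeneous_iff_weighted:
  assumes "vanishing_outside T f"
  shows "(r, f) \<in> homogeneous T (Gen v full) \<longleftrightarrow> WT v full r f"
  using assms by (simp add: weighted_def vanishing_outside_def)

lemma QM_wt_eq: "QM_wt v n \<Omega> r = {f. (r, f) \<in> homogeneous T (Gen v True)}"
  by (simp add: QM_wt_def idx_def)

lemma MF_eq: "MF v n \<Omega> = generated_algebra T (snd ` Gen v False)"
  by (simp add: MF_def idx_def)

lemma QM_eq: "QM v n \<Omega> = generated_algebra T (snd ` Gen v True)"
  by (simp add: QM_def idx_def)

lemma D_vanishing:
  assumes "D_vector_field v n \<Omega> D" "(r, f) \<in> homogeneous T (Gen v full)"
  shows "vanishing_outside T (D f)"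
proof -
  have "f \<in> OT" using assms(2) by (rule homogeneous_O_T)
  then have "D f \<in> OT"
    using D_vector_field_vf[OF assms(1)] unfolding vector_field_def by blast
  then show ?thesis by (rule O_T_vanishing)
qed

lemma D_homogeneous:
  assumes "D_vector_field v n \<Omega> D" "(r, f) \<in> homogeneous T (Gen v True)"
  shows "(r + 2, D f) \<in> homogeneous T (Gen v True)"
proof -
  note van = homogeneous_vanishing_T[OF assms(2)]
  have "WT v True r f" using assms(2) homogeneous_iff_weighted[OF van] by blast
  from D_weighted[OF assms(1) this] have "WT v True (r + 2) (D f)"
    using van by (simp add: der_def vanishing_outside_def)
  then show ?thesis using homogeneous_iff_weighted[OF D_vanishing[OF assms]] by blast
qed

lemma serre_homogeneous:
  assumes D: "D_vector_field v n \<Omega> D" and Q: "ramanujan_serre v n \<Omega> D Q"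
    and f: "(r, f) \<in> homogeneous T (Gen v False)"
  shows "(r + 2, Q f) \<in> homogeneous T (Gen v False)"
proof -
  note van = homogeneous_vanishing_T[OF f]
  have "(r, f) \<in> homogeneous T (Gen v True)"
    using homogeneous_subst[OF f generators_full_subset] .
  then have Qf: "Q f = (\<lambda>p. D f p + serre_factor * of_int r * chart v n \<Omega> 2 p * f p)"
    using Q unfolding ramanujan_serre_def QM_wt_eq serre_factor_def by blast
  have "vanishing_outside T (Q f)"
    unfolding Qf using vanishing_outsideD[OF D_vanishing[OF D f]] vanishing_outsideD[OF van]
    by (intro vanishing_outsideI) simp
  moreover have "WT v False r f" using f homogeneous_iff_weighted[OF van] by blast
  from D_modular[OF D this] have "WT v False (r + 2) (Q f)"
    by (rule weighted_cong)
      (use van in \<open>simp_all add: Qf position_2 der_def vanishing_outside_def\<close>)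
  ultimately show ?thesis using homogeneous_iff_weighted by blast
qed

text \<open>An element of \<open>MF\<close> splits into summands homogeneous in the generators
  without t_2. \<open>serre_homogeneous\<close> applies to each of them, and additivity of
  \<open>Q\<close> on \<open>QM\<close> reassembles the result.\<close>

lemma serre_modular:
  assumes D: "D_vector_field v n \<Omega> D" and Q: "ramanujan_serre v n \<Omega> D Q"
    and f: "f \<in> MF v n \<Omega>"
  shows "Q f \<in> MF v n \<Omega>"
proof -
  have in_QM: "g \<in> QM v n \<Omega>" if "g \<in> MF v n \<Omega>" for g
  proof -
    have "snd ` Gen v False \<subseteq> generated_algebra T (snd ` Gen v True)"
    proof
      fix h assume "h \<in> snd ` Gen v False"
      then obtain r where "(r, h) \<in> Gen v False" by force
      then have "(r, h) \<in> homogeneous T (Gen v True)" using generators_full_subset by blast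
      then show "h \<in> generated_algebra T (snd ` Gen v True)" by (rule homogeneous_generated)
    qed
    with that show ?thesis unfolding QM_eq MF_eq by (rule generated_algebra_subst)
  qed
  have hom_MF: "h \<in> MF v n \<Omega>" if "(r, h) \<in> homogeneous T (Gen v False)" for r h
    unfolding MF_eq using that by (rule homogeneous_generated)
  have "f \<in> homogeneous_sums T (Gen v False)"
    using f unfolding MF_eq by (rule generated_algebra_homogeneous_sums)
  then have "f \<in> MF v n \<Omega> \<and> Q f \<in> MF v n \<Omega>"
  proof (induction rule: homogeneous_sums.induct)
    case zero
    have "(0, \<lambda>_. 0) \<in> homogeneous T (Gen v False)" by (rule homogeneous.zero)
    then show ?case using hom_MF serre_homogeneous[OF D Q] by blast
  next
    case (step r h f)
    have h: "h \<in> MF v n \<Omega>" "Q h \<in> MF v n \<Omega>"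
      using hom_MF serre_homogeneous[OF D Q] step(1) by blast+
    have "Q (\<lambda>p. h p + f p) = (\<lambda>p. Q h p + Q f p)"
      using Q in_QM h(1) step(3) unfolding ramanujan_serre_def by blast
    then show ?case using h step(3) unfolding MF_eq by (auto intro: generated_algebra.add)
  qed
  then show ?thesis ..
qed

end

theorem theorem1p1:
  fixes n :: nat and c :: complex and \<Omega> :: "complex \<Rightarrow> complex \<Rightarrow> complex mat"
    and v :: variant and D Q :: vfield
  assumes "n \<ge> 1"
    and "c \<noteq> 0"
    and "intersection_matrix n c \<Omega>"
    and "D_vector_field v n \<Omega> D"
    and "ramanujan_serre v n \<Omega> D Q"
  shows "(\<forall>r. D ` QM_wt v n \<Omega> r \<subseteq> QM_wt v n \<Omega> (r + 2)) \<and>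
         (\<forall>r. Q ` MF_wt v n \<Omega> r \<subseteq> MF_wt v n \<Omega> (r + 2)) \<and>
         Q ` MF v n \<Omega> \<subseteq> MF v n \<Omega>"
proof -
  interpret dwork n c \<Omega> by standard (use assms in auto)
  note D = assms(4) and Q = assms(5)
  \<comment> \<open>\<open>MF_wt\<close> is an intersection, so the image is controlled twice: its
    weight here, in the full algebra, and its membership in \<open>MF\<close> by
    \<open>serre_modular\<close>.\<close>
  have "Q f \<in> QM_wt v n \<Omega> (r + 2)" if f: "f \<in> QM_wt v n \<Omega> r" for r f
  proof -
    have hom: "(r, f) \<in> homogeneous T (Gen v True)" using f by (simp add: QM_wt_eq)
    have "(2, chart v n \<Omega> 2) \<in> homogeneous T (Gen v True)"
      using s_21_weighted[of v] by (simp add: weighted_def position_2)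
    from homogeneous.mult[OF homogeneous.mult[OF homogeneous.const this] hom]
    have "(r + 2, \<lambda>p. on_set T (\<lambda>_. serre_factor * of_int r) p * chart v n \<Omega> 2 p * f p)
        \<in> homogeneous T (Gen v True)"
      by (simp add: add.commute)
    moreover have "(\<lambda>p. on_set T (\<lambda>_. serre_factor * of_int r) p * chart v n \<Omega> 2 p * f p) =
        (\<lambda>p. serre_factor * of_int r * chart v n \<Omega> 2 p * f p)"
      using vanishing_outsideD[OF homogeneous_vanishing_T[OF hom]] by (auto simp: on_set_def)
    moreover have "Q f = (\<lambda>p. D f p + serre_factor * of_int r * chart v n \<Omega> 2 p * f p)"
      using Q f unfolding ramanujan_serre_def serre_factor_def by blast
    ultimately show ?thesis
      using homogeneous.add[OF D_homogeneous[OF D hom]] by (simp add: QM_wt_eq)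
  qed
  then show ?thesis
    using D_homogeneous[OF D] serre_modular[OF D Q] by (auto simp: QM_wt_eq MF_wt_def)
qed

end
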